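(* For every integer $r\ge 3$ there are constants $c,C>0$ and a sequence of numbers $(c_n)_{n\in\mathbb{N}}$ with $c_n\in(c,C)$ such that for every $\gamma>0$ \[ \lim_{n\to\infty}\mathbb{P}\big(\mathcal{R}^{(r)}(n,(c_n-\gamma)n^{3-r})\text{ is Turánnical}\big)=0 \quad\text{and}\quad \lim_{n\to\infty}\mathbb{P}\big(\mathcal{R}^{(r)}(n,(c_n+\gamma)n^{3-r})\text{ is Turánnical}\big)=1. \]
   Context: $\mathcal{R}^{(r)}(n,p)$ is the random $r$-uniform hypergraph on $[n]$ in which each $r$-subset is a hyperedge independently with probability $p$. $t_r(n)$ is the number of edges of the Turán graph $T_r(n)$, the complete balanced $(r-1)$-partite graph on $n$ vertices. An $r$-uniform hypergraph $\mathcal{F}$ on $[n]$ detects a graph $G$ on $[n]$ if some hyperedge of $\mathcal{F}$ induces a copy of $K_r$ in $G$; $\mathcal{F}$ is Turánnical if it detects every graph $G$ on $[n]$ with $e(G)>t_r(n)$. *)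

theory Defs
  imports "HOL-Library.Ramsey" "HOL-Probability.Probability"
begin

text \<open>
  A graph or an \<open>r\<close>-uniform hypergraph on \<open>[n] = {1..n}\<close> is represented by its edge set, that is by a
  subset of \<open>[{1..n}]\<^bsup>2\<^esup>\<close> or \<open>[{1..n}]\<^bsup>r\<^esup>\<close>, respectively. In the index-shifted convention used here, the
  Turan graph \<open>T\<^sub>r(n)\<close> has \<open>r - 1\<close> parts; the parts are the residue classes modulo \<open>r - 1\<close>,
  whose sizes differ by at most one (see \<open>residue_classes_balanced\<close>).
\<close>

definition turan_graph :: "nat \<Rightarrow> nat \<Rightarrow> nat set set" where
  "turan_graph r n = {{x, y} | x y. x \<in> {1..n} \<and> y \<in> {1..n} \<and> x mod (r - 1) \<noteq> y mod (r - 1)}"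

lemma residue_classes_balanced:
  fixes i j k n :: nat
  assumes "i < k" "j < k"
  shows "card {x \<in> {1..n}. x mod k = i} \<le> card {x \<in> {1..n}. x mod k = j} + 1"
proof -
  have eq: "card {x \<in> {1..n}. x mod k = l} = n div k + (if 0 < l \<and> l \<le> n mod k then 1 else 0)"
    if "l < k" for l
  proof (induction n)
    case 0
    show ?case by (cases "l = 0") auto
  next
    case (Suc n)
    have "{x \<in> {1..Suc n}. x mod k = l} =
        (if Suc n mod k = l then insert (Suc n) {x \<in> {1..n}. x mod k = l} else {x \<in> {1..n}. x mod k = l})"
      by (auto simp: le_Suc_eq)
    then have "card {x \<in> {1..Suc n}. x mod k = l} =
        card {x \<in> {1..n}. x mod k = l} + (if Suc n mod k = l then 1 else 0)"
      by auto
    with Suc that show ?case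
      by (auto simp: mod_Suc div_Suc split: if_splits)
  qed
  show ?thesis
    using eq[OF assms(1)] eq[OF assms(2)] by auto
qed

definition turan_number :: "nat \<Rightarrow> nat \<Rightarrow> nat" where
  "turan_number r n = card (turan_graph r n)"

definition detects :: "nat \<Rightarrow> nat set set \<Rightarrow> nat set set \<Rightarrow> bool" where
  "detects r F G \<longleftrightarrow> (\<exists>f\<in>F. card f = r \<and> clique f G)"

definition turannical :: "nat \<Rightarrow> nat \<Rightarrow> nat set set \<Rightarrow> bool" where
  "turannical r n F \<longleftrightarrow>
     F \<subseteq> [{1..n}]\<^bsup>r\<^esup> \<and> (\<forall>G. G \<subseteq> [{1..n}]\<^bsup>2\<^esup> \<and> card G > turan_number r n \<longrightarrow> detects r F G)"

text \<open>
  \<^const>\<open>bernoulli_pmf\<close> truncates its parameter to \<open>[0,1]\<close>: for \<open>p \<le> 0\<close> the random hypergraph is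
  almost surely empty, for \<open>p \<ge> 1\<close> almost surely complete.
\<close>

definition random_hypergraph :: "nat \<Rightarrow> nat \<Rightarrow> real \<Rightarrow> nat set set pmf" where
  "random_hypergraph r n p =
     map_pmf (\<lambda>b. {e \<in> [{1..n}]\<^bsup>r\<^esup>. b e}) (Pi_pmf ([{1..n}]\<^bsup>r\<^esup>) False (\<lambda>_. bernoulli_pmf p))"

end

(*
  Fix a pair e and call a hyperedge containing e rainbow for a vertex colouring with r - 1 colours that is
  constant on e if e is its only monochromatic pair. Let M(e) be the least number of rainbow hyperedges over
  all nearly balanced colourings. If M(e) = 0 is attained by an exactly balanced colouring, then the Turan
  graph of that colouring together with e is not detected. Conversely, if M(e) is linear in n for all e, then
  with high probability every graph with more than t_r(n) edges is detected: by stability an undetected graph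
  is close to a Turan graph, and its missing edges cannot meet all the rainbow hyperedges of its extra edges.
  The passage between the two conditions is sharp. If M(e) = o(n) has a probability that is not exponentially
  small, concentration shows that M(e) = o(n) holds with probability bounded below. Deleting a small constant
  proportion of the hyperedges then isolates linearly many vertices in the link of e, and recolouring these
  turns the colouring into an exactly balanced one without rainbow hyperedges. As boundedly many disjoint
  pairs e behave almost independently, one of them succeeds with high probability.
*)
theory Submission
  imports Defs "HOL-Real_Asymp.Real_Asymp"
begin

section \<open>Random subsets\<close>

text \<open>The expectation of \<open>f\<close> at a random subset of \<open>A\<close> with independent inclusions of probability \<open>p\<close>.\<close>

definition bexp :: "real \<Rightarrow> 'a set \<Rightarrow> ('a set \<Rightarrow> real) \<Rightarrow> real" where
  "bexp p A f = (\<Sum>S\<in>Pow A. p ^ card S * (1 - p) ^ card (A - S) * f S)"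

abbreviation bprob :: "real \<Rightarrow> 'a set \<Rightarrow> ('a set \<Rightarrow> bool) \<Rightarrow> real" where
  "bprob p A Q \<equiv> bexp p A (\<lambda>S. of_bool (Q S))"

lemma bexp_empty [simp]: "bexp p {} f = f {}"
  by (simp add: bexp_def)

lemma bexp_insert:
  assumes "finite A" "x \<notin> A"
  shows "bexp p (insert x A) f = p * bexp p A (\<lambda>S. f (insert x S)) + (1 - p) * bexp p A f"
proof -
  have inj: "inj_on (insert x) (Pow A)"
    using assms(2) by (auto simp: inj_on_def)
  have fin: "finite S" if "S \<subseteq> A" for S
    using that assms(1) finite_subset by blast
  have a: "card (insert x S) = Suc (card S)" "A - insert x S = A - S"
      "card (insert x A - S) = Suc (card (A - S))" if "S \<subseteq> A" for S
  proof -
    have "insert x A - S = insert x (A - S)" using that assms(2) by auto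
    then show "card (insert x A - S) = Suc (card (A - S))" using assms by simp
    have "x \<notin> S" using that assms(2) by auto
    then show "card (insert x S) = Suc (card S)" "A - insert x S = A - S"
      using fin[OF that] assms(2) by auto
  qed
  have "bexp p (insert x A) f
      = (\<Sum>S\<in>Pow A. p ^ card S * (1 - p) ^ card (insert x A - S) * f S)
        + (\<Sum>S\<in>insert x ` Pow A. p ^ card S * (1 - p) ^ card (insert x A - S) * f S)"
    unfolding bexp_def Pow_insert using assms by (intro sum.union_disjoint) auto
  also have "(\<Sum>S\<in>insert x ` Pow A. p ^ card S * (1 - p) ^ card (insert x A - S) * f S)
     = p * bexp p A (\<lambda>S. f (insert x S))"
    unfolding bexp_def sum.reindex[OF inj] sum_distrib_left
    by (intro sum.cong) (simp_all add: a mult_ac)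
  also have "(\<Sum>S\<in>Pow A. p ^ card S * (1 - p) ^ card (insert x A - S) * f S) = (1 - p) * bexp p A f"
    unfolding bexp_def sum_distrib_left
    by (intro sum.cong) (simp_all add: a mult_ac)
  finally show ?thesis by simp
qed

lemma bexp_cong: "A = B \<Longrightarrow> (\<And>S. S \<subseteq> B \<Longrightarrow> f S = g S) \<Longrightarrow> bexp p A f = bexp p B g"
  unfolding bexp_def by (auto intro!: sum.cong)

lemma bexp_mono:
  assumes "0 \<le> p" "p \<le> 1" "\<And>S. S \<subseteq> A \<Longrightarrow> f S \<le> g S"
  shows "bexp p A f \<le> bexp p A g"
  unfolding bexp_def using assms by (intro sum_mono mult_left_mono) auto

lemma bexp_add: "bexp p A (\<lambda>S. f S + g S) = bexp p A f + bexp p A g"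
  by (simp add: bexp_def algebra_simps sum.distrib)

lemma bexp_cmult: "bexp p A (\<lambda>S. c * f S) = c * bexp p A f"
  by (simp add: bexp_def algebra_simps sum_distrib_left)

lemma bexp_sum: "bexp p A (\<lambda>S. \<Sum>i\<in>I. f i S) = (\<Sum>i\<in>I. bexp p A (f i))"
  unfolding bexp_def sum_distrib_left by (subst sum.swap) simp

lemma bexp_const: "finite A \<Longrightarrow> bexp p A (\<lambda>_. c) = c"
  by (induction A rule: finite_induct) (auto simp: bexp_insert algebra_simps)

lemma bexp_nonneg:
  assumes "0 \<le> p" "p \<le> 1" "\<And>S. S \<subseteq> A \<Longrightarrow> 0 \<le> f S"
  shows "0 \<le> bexp p A f"
  unfolding bexp_def using assms by (intro sum_nonneg mult_nonneg_nonneg) auto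

lemma bprob_le_1: "finite A \<Longrightarrow> 0 \<le> p \<Longrightarrow> p \<le> 1 \<Longrightarrow> bprob p A Q \<le> 1"
  using bexp_mono[of p A "\<lambda>S. of_bool (Q S)" "\<lambda>_. 1"] by (simp add: bexp_const)

lemma bprob_mono:
  assumes "0 \<le> p" "p \<le> 1" "\<And>S. S \<subseteq> A \<Longrightarrow> P S \<Longrightarrow> Q S"
  shows "bprob p A P \<le> bprob p A Q"
  using assms by (intro bexp_mono) auto

lemma bprob_not:
  assumes "finite A"
  shows "bprob p A (\<lambda>S. \<not> Q S) = 1 - bprob p A Q"
proof -
  have "bprob p A (\<lambda>S. \<not> Q S) + bprob p A Q = bexp p A (\<lambda>_. 1)"
    unfolding bexp_add[symmetric] by (intro bexp_cong refl) auto
  then show ?thesis using assms by (simp add: bexp_const)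
qed

lemma bprob_disj_le:
  assumes "0 \<le> p" "p \<le> 1"
  shows "bprob p A (\<lambda>S. P S \<or> Q S) \<le> bprob p A P + bprob p A Q"
  unfolding bexp_add[symmetric] using assms by (intro bexp_mono) auto

lemma bprob_Bex_le:
  assumes "0 \<le> p" "p \<le> 1" "finite I"
  shows "bprob p A (\<lambda>S. \<exists>i\<in>I. Q i S) \<le> (\<Sum>i\<in>I. bprob p A (Q i))"
  unfolding bexp_sum[symmetric]
proof (intro bexp_mono assms)
  fix S
  show "of_bool (\<exists>i\<in>I. Q i S) \<le> (\<Sum>i\<in>I. of_bool (Q i S) :: real)"
  proof (cases "\<exists>i\<in>I. Q i S")
    case True
    then obtain i where i: "i \<in> I" "Q i S" by blast
    have "of_bool (Q i S) \<le> (\<Sum>i\<in>I. of_bool (Q i S) :: real)"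
      using i assms by (intro member_le_sum) auto
    with i show ?thesis by auto
  qed (auto intro: sum_nonneg)
qed

lemma bexp_Un:
  assumes "finite A" "finite B" "A \<inter> B = {}"
  shows "bexp p (A \<union> B) f = bexp p A (\<lambda>S. bexp p B (\<lambda>T. f (S \<union> T)))"
  using assms(1,3)
proof (induction A arbitrary: f rule: finite_induct)
  case (insert x A)
  then have "x \<notin> A \<union> B" "A \<inter> B = {}" by auto
  then show ?case
    using insert.IH[of f] insert.IH[of "\<lambda>S. f (insert x S)"] insert.hyps assms(2)
    by (simp add: bexp_insert)
qed simp

lemma bexp_Int:
  assumes "finite A" "B \<subseteq> A"
  shows "bexp p A (\<lambda>S. f (S \<inter> B)) = bexp p B f"
proof -
  have fin: "finite B" "finite (A - B)" using assms finite_subset by auto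
  have "bexp p A (\<lambda>S. f (S \<inter> B)) = bexp p (B \<union> (A - B)) (\<lambda>S. f (S \<inter> B))"
    using assms by (simp add: Un_absorb1)
  also have "\<dots> = bexp p B (\<lambda>S. bexp p (A - B) (\<lambda>T. f ((S \<union> T) \<inter> B)))"
    using fin by (intro bexp_Un) auto
  also have "\<dots> = bexp p B (\<lambda>S. bexp p (A - B) (\<lambda>T. f S))"
    by (intro bexp_cong refl arg_cong[of _ _ f]) auto
  finally show ?thesis using fin by (simp add: bexp_const)
qed

lemma bexp_thin:
  assumes "finite A"
  shows "bexp (p * q) A f = bexp p A (\<lambda>S. bexp q S f)"
  using assms
proof (induction A arbitrary: f rule: finite_induct)
  case (insert x A)
  have 1: "bexp p A (\<lambda>S. bexp q (insert x S) f) = q * bexp (p * q) A (\<lambda>S. f (insert x S)) + (1 - q) * bexp (p * q) A f"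
  proof -
    have "bexp p A (\<lambda>S. bexp q (insert x S) f)
        = bexp p A (\<lambda>S. q * bexp q S (\<lambda>S. f (insert x S)) + (1 - q) * bexp q S f)"
      using insert.hyps by (intro bexp_cong refl bexp_insert) (auto intro: finite_subset)
    then show ?thesis by (simp add: bexp_add bexp_cmult insert.IH)
  qed
  show ?case
    unfolding bexp_insert[OF insert.hyps] 1 insert.IH[of f, symmetric] by (simp add: algebra_simps)
qed simp

lemma bprob_up_mono:
  assumes "finite A" "0 \<le> p" "p \<le> p'" "p' \<le> 1"
    and up: "\<And>S T. S \<subseteq> T \<Longrightarrow> T \<subseteq> A \<Longrightarrow> Q S \<Longrightarrow> Q T"
  shows "bprob p A Q \<le> bprob p' A Q"
proof (cases "p' = 0")
  case False
  define q where "q = p / p'"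
  have q: "0 \<le> q" "q \<le> 1" "p = p' * q" using assms False by (auto simp: q_def)
  have "bprob p A Q = bexp p' A (\<lambda>S. bprob q S Q)"
    by (subst q(3), rule bexp_thin[OF assms(1)])
  also have "\<dots> \<le> bprob p' A Q"
  proof (intro bexp_mono)
    fix S assume S: "S \<subseteq> A"
    have finS: "finite S" using S assms(1) finite_subset by blast
    have "bprob q S Q \<le> bexp q S (\<lambda>_. of_bool (Q S))"
      using q up[OF _ S] by (intro bexp_mono) auto
    also have "\<dots> = of_bool (Q S)" using finS by (rule bexp_const)
    finally show "bprob q S Q \<le> of_bool (Q S)" .
  qed (use assms in auto)
  finally show ?thesis .
qed (use assms in auto)

lemma bexp_exp_card:
  assumes "finite A" "B \<subseteq> A"
  shows "bexp p A (\<lambda>S. exp (t * real (card (S \<inter> B)))) = (1 - p + p * exp t) ^ card B"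
proof -
  have "finite B" using assms finite_subset by blast
  then have "bexp p B (\<lambda>S. exp (t * real (card S))) = (1 - p + p * exp t) ^ card B"
  proof (induction B rule: finite_induct)
    case (insert x B)
    have "bexp p B (\<lambda>S. exp (t * real (card (insert x S)))) = bexp p B (\<lambda>S. exp t * exp (t * real (card S)))"
    proof (intro bexp_cong refl)
      fix S assume "S \<subseteq> B"
      then have "finite S" "x \<notin> S" using insert.hyps finite_subset by auto
      then show "exp (t * real (card (insert x S))) = exp t * exp (t * real (card S))"
        by (simp add: algebra_simps exp_add)
    qed
    with insert show ?case by (simp add: bexp_insert bexp_cmult algebra_simps)
  qed simp
  with bexp_Int[OF assms, of p "\<lambda>S. exp (t * real (card S))"] show ?thesis by simp
qed

lemma bprob_disjoint:
  assumes "finite A" "B \<subseteq> A"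
  shows "bprob p A (\<lambda>S. S \<inter> B = {}) = (1 - p) ^ card B"
proof -
  have "finite B" using assms finite_subset by blast
  then have "bprob p B (\<lambda>S. S = {}) = (1 - p) ^ card B"
  proof (induction B rule: finite_induct)
    case (insert x B)
    then show ?case using bexp_const[of B p 0] by (simp add: bexp_insert)
  qed simp
  with bexp_Int[OF assms, of p "\<lambda>S. of_bool (S = {})"] show ?thesis by simp
qed

lemma bexp_card:
  assumes "finite A" "B \<subseteq> A"
  shows "bexp p A (\<lambda>S. real (card (S \<inter> B))) = p * real (card B)"
proof -
  have "finite B" using assms finite_subset by blast
  then have "bexp p B (\<lambda>S. real (card S)) = p * real (card B)"
  proof (induction B rule: finite_induct)
    case (insert x B)
    have "bexp p B (\<lambda>S. real (card (insert x S))) = bexp p B (\<lambda>S. 1 + real (card S))"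
    proof (intro bexp_cong refl)
      fix S assume "S \<subseteq> B"
      then have "finite S" "x \<notin> S" using insert.hyps finite_subset by auto
      then show "real (card (insert x S)) = 1 + real (card S)" by simp
    qed
    with insert show ?case by (simp add: bexp_insert bexp_add bexp_const algebra_simps)
  qed simp
  with bexp_Int[OF assms, of p "\<lambda>S. real (card S)"] show ?thesis by simp
qed

lemma bprob_markov:
  assumes "0 \<le> p" "p \<le> 1" "t > 0" "\<And>S. S \<subseteq> A \<Longrightarrow> 0 \<le> f S"
  shows "bprob p A (\<lambda>S. f S \<ge> t) \<le> bexp p A f / t"
proof -
  have "t * bprob p A (\<lambda>S. f S \<ge> t) \<le> bexp p A f"
    unfolding bexp_cmult[symmetric] using assms by (intro bexp_mono) auto
  with assms(3) show ?thesis by (simp add: field_simps)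
qed

lemma one_plus_power_le_exp: "-1 \<le> x \<Longrightarrow> (1 + x) ^ n \<le> exp (real n * x)"
  by (simp add: exp_of_nat_mult power_mono)

lemma bprob_card_ge:
  assumes "finite A" "B \<subseteq> A" "0 \<le> p" "p \<le> 1"
  shows "bprob p A (\<lambda>S. real (card (S \<inter> B)) \<ge> t) \<le> exp (2 * (p * real (card B)) - t)"
proof -
  have "bprob p A (\<lambda>S. real (card (S \<inter> B)) \<ge> t) \<le> bexp p A (\<lambda>S. exp (-t) * exp (1 * real (card (S \<inter> B))))"
    using assms by (intro bexp_mono) (auto simp: exp_add[symmetric])
  also have "\<dots> = exp (-t) * (1 + p * (exp 1 - 1)) ^ card B"
    unfolding bexp_cmult bexp_exp_card[OF assms(1,2)] by (simp add: algebra_simps)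
  also have "\<dots> \<le> exp (-t) * exp (real (card B) * (p * (exp 1 - 1)))"
    using assms exp_ge_add_one_self[of 1]
    by (intro mult_left_mono one_plus_power_le_exp) (auto intro: order_trans[of _ 0])
  also have "\<dots> \<le> exp (-t) * exp (real (card B) * (p * 2))"
    using assms exp_le by (intro mult_left_mono iffD2[OF exp_le_cancel_iff]) auto
  finally show ?thesis by (simp add: exp_add[symmetric] algebra_simps)
qed

lemma bprob_card_le:
  assumes "finite A" "B \<subseteq> A" "0 \<le> p" "p \<le> 1"
  shows "bprob p A (\<lambda>S. real (card (S \<inter> B)) \<le> t) \<le> exp (t - p * real (card B) / 2)"
proof -
  have e: "exp (-1::real) \<le> 1/2"
    using exp_ge_add_one_self[of "1::real"] by (simp add: exp_minus field_simps)
  have "bprob p A (\<lambda>S. real (card (S \<inter> B)) \<le> t) \<le> bexp p A (\<lambda>S. exp t * exp ((-1) * real (card (S \<inter> B))))"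
    using assms by (intro bexp_mono) (auto simp: exp_add[symmetric])
  also have "\<dots> = exp t * (1 + p * (exp (-1) - 1)) ^ card B"
    unfolding bexp_cmult bexp_exp_card[OF assms(1,2)] by (simp add: algebra_simps)
  also have "\<dots> \<le> exp t * exp (real (card B) * (p * (exp (-1) - 1)))"
  proof (intro mult_left_mono one_plus_power_le_exp)
    have "p * (1 - exp (-1)) \<le> 1 * 1" using assms by (intro mult_mono) auto
    then show "-1 \<le> p * (exp (-1) - 1)" by (simp add: algebra_simps)
  qed simp
  also have "\<dots> \<le> exp t * exp (real (card B) * (p * (- 1/2)))"
    using assms e by (intro mult_left_mono iffD2[OF exp_le_cancel_iff]) auto
  finally show ?thesis by (simp add: exp_add[symmetric] algebra_simps)
qed

lemma bprob_disjoint_le: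
  assumes "finite A" "B \<subseteq> A" "p \<le> 1"
  shows "bprob p A (\<lambda>S. S \<inter> B = {}) \<le> exp (- (p * real (card B)))"
  using one_plus_power_le_exp[of "-p" "card B"] assms by (simp add: bprob_disjoint mult.commute)

text \<open>
  For functions that change by at most one per element, the exponent is governed by the expected number
  of chosen elements rather than by the size of \<open>A\<close>; a bounded difference inequality would be too weak here.
\<close>

lemma bexp_laplace:
  assumes "finite A" "0 \<le> p" "p \<le> 1" "0 \<le> t" "t \<le> 1"
    and "\<And>S x. S \<subseteq> A \<Longrightarrow> x \<in> A \<Longrightarrow> f S \<le> f (insert x S) \<and> f (insert x S) \<le> f S + 1"
  shows "bexp p A (\<lambda>S. exp (- t * f S)) \<le> exp (- t * bexp p A f + real (card A) * p * t\<^sup>2)"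
  using assms(1,6)
proof (induction A arbitrary: f rule: finite_induct)
  case (insert x A)
  let ?f1 = "\<lambda>S. f (insert x S)"
  let ?a = "bexp p A f" and ?b = "bexp p A ?f1" and ?c = "real (card A) * p * t\<^sup>2"
  have l: "f S \<le> f (insert y S) \<and> f (insert y S) \<le> f S + 1" if "S \<subseteq> insert x A" "y \<in> insert x A" for S y
    using insert.prems that by blast
  have 0: "bexp p A (\<lambda>S. exp (- t * f S)) \<le> exp (- t * ?a + ?c)"
    by (rule insert.IH) (use l in blast)
  have 1: "bexp p A (\<lambda>S. exp (- t * ?f1 S)) \<le> exp (- t * ?b + ?c)"
  proof (rule insert.IH)
    fix S y assume "S \<subseteq> A" "y \<in> A"
    with l[of "insert x S" y] show "?f1 S \<le> ?f1 (insert y S) \<and> ?f1 (insert y S) \<le> ?f1 S + 1"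
      by (auto simp: insert_commute)
  qed
  have ab: "?a \<le> ?b" using l assms(2,3) by (intro bexp_mono) blast+
  have "?b \<le> bexp p A (\<lambda>S. f S + 1)" using l assms(2,3) by (intro bexp_mono) blast+
  then have ba: "?b \<le> ?a + 1" using insert.hyps by (simp add: bexp_add bexp_const)
  define d where "d = ?b - ?a"
  have d: "0 \<le> d" "d \<le> 1" "?b = ?a + d" using ab ba by (auto simp: d_def)
  have td: "0 \<le> t * d" "t * d \<le> t" using d assms(4) by (auto intro: mult_left_le)
  have e1: "exp (- (t * d)) \<le> 1 - t * d + (t * d)\<^sup>2"
  proof -
    have "exp (- (t * d)) = inverse (exp (t * d))" by (simp add: exp_minus)
    also have "\<dots> \<le> inverse (1 + t * d)"
      using td by (intro le_imp_inverse_le exp_ge_add_one_self) auto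
    also have "\<dots> \<le> 1 - t * d + (t * d)\<^sup>2"
    proof -
      have "1 \<le> (1 - t * d + (t * d)\<^sup>2) * (1 + t * d)"
      proof -
        have "(1 - t * d + (t * d)\<^sup>2) * (1 + t * d) = 1 + (t * d) ^ 3"
          by (simp add: algebra_simps power2_eq_square power3_eq_cube)
        then show ?thesis using td by simp
      qed
      then show ?thesis using td by (simp add: inverse_eq_divide divide_le_eq)
    qed
    finally show ?thesis .
  qed
  have e2: "(t * d)\<^sup>2 \<le> t\<^sup>2" using td by (intro power_mono) auto
  have "bexp p (insert x A) (\<lambda>S. exp (- t * f S))
      \<le> p * exp (- t * ?b + ?c) + (1 - p) * exp (- t * ?a + ?c)"
    unfolding bexp_insert[OF insert.hyps] using assms(2,3) by (intro add_mono mult_left_mono 0 1) auto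
  also have "\<dots> = exp (- t * ?a + ?c) * (1 + p * (exp (- (t * d)) - 1))"
    by (simp add: d(3) exp_add exp_diff exp_minus field_simps)
  also have "\<dots> \<le> exp (- t * ?a + ?c) * exp (p * (- t * d + t\<^sup>2))"
  proof (intro mult_left_mono)
    have "1 + p * (exp (- (t * d)) - 1) \<le> 1 + p * (- t * d + t\<^sup>2)"
      using e1 e2 assms(2) by (intro add_mono mult_left_mono) auto
    also have "\<dots> \<le> exp (p * (- t * d + t\<^sup>2))" by (rule exp_ge_add_one_self)
    finally show "1 + p * (exp (- (t * d)) - 1) \<le> exp (p * (- t * d + t\<^sup>2))" .
  qed simp
  also have "\<dots> = exp (- t * (p * ?b + (1 - p) * ?a) + real (card (insert x A)) * p * t\<^sup>2)"
    using insert.hyps by (simp add: d(3) exp_add[symmetric] algebra_simps)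
  finally show ?case using insert.hyps by (simp add: bexp_insert)
qed simp

lemma bprob_indep_family:
  assumes "finite I" "finite A" "\<And>i. i \<in> I \<Longrightarrow> H i \<subseteq> A" "disjoint_family_on H I"
    "0 \<le> p" "p \<le> 1"
  shows "bprob p A (\<lambda>S. \<forall>i\<in>I. Q i (S \<inter> H i)) = (\<Prod>i\<in>I. bprob p A (\<lambda>S. Q i (S \<inter> H i)))"
  using assms(1,3,4)
proof (induction I rule: finite_induct)
  case empty
  then show ?case using assms(2) by (simp add: bexp_const)
next
  case (insert j I)
  define B where "B = A - H j"
  have HB: "H i \<subseteq> B" if i: "i \<in> I" for i
  proof -
    have "H i \<inter> H j = {}"
      using insert.prems(2) insert.hyps(2) i by (intro disjoint_family_onD[of H "insert j I"]) auto
    then show ?thesis using insert.prems(1)[of i] i by (auto simp: B_def)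
  qed
  have Hj: "H j \<subseteq> A" using insert.prems by auto
  have A: "A = H j \<union> B" using Hj by (auto simp: B_def)
  have fin: "finite (H j)" "finite B" using assms(2) Hj finite_subset by (auto simp: B_def)
  have BA: "B \<subseteq> A" by (auto simp: B_def)
  let ?q = "\<lambda>T. of_bool (\<forall>i\<in>I. Q i (T \<inter> H i)) :: real" and ?qj = "\<lambda>S. of_bool (Q j (S \<inter> H j)) :: real"
  have "bprob p A (\<lambda>S. \<forall>i\<in>insert j I. Q i (S \<inter> H i))
      = bexp p (H j) (\<lambda>S. bprob p B (\<lambda>T. \<forall>i\<in>insert j I. Q i ((S \<union> T) \<inter> H i)))"
    by (subst A, rule bexp_Un) (use fin in \<open>auto simp: B_def\<close>)
  also have "\<dots> = bexp p (H j) (\<lambda>S. bexp p B (\<lambda>T. ?qj S * ?q T))"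
  proof (intro bexp_cong refl)
    fix S T assume ST: "S \<subseteq> H j" "T \<subseteq> B"
    have 1: "(S \<union> T) \<inter> H j = S \<inter> H j" using ST by (auto simp: B_def)
    have 2: "(S \<union> T) \<inter> H i = T \<inter> H i" if "i \<in> I" for i using ST HB[OF that] B_def by blast
    have "(\<forall>i\<in>insert j I. Q i ((S \<union> T) \<inter> H i)) \<longleftrightarrow> Q j (S \<inter> H j) \<and> (\<forall>i\<in>I. Q i (T \<inter> H i))"
      using 1 2 by simp
    then show "of_bool (\<forall>i\<in>insert j I. Q i ((S \<union> T) \<inter> H i)) = ?qj S * ?q T"
      by (simp only: of_bool_conj)
  qed
  also have "\<dots> = bexp p (H j) (\<lambda>S. bexp p B ?q * ?qj S)"
    by (intro bexp_cong refl) (subst bexp_cmult, rule mult.commute)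
  also have "\<dots> = bexp p B ?q * bexp p (H j) ?qj"
    by (rule bexp_cmult)
  also have "bexp p (H j) ?qj = bexp p A ?qj"
    using bexp_Int[OF assms(2) Hj, of p ?qj] by (simp add: Int_assoc)
  also have "bexp p B ?q = bexp p A ?q"
  proof -
    have "bexp p B ?q = bexp p A (\<lambda>T. ?q (T \<inter> B))"
      using bexp_Int[OF assms(2) BA] by (rule sym)
    also have "\<dots> = bexp p A ?q"
    proof (intro bexp_cong refl)
      fix T
      have "T \<inter> B \<inter> H i = T \<inter> H i" if "i \<in> I" for i using HB[OF that] by auto
      then show "?q (T \<inter> B) = ?q T" by simp
    qed
    finally show ?thesis .
  qed
  also have "\<dots> = (\<Prod>i\<in>I. bprob p A (\<lambda>S. Q i (S \<inter> H i)))"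
    using insert.prems by (intro insert.IH) (auto simp: disjoint_family_on_def)
  finally show ?case using insert.hyps by (simp add: mult.commute)
qed

lemma bexp_reindex:
  assumes "finite A" "bij_betw h A A"
  shows "bexp p A f = bexp p A (\<lambda>S. f (h ` S))"
proof -
  have inj: "inj_on h S" if "S \<subseteq> A" for S
    using assms(2) that inj_on_subset by (auto simp: bij_betw_def)
  have b: "bij_betw (image h) (Pow A) (Pow A)"
    using assms(2) by (rule bij_betw_Pow)
  define g where "g = (\<lambda>S. p ^ card S * (1 - p) ^ card (A - S) * f S)"
  have "bexp p A f = (\<Sum>S\<in>Pow A. g (h ` S))"
    unfolding bexp_def g_def[symmetric] by (rule sum.reindex_bij_betw[OF b, symmetric])
  also have "\<dots> = bexp p A (\<lambda>S. f (h ` S))"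
    unfolding bexp_def
  proof (intro sum.cong refl)
    fix S assume S: "S \<in> Pow A"
    have "A - h ` S = h ` (A - S)"
      using S assms(2) inj_on_image_set_diff[of h A A S] by (auto simp: bij_betw_def)
    moreover have "card (h ` S) = card S" "card (h ` (A - S)) = card (A - S)"
      using S by (auto intro!: card_image inj)
    ultimately show "g (h ` S) = p ^ card S * (1 - p) ^ card (A - S) * f (h ` S)"
      by (simp add: g_def)
  qed
  finally show ?thesis .
qed


lemma prob_random_hypergraph:
  assumes "0 \<le> p" "p \<le> 1"
  shows "measure_pmf.prob (random_hypergraph r n p) {F. Q F} = bprob p ([{1..n}]\<^bsup>r\<^esup>) Q"
proof -
  have gen: "measure_pmf.expectation (map_pmf (\<lambda>b. {e \<in> A. b e}) (Pi_pmf A False (\<lambda>_. bernoulli_pmf p))) f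
      = bexp p A f" if "finite A" for A :: "nat set set" and f :: "nat set set \<Rightarrow> real"
    using that
  proof (induction A arbitrary: f rule: finite_induct)
    case (insert x A)
    have fs: "finite (set_pmf (Pi_pmf A False (\<lambda>_. bernoulli_pmf p)))"
      using insert.hyps by (intro finite_subset[OF set_Pi_pmf_subset'[OF insert.hyps(1)]] finite_PiE_dflt) (auto intro: finite_subset[of _ UNIV])
    have e: "{e \<in> insert x A. (b(x := y)) e} = (if y then insert x {e \<in> A. b e} else {e \<in> A. b e})" for b y
      using insert.hyps by auto
    have "measure_pmf.expectation (map_pmf (\<lambda>b. {e \<in> insert x A. b e}) (Pi_pmf (insert x A) False (\<lambda>_. bernoulli_pmf p))) f
      = measure_pmf.expectation (bind_pmf (bernoulli_pmf p) (\<lambda>y. map_pmf (\<lambda>b. {e \<in> insert x A. (b(x := y)) e}) (Pi_pmf A False (\<lambda>_. bernoulli_pmf p)))) f"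
      using insert.hyps unfolding Pi_pmf_insert[OF insert.hyps]
      by (simp add: pair_pmf_def map_bind_pmf bind_map_pmf map_pmf_def[symmetric] pmf.map_comp o_def del: fun_upd_apply)
    also have "\<dots> = (\<Sum>y\<in>UNIV. pmf (bernoulli_pmf p) y *\<^sub>R measure_pmf.expectation
         (map_pmf (\<lambda>b. {e \<in> insert x A. (b(x := y)) e}) (Pi_pmf A False (\<lambda>_. bernoulli_pmf p))) f)"
      using fs by (intro pmf_expectation_bind) auto
    also have "\<dots> = p * measure_pmf.expectation (map_pmf (\<lambda>b. {e \<in> A. b e}) (Pi_pmf A False (\<lambda>_. bernoulli_pmf p))) (\<lambda>S. f (insert x S))
       + (1 - p) * measure_pmf.expectation (map_pmf (\<lambda>b. {e \<in> A. b e}) (Pi_pmf A False (\<lambda>_. bernoulli_pmf p))) f"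
      unfolding e using assms by (simp add: UNIV_bool)
    finally show ?case unfolding bexp_insert[OF insert.hyps] insert.IH .
  qed simp
  have "measure_pmf.prob (random_hypergraph r n p) {F. Q F}
     = measure_pmf.expectation (random_hypergraph r n p) (indicator {F. Q F})"
    by simp
  also have "(indicator {F. Q F} :: _ \<Rightarrow> real) = (\<lambda>F. of_bool (Q F))" by (auto simp: indicator_def)
  finally show ?thesis
    unfolding random_hypergraph_def gen[OF finite_imp_finite_nsets[OF finite_atLeastAtMost]] .
qed

section \<open>Stability and Turan numbers\<close>

definition nbrs :: "'a set set \<Rightarrow> 'a set \<Rightarrow> 'a \<Rightarrow> 'a set" where
  "nbrs G U x = {z \<in> U. {x, z} \<in> G}"

definition cliques :: "nat \<Rightarrow> 'a set \<Rightarrow> 'a set set \<Rightarrow> 'a set set" where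
  "cliques j U G = {f \<in> [U]\<^bsup>j\<^esup>. clique f G}"

lemma finite_cliques [simp]: "finite U \<Longrightarrow> finite (cliques j U G)"
  by (simp add: cliques_def finite_imp_finite_nsets)

lemma sum_card_cliques_nbrs_le:
  assumes "finite U" "B \<subseteq> U" "\<And>x. {x} \<notin> G"
  shows "(\<Sum>x\<in>B. card (cliques j (nbrs G U x) G)) \<le> Suc j * card (cliques (Suc j) U G)"
proof -
  have finB: "finite B" using assms finite_subset by blast
  have fin: "finite (nbrs G U x)" for x using assms by (simp add: nbrs_def)
  have finf: "finite f" if "f \<in> cliques i W G" for f i W
    using that by (simp add: cliques_def nsets_def)
  have "(\<Sum>x\<in>B. card (cliques j (nbrs G U x) G)) = card (SIGMA x:B. cliques j (nbrs G U x) G)"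
    using finB fin by (simp add: card_SigmaI)
  also have "\<dots> \<le> card (SIGMA f:cliques (Suc j) U G. f)"
  proof (rule card_inj_on_le)
    have ni: "x \<notin> f" if "f \<in> cliques j (nbrs G U x) G" for x f
      using that assms(3)[of x] by (auto simp: cliques_def nsets_def nbrs_def)
    show "inj_on (\<lambda>(x, f). (insert x f, x)) (SIGMA x:B. cliques j (nbrs G U x) G)"
      using ni by (auto simp: inj_on_def dest: insert_ident[THEN iffD1, rotated 2])
    show "(\<lambda>(x, f). (insert x f, x)) ` (SIGMA x:B. cliques j (nbrs G U x) G) \<subseteq> (SIGMA f:cliques (Suc j) U G. f)"
    proof clarsimp
      fix x f assume x: "x \<in> B" and f: "f \<in> cliques j (nbrs G U x) G"
      then show "insert x f \<in> cliques (Suc j) U G"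
        using ni[OF f] assms(2) by (auto simp: cliques_def nsets_def nbrs_def clique_def insert_commute)
    qed
    show "finite (SIGMA f:cliques (Suc j) U G. f)"
      using assms(1) finf by (intro finite_SigmaI) auto
  qed
  also have "\<dots> = (\<Sum>f\<in>cliques (Suc j) U G. card f)"
    using assms(1) finf by (subst card_SigmaI) auto
  also have "\<dots> = (\<Sum>f\<in>cliques (Suc j) U G. Suc j)"
    by (intro sum.cong) (auto simp: cliques_def nsets_def)
  finally show ?thesis by (simp add: mult.commute)
qed

abbreviation dsum :: "'a set \<Rightarrow> 'a set \<Rightarrow> ('a \<Rightarrow> 'a \<Rightarrow> bool) \<Rightarrow> real" where
  "dsum A B P \<equiv> (\<Sum>y\<in>A. \<Sum>z\<in>B. of_bool (P y z))"

lemma dsum_Un: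
  assumes "finite A" "finite B" "A \<inter> B = {}"
  shows "dsum (A \<union> B) (A \<union> B) P = dsum A A P + dsum A B P + dsum B A P + dsum B B P"
  by (simp only: sum.union_disjoint[OF assms] sum.distrib add_ac)

lemma dsum_cong: "(\<And>y z. y \<in> A \<Longrightarrow> z \<in> B \<Longrightarrow> P y z \<longleftrightarrow> Q y z) \<Longrightarrow> dsum A B P = dsum A B Q"
  by (auto intro!: sum.cong)

lemma dsum_swap: "dsum A B P = dsum B A (\<lambda>y z. P z y)"
  by (rule sum.swap)

lemma dsum_True: "dsum A B (\<lambda>_ _. True) = real (card A) * real (card B)"
  by simp

lemma dsum_le: "finite A \<Longrightarrow> finite B \<Longrightarrow> dsum A B P \<le> real (card A) * real (card B)"
  unfolding dsum_True[symmetric] by (intro sum_mono) auto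

text \<open>
  An approximate form of Fueredi's stability argument: remove the non-neighbours of a vertex which has maximum
  degree among the vertices lying in few cliques, and continue in its neighbourhood.
  All counts are over ordered pairs.
\<close>

lemma few_cliques_imp_almost_partite:
  assumes "1 \<le> j" "\<epsilon> > 0"
  shows "\<exists>\<eta>>0. \<forall>(G :: 'a set set) U (n::real). finite U \<and> (\<forall>x. {x} \<notin> G) \<and> real (card U) \<le> n \<and>
    real (card (cliques (Suc j) U G)) < \<eta> * n ^ Suc j \<longrightarrow>
    (\<exists>\<phi>. (\<forall>v\<in>U. \<phi> v < j) \<and>
      dsum U U (\<lambda>y z. {y, z} \<in> G) + dsum U U (\<lambda>y z. {y, z} \<in> G \<and> \<phi> y = \<phi> z)
      \<le> dsum U U (\<lambda>y z. \<phi> y \<noteq> \<phi> z) + \<epsilon> * n\<^sup>2)"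
  using assms
proof (induction j arbitrary: \<epsilon> rule: nat_induct_at_least)
  case base
  show ?case
  proof (intro exI[of _ "\<epsilon> / 4"] conjI allI impI)
    fix G :: "'a set set" and U and n :: real
    assume A: "finite U \<and> (\<forall>x. {x} \<notin> G) \<and> real (card U) \<le> n \<and>
      real (card (cliques (Suc 1) U G)) < \<epsilon> / 4 * n ^ Suc 1"
    have fin: "finite (nbrs G U x)" for x using A by (simp add: nbrs_def)
    have "dsum U U (\<lambda>y z. {y, z} \<in> G) = real (\<Sum>x\<in>U. card (cliques 1 (nbrs G U x) G))"
    proof -
      have "cliques 1 (nbrs G U x) G = (\<lambda>z. {z}) ` nbrs G U x" for x
        by (auto simp: cliques_def nsets_def clique_def card_1_singleton_iff)
      then have "card (cliques 1 (nbrs G U x) G) = card (nbrs G U x)" for x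
        by (simp add: card_image)
      then show ?thesis using A by (simp add: nbrs_def sum_of_bool_eq Int_def)
    qed
    also have "\<dots> \<le> real (Suc 1 * card (cliques (Suc 1) U G))"
      using A by (intro of_nat_mono sum_card_cliques_nbrs_le) auto
    finally have "dsum U U (\<lambda>y z. {y, z} \<in> G) \<le> \<epsilon> / 2 * n\<^sup>2"
      using A by (simp add: power2_eq_square)
    then show "\<exists>\<phi>. (\<forall>v\<in>U. \<phi> v < (1::nat)) \<and>
      dsum U U (\<lambda>y z. {y, z} \<in> G) + dsum U U (\<lambda>y z. {y, z} \<in> G \<and> \<phi> y = \<phi> z)
      \<le> dsum U U (\<lambda>y z. \<phi> y \<noteq> \<phi> z) + \<epsilon> * n\<^sup>2"
      by (intro exI[of _ "\<lambda>_. 0"]) simp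
  qed (use base in auto)
next
  case (Suc j)
  from Suc.IH[of "\<epsilon> / 2"] Suc.prems obtain \<eta>' where \<eta>': "\<eta>' > 0" and IH: "\<And>(G :: 'a set set) U (n::real).
    finite U \<Longrightarrow> (\<And>x. {x} \<notin> G) \<Longrightarrow> real (card U) \<le> n \<Longrightarrow>
    real (card (cliques (Suc j) U G)) < \<eta>' * n ^ Suc j \<Longrightarrow>
    (\<exists>\<phi>. (\<forall>v\<in>U. \<phi> v < j) \<and>
      dsum U U (\<lambda>y z. {y, z} \<in> G) + dsum U U (\<lambda>y z. {y, z} \<in> G \<and> \<phi> y = \<phi> z)
      \<le> dsum U U (\<lambda>y z. \<phi> y \<noteq> \<phi> z) + \<epsilon> / 2 * n\<^sup>2)" by auto
  define \<eta> where "\<eta> = \<epsilon> / 4 * \<eta>' / real (Suc (Suc j))"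
  show ?case
  proof (intro exI[of _ \<eta>] conjI allI impI)
    show "\<eta> > 0" using \<eta>' Suc.prems by (auto simp: \<eta>_def)
    fix G :: "'a set set" and U and n :: real
    assume "finite U \<and> (\<forall>x. {x} \<notin> G) \<and> real (card U) \<le> n \<and>
      real (card (cliques (Suc (Suc j)) U G)) < \<eta> * n ^ Suc (Suc j)"
    then have finU: "finite U" and noloop: "\<And>x. {x} \<notin> G" and cU: "real (card U) \<le> n"
      and few: "real (card (cliques (Suc (Suc j)) U G)) < \<eta> * n ^ Suc (Suc j)" by auto
    have n0: "n > 0"
    proof (rule ccontr)
      assume "\<not> n > 0"
      then have "n = 0" using cU by linarith
      with few show False by simp
    qed
    define N where "N = nbrs G U"
    have NU: "N x \<subseteq> U" for x by (auto simp: N_def nbrs_def)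
    have finN: "finite (N x)" for x using NU finU finite_subset by blast
    define B where "B = {x \<in> U. real (card (cliques (Suc j) (N x) G)) \<ge> \<eta>' * n ^ Suc j}"
    have BU: "B \<subseteq> U" by (auto simp: B_def)
    have finB: "finite B" using BU finU finite_subset by blast
    have cB: "real (card B) \<le> \<epsilon> / 4 * n"
    proof -
      have "real (card B) * (\<eta>' * n ^ Suc j) = (\<Sum>x\<in>B. \<eta>' * n ^ Suc j)" by simp
      also have "\<dots> \<le> (\<Sum>x\<in>B. real (card (cliques (Suc j) (N x) G)))"
        by (intro sum_mono) (auto simp: B_def)
      also have "\<dots> \<le> real (Suc (Suc j) * card (cliques (Suc (Suc j)) U G))"
        unfolding of_nat_sum[symmetric] N_def
        by (intro of_nat_mono sum_card_cliques_nbrs_le finU BU noloop)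
      also have "\<dots> \<le> real (Suc (Suc j)) * (\<eta> * n ^ Suc (Suc j))"
        using few by (simp only: of_nat_mult) (intro mult_left_mono, auto)
      also have "\<dots> = \<epsilon> / 4 * n * (\<eta>' * n ^ Suc j)" by (simp add: \<eta>_def field_simps)
      finally show ?thesis using \<eta>' n0 by (simp add: mult_le_cancel_right)
    qed
    show "\<exists>\<phi>. (\<forall>v\<in>U. \<phi> v < Suc j) \<and>
      dsum U U (\<lambda>y z. {y, z} \<in> G) + dsum U U (\<lambda>y z. {y, z} \<in> G \<and> \<phi> y = \<phi> z)
      \<le> dsum U U (\<lambda>y z. \<phi> y \<noteq> \<phi> z) + \<epsilon> * n\<^sup>2"
    proof (cases "U \<subseteq> B")
      case True
      then have "U = B" using BU by auto
      then have "real (card U) * real (card U) \<le> \<epsilon> / 4 * n * n"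
        using cB cU n0 Suc.prems by (intro mult_mono) auto
      moreover have "dsum U U (\<lambda>y z. {y, z} \<in> G) \<le> real (card U) * real (card U)"
        by (rule dsum_le) (use finU in auto)
      moreover have "0 \<le> \<epsilon> * (n * n)" using Suc.prems by simp
      ultimately show ?thesis
        by (intro exI[of _ "\<lambda>_. 0"]) (simp add: power2_eq_square)
    next
      case False
      then have "finite (U - B)" "U - B \<noteq> {}" using finU by auto
      then obtain x where x: "x \<in> U - B" and max: "\<And>y. y \<in> U - B \<Longrightarrow> card (N y) \<le> card (N x)"
        using obtains_MAX[of "U - B" "\<lambda>y. card (N y)"] by (metis Max_ge finite_imageI imageI)
      define W where "W = N x"
      define U1 where "U1 = U - W"
      have U: "U = W \<union> U1" and dis: "W \<inter> U1 = {}" using NU by (auto simp: W_def U1_def)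
      have finW: "finite W" "finite U1" using finN finU by (auto simp: W_def U1_def)
      have "\<not> real (card (cliques (Suc j) (N x) G)) \<ge> \<eta>' * n ^ Suc j"
        using x by (auto simp: B_def)
      moreover have "real (card W) \<le> n"
        using card_mono[OF finU, of W] cU U by auto
      ultimately obtain \<phi> where \<phi>: "\<And>v. v \<in> W \<Longrightarrow> \<phi> v < j"
         and le: "dsum W W (\<lambda>y z. {y, z} \<in> G) + dsum W W (\<lambda>y z. {y, z} \<in> G \<and> \<phi> y = \<phi> z)
      \<le> dsum W W (\<lambda>y z. \<phi> y \<noteq> \<phi> z) + \<epsilon> / 2 * n\<^sup>2"
        using IH[of W G n] finW noloop by (auto simp: W_def)
      define \<phi>' where "\<phi>' v = (if v \<in> W then \<phi> v else j)" for v
      have W: "\<phi>' v = \<phi> v" "\<phi>' v < j" if "v \<in> W" for v using that \<phi> by (auto simp: \<phi>'_def)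
      have U1: "\<phi>' v = j" if "v \<in> U1" for v using that dis by (auto simp: \<phi>'_def)
      have ne: "\<phi>' y \<noteq> \<phi>' z" "\<phi>' z \<noteq> \<phi>' y" if "y \<in> W" "z \<in> U1" for y z
        using W(2)[OF that(1)] U1[OF that(2)] by auto
      let ?G = "\<lambda>y z. {y, z} \<in> G"
      have e: "dsum U U ?G = dsum W W ?G + 2 * dsum U1 W ?G + dsum U1 U1 ?G"
      proof -
        have "dsum W U1 ?G = dsum U1 W ?G"
          using dsum_swap[of ?G W U1] by (simp add: insert_commute)
        then show ?thesis unfolding U dsum_Un[OF finW dis] by simp
      qed
      have i: "dsum U U (\<lambda>y z. {y, z} \<in> G \<and> \<phi>' y = \<phi>' z)
         = dsum W W (\<lambda>y z. {y, z} \<in> G \<and> \<phi> y = \<phi> z) + dsum U1 U1 ?G"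
      proof -
        have "dsum W W (\<lambda>y z. {y, z} \<in> G \<and> \<phi>' y = \<phi>' z) = dsum W W (\<lambda>y z. {y, z} \<in> G \<and> \<phi> y = \<phi> z)"
          by (rule dsum_cong) (simp add: W)
        moreover have "dsum W U1 (\<lambda>y z. {y, z} \<in> G \<and> \<phi>' y = \<phi>' z) = dsum W U1 (\<lambda>y z. False)"
          by (rule dsum_cong) (simp add: ne)
        moreover have "dsum U1 W (\<lambda>y z. {y, z} \<in> G \<and> \<phi>' y = \<phi>' z) = dsum U1 W (\<lambda>y z. False)"
          by (rule dsum_cong) (simp add: ne)
        moreover have "dsum U1 U1 (\<lambda>y z. {y, z} \<in> G \<and> \<phi>' y = \<phi>' z) = dsum U1 U1 ?G"
          by (rule dsum_cong) (simp add: U1)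
        ultimately show ?thesis unfolding U dsum_Un[OF finW dis] by simp
      qed
      have c: "dsum U U (\<lambda>y z. \<phi>' y \<noteq> \<phi>' z)
         = dsum W W (\<lambda>y z. \<phi> y \<noteq> \<phi> z) + 2 * (real (card U1) * real (card W))"
      proof -
        have "dsum W W (\<lambda>y z. \<phi>' y \<noteq> \<phi>' z) = dsum W W (\<lambda>y z. \<phi> y \<noteq> \<phi> z)"
          by (rule dsum_cong) (simp add: W)
        moreover have "dsum W U1 (\<lambda>y z. \<phi>' y \<noteq> \<phi>' z) = dsum W U1 (\<lambda>y z. True)"
          by (rule dsum_cong) (simp add: ne)
        moreover have "dsum U1 W (\<lambda>y z. \<phi>' y \<noteq> \<phi>' z) = dsum U1 W (\<lambda>y z. True)"
          by (rule dsum_cong) (simp add: ne)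
        moreover have "dsum U1 U1 (\<lambda>y z. \<phi>' y \<noteq> \<phi>' z) = dsum U1 U1 (\<lambda>y z. False)"
          by (rule dsum_cong) (simp add: U1)
        ultimately show ?thesis unfolding U dsum_Un[OF finW dis] by simp
      qed
      have d: "dsum U1 W ?G + dsum U1 U1 ?G \<le> real (card U1) * real (card W) + \<epsilon> / 4 * n\<^sup>2"
      proof -
        have "dsum U1 W ?G + dsum U1 U1 ?G = (\<Sum>y\<in>U1. \<Sum>z\<in>U. of_bool ({y, z} \<in> G))"
          unfolding U sum.union_disjoint[OF finW dis] sum.distrib ..
        also have "\<dots> = (\<Sum>y\<in>U1. real (card (N y)))"
          using finU by (simp add: N_def nbrs_def Int_def)
        also have "\<dots> \<le> (\<Sum>y\<in>U1. real (card W) + n * of_bool (y \<in> B))"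
        proof (intro sum_mono)
          fix y assume y: "y \<in> U1"
          then have yU: "y \<in> U" by (simp add: U1_def)
          have "real (card (N y)) \<le> n" using card_mono[OF finU NU, of y] cU by linarith
          then show "real (card (N y)) \<le> real (card W) + n * of_bool (y \<in> B)"
            using max[of y] yU by (cases "y \<in> B") (auto simp: W_def)
        qed
        also have "\<dots> = real (card U1) * real (card W) + n * real (card (U1 \<inter> B))"
          using finW by (simp add: sum.distrib sum_distrib_left[symmetric] Int_def)
        also have "real (card (U1 \<inter> B)) \<le> \<epsilon> / 4 * n"
          using cB card_mono[OF finB, of "U1 \<inter> B"] by auto
        finally show ?thesis using n0 by (simp add: power2_eq_square mult.left_commute)
      qed
      have "\<forall>v\<in>U. \<phi>' v < Suc j"
        using \<phi> by (auto simp: \<phi>'_def intro: less_SucI)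
      moreover have "dsum U U ?G + dsum U U (\<lambda>y z. {y, z} \<in> G \<and> \<phi>' y = \<phi>' z)
         \<le> dsum U U (\<lambda>y z. \<phi>' y \<noteq> \<phi>' z) + \<epsilon> * n\<^sup>2"
        unfolding e i c using d le by (simp add: algebra_simps)
      ultimately show ?thesis by blast
    qed
  qed
qed

definition multipartite :: "'a set \<Rightarrow> ('a \<Rightarrow> nat) \<Rightarrow> 'a set set" where
  "multipartite V \<phi> = {{x, y} | x y. x \<in> V \<and> y \<in> V \<and> \<phi> x \<noteq> \<phi> y}"

lemma turan_graph_eq: "turan_graph (Suc k) n = multipartite {1..n} (\<lambda>x. x mod k)"
  by (simp add: turan_graph_def multipartite_def)

lemma multipartite_subset: "multipartite V \<phi> \<subseteq> [V]\<^bsup>2\<^esup>"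
  by (auto simp: multipartite_def nsets_def card_2_iff)

lemma doubleton_in_multipartite: "{y, z} \<in> multipartite V \<phi> \<longleftrightarrow> y \<in> V \<and> z \<in> V \<and> \<phi> y \<noteq> \<phi> z"
  by (auto simp: multipartite_def doubleton_eq_iff)

lemma dsum_edges:
  assumes "finite V" "E \<subseteq> [V]\<^bsup>2\<^esup>"
  shows "dsum V V (\<lambda>y z. {y, z} \<in> E) = 2 * real (card E)"
proof -
  have finE: "finite E" using assms finite_imp_finite_nsets finite_subset by blast
  have "dsum V V (\<lambda>y z. {y, z} \<in> E) = (\<Sum>y\<in>V. \<Sum>z\<in>V. \<Sum>e\<in>E. of_bool ({y, z} = e))"
    using finE by (intro sum.cong refl) (simp add: of_bool_def sum.delta')
  also have "\<dots> = (\<Sum>y\<in>V. \<Sum>e\<in>E. \<Sum>z\<in>V. of_bool ({y, z} = e))"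
    by (intro sum.cong refl sum.swap)
  also have "\<dots> = (\<Sum>e\<in>E. \<Sum>y\<in>V. \<Sum>z\<in>V. of_bool ({y, z} = e))"
    by (rule sum.swap)
  also have "\<dots> = (\<Sum>e\<in>E. 2)"
  proof (intro sum.cong refl)
    fix e assume "e \<in> E"
    then have "e \<in> [V]\<^bsup>2\<^esup>" using assms(2) by blast
    then obtain a b where ab: "a \<in> V" "b \<in> V" "a \<noteq> b" "e = {a, b}"
      by (auto simp: nsets_def card_2_iff)
    have "of_bool ({y, z} = e) = of_bool (y = a) * of_bool (z = b) + (of_bool (y = b) * of_bool (z = a) :: real)" for y z
      using ab by (auto simp: doubleton_eq_iff)
    then have "(\<Sum>y\<in>V. \<Sum>z\<in>V. of_bool ({y, z} = e)) = (\<Sum>y\<in>V. of_bool (y = a) + (of_bool (y = b) :: real))"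
      using ab assms(1) by (simp add: sum.distrib sum_distrib_left[symmetric] of_bool_def[of "_ = _"] )
    also have "\<dots> = 2" using ab assms(1) by (simp add: sum.distrib of_bool_def[of "_ = _"])
    finally show "(\<Sum>y\<in>V. \<Sum>z\<in>V. of_bool ({y, z} = e)) = (2::real)" .
  qed
  finally show ?thesis by simp
qed

lemma card_multipartite:
  assumes "finite V" "\<And>v. v \<in> V \<Longrightarrow> \<phi> v < k"
  shows "2 * real (card (multipartite V \<phi>)) = (real (card V))\<^sup>2 - (\<Sum>j<k. (real (card {v \<in> V. \<phi> v = j}))\<^sup>2)"
proof -
  have "2 * real (card (multipartite V \<phi>)) = dsum V V (\<lambda>y z. {y, z} \<in> multipartite V \<phi>)"
    using dsum_edges[OF assms(1) multipartite_subset] by simp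
  also have "\<dots> = dsum V V (\<lambda>y z. \<phi> y \<noteq> \<phi> z)"
    by (rule dsum_cong) (simp add: doubleton_in_multipartite)
  also have "\<dots> = (\<Sum>y\<in>V. \<Sum>z\<in>V. 1 - of_bool (\<phi> z = \<phi> y))"
    by (intro sum.cong) auto
  also have "\<dots> = (real (card V))\<^sup>2 - (\<Sum>y\<in>V. \<Sum>z\<in>V. of_bool (\<phi> z = \<phi> y))"
    by (simp add: sum_subtractf power2_eq_square)
  also have "(\<Sum>y\<in>V. \<Sum>z\<in>V. of_bool (\<phi> z = \<phi> y)) = (\<Sum>y\<in>V. real (card {v \<in> V. \<phi> v = \<phi> y}))"
    using assms(1) by (simp add: Int_def)
  also have "\<dots> = (\<Sum>j<k. \<Sum>y\<in>{v \<in> V. \<phi> v = j}. real (card {v \<in> V. \<phi> v = \<phi> y}))"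
    using assms by (intro sum.group[symmetric]) auto
  also have "\<dots> = (\<Sum>j<k. (real (card {v \<in> V. \<phi> v = j}))\<^sup>2)"
    by (intro sum.cong refl) (simp add: power2_eq_square)
  finally show ?thesis .
qed

lemma sum_card_classes:
  assumes "finite V" "\<And>v. v \<in> V \<Longrightarrow> \<phi> v < (k::nat)"
  shows "(\<Sum>j<k. card {v \<in> V. \<phi> v = j}) = card V"
proof -
  have "(\<Sum>j<k. \<Sum>v\<in>{v \<in> V. \<phi> v = j}. 1) = (\<Sum>v\<in>V. 1::nat)"
    using assms by (intro sum.group) auto
  then show ?thesis by simp
qed

lemma sum_squares_balanced_le:
  fixes a s :: "nat \<Rightarrow> int"
  assumes "(\<Sum>j<k. a j) = (\<Sum>j<k. s j)" "\<And>i j. i < k \<Longrightarrow> j < k \<Longrightarrow> s i \<le> s j + 1"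
  shows "(\<Sum>j<k. (s j)\<^sup>2) \<le> (\<Sum>j<k. (a j)\<^sup>2)"
proof (cases "k = 0")
  case False
  define q where "q = Min (s ` {..<k})"
  have "q \<in> s ` {..<k}" unfolding q_def using False by (intro Min_in) auto
  then obtain i where i: "i < k" "q = s i" by auto
  have s: "s j = q \<or> s j = q + 1" if "j < k" for j
  proof -
    have "q \<le> s j" unfolding q_def using that by (intro Min_le) auto
    then show ?thesis using assms(2)[OF that i(1)] i(2) by auto
  qed
  have "(\<Sum>j<k. (s j)\<^sup>2 - (2 * q + 1) * s j + q * (q + 1)) = (\<Sum>j<k. 0)"
  proof (intro sum.cong refl)
    fix j assume "j \<in> {..<k}"
    then have "(s j - q) * (s j - q - 1) = 0" using s[of j] by auto
    then show "(s j)\<^sup>2 - (2 * q + 1) * s j + q * (q + 1) = 0"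
      by (simp add: power2_eq_square algebra_simps)
  qed
  moreover have "(\<Sum>j<k. (a j)\<^sup>2 - (2 * q + 1) * a j + q * (q + 1)) \<ge> 0"
  proof (intro sum_nonneg)
    fix j
    have "(a j - q) * (a j - q - 1) \<ge> 0"
      by (cases "a j \<ge> q + 1") (auto intro: mult_nonneg_nonneg mult_nonpos_nonpos)
    then show "(a j)\<^sup>2 - (2 * q + 1) * a j + q * (q + 1) \<ge> 0"
      by (simp add: power2_eq_square algebra_simps)
  qed
  ultimately show ?thesis
    using assms(1) by (simp add: sum.distrib sum_subtractf sum_distrib_left[symmetric])
qed simp

abbreviation residue_class_size :: "nat \<Rightarrow> nat \<Rightarrow> nat \<Rightarrow> nat" where
  "residue_class_size k n j \<equiv> card {x \<in> {1..n}. x mod k = j}"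

lemma sum_residue_class_size: "k > 0 \<Longrightarrow> (\<Sum>j<k. residue_class_size k n j) = n"
  using sum_card_classes[of "{1..n}" "\<lambda>x. x mod k" k] by simp

lemma residue_class_size_bounds:
  assumes "j < k"
  shows "real (residue_class_size k n j) \<le> real n / real k + 1" "real n / real k - 1 \<le> real (residue_class_size k n j)"
proof -
  let ?s = "\<lambda>j. real (residue_class_size k n j)"
  have S: "(\<Sum>i<k. ?s i) = real n"
    using sum_residue_class_size[of k n] assms unfolding of_nat_sum[symmetric] by simp
  have 1: "?s i \<le> ?s i' + 1" if "i < k" "i' < k" for i i'
    using residue_classes_balanced[OF that, of n] by linarith
  have "(\<Sum>i<k. ?s j) \<le> (\<Sum>i<k. ?s i + 1)" using 1 assms by (intro sum_mono) auto
  then have "real k * ?s j \<le> real n + real k" using S by (simp add: sum.distrib)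
  then show "?s j \<le> real n / real k + 1" using assms by (simp add: field_simps)
  have "(\<Sum>i<k. ?s i) \<le> (\<Sum>i<k. ?s j + 1)" using 1 assms by (intro sum_mono) auto
  then have "real n \<le> real k * ?s j + real k" using S by (simp add: algebra_simps)
  then show "real n / real k - 1 \<le> ?s j" using assms by (simp add: field_simps)
qed

lemma turan_number_eq:
  "k > 0 \<Longrightarrow> 2 * real (turan_number (Suc k) n) = (real n)\<^sup>2 - (\<Sum>j<k. (real (residue_class_size k n j))\<^sup>2)"
  using card_multipartite[of "{1..n}" "\<lambda>x. x mod k" k] by (simp add: turan_number_def turan_graph_eq)

lemma card_multipartite_le_turan:
  assumes "k > 0" "\<And>v. v \<in> {1..n} \<Longrightarrow> \<phi> v < k"
  shows "card (multipartite {1..n} \<phi>) \<le> turan_number (Suc k) n"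
proof -
  let ?a = "\<lambda>j. card {v \<in> {1..n}. \<phi> v = j}"
  have "(\<Sum>j<k. (int (residue_class_size k n j))\<^sup>2) \<le> (\<Sum>j<k. (int (?a j))\<^sup>2)"
  proof (rule sum_squares_balanced_le)
    show "(\<Sum>j<k. int (?a j)) = (\<Sum>j<k. int (residue_class_size k n j))"
      using sum_card_classes[of "{1..n}" \<phi> k] assms sum_residue_class_size[of k n]
      unfolding of_nat_sum[symmetric] by simp
    show "int (residue_class_size k n i) \<le> int (residue_class_size k n j) + 1" if "i < k" "j < k" for i j
      using residue_classes_balanced[OF that, of n] by linarith
  qed
  then have "real_of_int (\<Sum>j<k. (int (residue_class_size k n j))\<^sup>2) \<le> real_of_int (\<Sum>j<k. (int (?a j))\<^sup>2)"
    by (simp only: of_int_le_iff)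
  then have "2 * real (card (multipartite {1..n} \<phi>)) \<le> 2 * real (turan_number (Suc k) n)"
    using card_multipartite[of "{1..n}" \<phi> k] assms by (simp add: turan_number_eq)
  then show ?thesis by simp
qed

lemma sum_squares_deviation:
  fixes a :: "nat \<Rightarrow> real"
  assumes "k > 0" "(\<Sum>j<k. a j) = n"
  shows "(\<Sum>j<k. (a j - n / real k)\<^sup>2) = (\<Sum>j<k. (a j)\<^sup>2) - n\<^sup>2 / real k"
proof -
  have "(\<Sum>j<k. (a j - n / real k)\<^sup>2) = (\<Sum>j<k. (a j)\<^sup>2 - (2 * n / real k) * a j + (n / real k)\<^sup>2)"
    by (intro sum.cong refl) (simp add: power2_diff)
  also have "\<dots> = (\<Sum>j<k. (a j)\<^sup>2) - (2 * n / real k) * n + real k * (n / real k)\<^sup>2"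
    by (simp add: sum.distrib sum_subtractf sum_distrib_left[symmetric] sum_divide_distrib[symmetric] assms(2))
  finally show ?thesis using assms(1) by (simp add: power2_eq_square field_simps)
qed

lemma turan_number_ge:
  assumes "k > 0"
  shows "2 * real (turan_number (Suc k) n) \<ge> (real n)\<^sup>2 - (real n)\<^sup>2 / real k - real k"
proof -
  let ?s = "\<lambda>j. real (residue_class_size k n j)"
  have S: "(\<Sum>i<k. ?s i) = real n"
    using sum_residue_class_size[of k n] assms unfolding of_nat_sum[symmetric] by simp
  have "(\<Sum>j<k. (?s j - real n / real k)\<^sup>2) \<le> (\<Sum>j<k. 1)"
  proof (intro sum_mono)
    fix j assume "j \<in> {..<k}"
    then have "\<bar>?s j - real n / real k\<bar> \<le> 1" using residue_class_size_bounds[of j k n] by (auto simp: abs_le_iff)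
    then show "(?s j - real n / real k)\<^sup>2 \<le> 1" using abs_square_le_1 by blast
  qed
  then show ?thesis
    unfolding turan_number_eq[OF assms] using sum_squares_deviation[OF assms S] by simp
qed

section \<open>Undetected graphs near a Turan graph\<close>

definition rainbow :: "('a \<Rightarrow> nat) \<Rightarrow> 'a set \<Rightarrow> 'a set \<Rightarrow> bool" where
  "rainbow \<phi> e f \<longleftrightarrow> (\<forall>x\<in>f. \<forall>y\<in>f. x \<noteq> y \<and> {x, y} \<noteq> e \<longrightarrow> \<phi> x \<noteq> \<phi> y)"

definition mono_col :: "('a \<Rightarrow> nat) \<Rightarrow> 'a set \<Rightarrow> bool" where
  "mono_col \<phi> e \<longleftrightarrow> (\<forall>x\<in>e. \<forall>y\<in>e. \<phi> x = \<phi> y)"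

definition near_balanced :: "nat \<Rightarrow> nat \<Rightarrow> real \<Rightarrow> (nat \<Rightarrow> nat) \<Rightarrow> bool" where
  "near_balanced k n \<epsilon> \<phi> \<longleftrightarrow> (\<forall>v\<in>{1..n}. \<phi> v < k) \<and>
     (\<forall>j<k. \<bar>real (card {v \<in> {1..n}. \<phi> v = j}) - real n / real k\<bar> \<le> \<epsilon> * real n)"

definition rainbow_sets :: "'a set set \<Rightarrow> ('a \<Rightarrow> nat) \<Rightarrow> 'a set \<Rightarrow> 'a set set" where
  "rainbow_sets A \<phi> e = {f \<in> A. e \<subseteq> f \<and> rainbow \<phi> e f}"

definition hitting_sets :: "'a set set \<Rightarrow> 'a set set \<Rightarrow> 'a set set \<Rightarrow> 'a set set" where
  "hitting_sets A X Y = {f \<in> A. \<exists>a\<in>X. \<exists>b\<in>Y. a \<union> b \<subseteq> f}"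

definition transversal_sets :: "'a set set \<Rightarrow> 'a \<Rightarrow> ('a \<Rightarrow> nat) \<Rightarrow> 'a set \<Rightarrow> 'a set set \<Rightarrow> 'a set set" where
  "transversal_sets A u \<phi> N Y =
     {f \<in> A. u \<in> f \<and> f - {u} \<subseteq> N \<and> inj_on \<phi> (f - {u}) \<and> (\<forall>y\<in>Y. \<not> y \<subseteq> f - {u})}"

lemma card_incident_edges:
  assumes "E \<subseteq> [V]\<^bsup>2\<^esup>"
  shows "card {e \<in> E. u \<in> e} = card (nbrs E V u)"
proof -
  have "{e \<in> E. u \<in> e} = (\<lambda>z. {u, z}) ` nbrs E V u"
  proof (intro equalityI subsetI)
    fix e assume e: "e \<in> {e \<in> E. u \<in> e}"
    then have "e \<in> [V]\<^bsup>2\<^esup>" using assms by blast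
    then obtain a b where ab: "a \<in> V" "b \<in> V" "a \<noteq> b" "e = {a, b}"
      by (auto simp: nsets_def card_2_iff)
    then consider "u = a" | "u = b" using e by auto
    then show "e \<in> (\<lambda>z. {u, z}) ` nbrs E V u"
    proof cases
      case 1
      then show ?thesis using ab e by (intro image_eqI[of _ _ b]) (auto simp: nbrs_def)
    next
      case 2
      then show ?thesis using ab e by (intro image_eqI[of _ _ a]) (auto simp: nbrs_def insert_commute)
    qed
  qed (auto simp: nbrs_def)
  moreover have "inj_on (\<lambda>z. {u, z}) (nbrs E V u)"
    by (auto simp: inj_on_def doubleton_eq_iff)
  ultimately show ?thesis by (simp add: card_image)
qed

lemma card_edges_split_vertex:
  assumes "finite V" "E \<subseteq> [V]\<^bsup>2\<^esup>"
  shows "card E = card {e \<in> E. u \<notin> e} + card (nbrs E V u)"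
proof -
  have finE: "finite E" using assms finite_imp_finite_nsets finite_subset by blast
  have "card E = card ({e \<in> E. u \<notin> e} \<union> {e \<in> E. u \<in> e})"
    by (rule arg_cong[of _ _ card]) auto
  also have "\<dots> = card {e \<in> E. u \<notin> e} + card {e \<in> E. u \<in> e}"
    using finE by (intro card_Un_disjoint) auto
  finally show ?thesis by (simp only: card_incident_edges[OF assms(2)])
qed

text \<open>
  Take a colouring with fewest monochromatic edges \<open>X\<close>, and let \<open>Y\<close> be the missing bichromatic pairs, so that
  \<open>|Y| < |X|\<close>. Every hyperedge that is rainbow for some \<open>e \<in> X\<close> must contain a pair from \<open>Y\<close>, which
  contradicts the count of such hyperedges once \<open>X\<close> is known to have small maximum degree.
\<close>

lemma turannicalI:
  fixes n k :: nat and F :: "nat set set"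
  defines "V \<equiv> {1..n}" and "A \<equiv> [{1..n}]\<^bsup>Suc k\<^esup>"
  assumes k: "k \<ge> 1" and n: "n > 0" and FA: "F \<subseteq> A"
    and E1: "\<And>e \<phi>. e \<in> [V]\<^bsup>2\<^esup> \<Longrightarrow> near_balanced k n \<epsilon>\<^sub>b \<phi> \<Longrightarrow> mono_col \<phi> e \<Longrightarrow>
          \<delta> * real n \<le> real (card (F \<inter> rainbow_sets A \<phi> e))"
    and E2: "\<And>X Y. X \<subseteq> [V]\<^bsup>2\<^esup> \<Longrightarrow> Y \<subseteq> [V]\<^bsup>2\<^esup> \<Longrightarrow> X \<inter> Y = {} \<Longrightarrow> X \<noteq> {} \<Longrightarrow> card Y \<le> card X \<Longrightarrow>
          real (card Y) \<le> \<zeta> * (real n)\<^sup>2 \<Longrightarrow> (\<And>u. u \<in> V \<Longrightarrow> real (card (nbrs X V u)) \<le> \<epsilon>' * real n) \<Longrightarrow>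
          real (card (F \<inter> hitting_sets A X Y)) < \<delta> * real n * real (card X)"
    and E3: "\<And>G. G \<subseteq> [V]\<^bsup>2\<^esup> \<Longrightarrow> \<eta> * real n ^ Suc k \<le> real (card (cliques (Suc k) V G)) \<Longrightarrow>
          F \<inter> cliques (Suc k) V G \<noteq> {}"
    and E4: "\<And>u \<phi> N Y. u \<in> V \<Longrightarrow> Y \<subseteq> [V]\<^bsup>2\<^esup> \<Longrightarrow> real (card Y) \<le> \<zeta> * (real n)\<^sup>2 \<Longrightarrow> N \<subseteq> V - {u} \<Longrightarrow>
          (\<And>v. v \<in> V \<Longrightarrow> \<phi> v < k) \<Longrightarrow> (\<And>j. j < k \<Longrightarrow> \<epsilon>' * real n \<le> real (card {v \<in> N. \<phi> v = j})) \<Longrightarrow>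
          F \<inter> transversal_sets A u \<phi> N Y \<noteq> {}"
    and stab: "\<And>G. (\<And>x. {x} \<notin> G) \<Longrightarrow> real (card (cliques (Suc k) V G)) < \<eta> * real n ^ Suc k \<Longrightarrow>
          \<exists>\<phi>. (\<forall>v\<in>V. \<phi> v < k) \<and>
            dsum V V (\<lambda>y z. {y, z} \<in> G) + dsum V V (\<lambda>y z. {y, z} \<in> G \<and> \<phi> y = \<phi> z)
            \<le> dsum V V (\<lambda>y z. \<phi> y \<noteq> \<phi> z) + \<epsilon>\<^sub>s * (real n)\<^sup>2"
    and eps: "\<epsilon>\<^sub>s \<le> 2 * \<zeta>" "2 * \<epsilon>\<^sub>s \<le> \<epsilon>\<^sub>b\<^sup>2" "0 < \<epsilon>\<^sub>b" "real k \<le> \<epsilon>\<^sub>s * (real n)\<^sup>2"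
  shows "turannical (Suc k) n F"
  unfolding turannical_def
proof (intro conjI allI impI)
  show "F \<subseteq> [{1..n}]\<^bsup>Suc k\<^esup>" using FA by (simp add: A_def)
  fix G assume "G \<subseteq> [{1..n}]\<^bsup>2\<^esup> \<and> card G > turan_number (Suc k) n"
  then have GV: "G \<subseteq> [V]\<^bsup>2\<^esup>" and cG: "card G > turan_number (Suc k) n" by (auto simp: V_def)
  have finV [simp]: "finite V" by (simp add: V_def)
  have cV: "card V = n" by (simp add: V_def)
  have finV2: "finite ([V]\<^bsup>2\<^esup>)" by (simp add: finite_imp_finite_nsets)
  have finA: "finite A" by (simp add: A_def finite_imp_finite_nsets)
  have finF: "finite F" using FA finA finite_subset by blast
  have finG: "finite G" using GV finV2 finite_subset by blast
  have noloop: "{x} \<notin> G" for x using GV by (auto simp: nsets_def)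
  show "detects (Suc k) F G"
  proof (rule ccontr)
    assume undet: "\<not> detects (Suc k) F G"
    have nocl: "\<not> clique f G" if "f \<in> F" for f
      using undet that FA by (auto simp: detects_def A_def nsets_def)
    have "F \<inter> cliques (Suc k) V G = {}" using nocl by (auto simp: cliques_def)
    then have "real (card (cliques (Suc k) V G)) < \<eta> * real n ^ Suc k"
      using E3[OF GV] by linarith
    from stab[OF noloop this] obtain \<phi>0 where \<phi>0: "\<And>v. v \<in> V \<Longrightarrow> \<phi>0 v < k"
      and st: "dsum V V (\<lambda>y z. {y, z} \<in> G) + dsum V V (\<lambda>y z. {y, z} \<in> G \<and> \<phi>0 y = \<phi>0 z)
            \<le> dsum V V (\<lambda>y z. \<phi>0 y \<noteq> \<phi>0 z) + \<epsilon>\<^sub>s * (real n)\<^sup>2" by blast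
    define X where "X \<phi> = {e \<in> G. mono_col \<phi> e}" for \<phi> :: "nat \<Rightarrow> nat"
    have XG: "X \<phi> \<subseteq> G" for \<phi> by (auto simp: X_def)
    have XV: "X \<phi> \<subseteq> [V]\<^bsup>2\<^esup>" for \<phi> using XG GV by blast
    have finX: "finite (X \<phi>)" for \<phi> using XG finG finite_subset by blast
    have Xmem: "{y, z} \<in> X \<phi> \<longleftrightarrow> {y, z} \<in> G \<and> \<phi> y = \<phi> z" for y z \<phi>
      by (auto simp: X_def mono_col_def)
    have "\<exists>\<phi>. (\<forall>v\<in>V. \<phi> v < k) \<and> (\<forall>\<psi>. (\<forall>v\<in>V. \<psi> v < k) \<longrightarrow> card (X \<phi>) \<le> card (X \<psi>))"
      using ex_has_least_nat[of "\<lambda>\<phi>. \<forall>v\<in>V. \<phi> v < k" \<phi>0 "\<lambda>\<phi>. card (X \<phi>)"] \<phi>0 by blast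
    then obtain \<phi> where \<phi>: "\<And>v. v \<in> V \<Longrightarrow> \<phi> v < k"
      and min: "\<And>\<psi>. (\<And>v. v \<in> V \<Longrightarrow> \<psi> v < k) \<Longrightarrow> card (X \<phi>) \<le> card (X \<psi>)" by blast
    define M where "M = multipartite V \<phi>"
    define Y where "Y = M - G"
    have MV: "M \<subseteq> [V]\<^bsup>2\<^esup>" by (simp add: M_def multipartite_subset)
    have finM: "finite M" using MV finV2 finite_subset by blast
    have X0: "2 * real (card (X \<phi>0)) \<le> \<epsilon>\<^sub>s * (real n)\<^sup>2"
    proof -
      have "dsum V V (\<lambda>y z. {y, z} \<in> G \<and> \<phi>0 y = \<phi>0 z) = 2 * real (card (X \<phi>0))"
        unfolding dsum_edges[OF finV XV, symmetric] by (rule dsum_cong) (simp add: Xmem)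
      moreover have "dsum V V (\<lambda>y z. {y, z} \<in> G) = 2 * real (card G)"
        by (rule dsum_edges[OF finV GV])
      moreover have "dsum V V (\<lambda>y z. \<phi>0 y \<noteq> \<phi>0 z) = 2 * real (card (multipartite V \<phi>0))"
        unfolding dsum_edges[OF finV multipartite_subset, symmetric]
        by (rule dsum_cong) (simp add: doubleton_in_multipartite)
      moreover have "card (multipartite V \<phi>0) \<le> turan_number (Suc k) n"
        unfolding V_def using k \<phi>0 by (intro card_multipartite_le_turan) (auto simp: V_def)
      ultimately show ?thesis using st cG by linarith
    qed
    have Xs: "2 * real (card (X \<phi>)) \<le> \<epsilon>\<^sub>s * (real n)\<^sup>2"
    proof -
      have "card (X \<phi>) \<le> card (X \<phi>0)" by (rule min) (rule \<phi>0)
      then show ?thesis using X0 by linarith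
    qed
    have Gun: "card G = card (X \<phi>) + card (M \<inter> G)"
    proof -
      have "e \<in> X \<phi> \<or> e \<in> M" if "e \<in> G" for e
      proof -
        have "e \<in> [V]\<^bsup>2\<^esup>" using that GV by blast
        then obtain a b where "a \<in> V" "b \<in> V" "a \<noteq> b" "e = {a, b}"
          by (auto simp: nsets_def card_2_iff)
        then show ?thesis using that Xmem[of a b \<phi>] by (auto simp: M_def doubleton_in_multipartite)
      qed
      then have "card G = card (X \<phi> \<union> (M \<inter> G))"
        using XG[of \<phi>] by (intro arg_cong[of _ _ card]) blast
      also have "\<dots> = card (X \<phi>) + card (M \<inter> G)"
        using finX finM by (intro card_Un_disjoint) (auto simp: M_def multipartite_def Xmem)
      finally show ?thesis .
    qed
    have cM: "card M = card (M \<inter> G) + card Y"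
      unfolding Y_def using finM by (rule card_Int_Diff)
    have MT: "card M \<le> turan_number (Suc k) n"
      unfolding M_def V_def using k \<phi> by (intro card_multipartite_le_turan) (auto simp: V_def)
    have YX: "card Y < card (X \<phi>)" using Gun cM MT cG by linarith
    have XY: "X \<phi> \<inter> Y = {}" using XG by (auto simp: Y_def)
    have YV: "Y \<subseteq> [V]\<^bsup>2\<^esup>" using MV by (auto simp: Y_def)
    have Ys: "real (card Y) \<le> \<zeta> * (real n)\<^sup>2"
    proof -
      have "real (card Y) \<le> \<epsilon>\<^sub>s / 2 * (real n)\<^sup>2" using Xs YX by linarith
      also have "\<dots> \<le> \<zeta> * (real n)\<^sup>2" using eps(1) by (intro mult_right_mono) auto
      finally show ?thesis .
    qed
    have bal: "near_balanced k n \<epsilon>\<^sub>b \<phi>"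
      unfolding near_balanced_def V_def[symmetric]
    proof (intro conjI allI impI ballI)
      fix j assume j: "j < k"
      let ?a = "\<lambda>j. real (card {v \<in> V. \<phi> v = j})"
      have S: "(\<Sum>j<k. ?a j) = real n"
        using sum_card_classes[of V \<phi> k] \<phi> cV unfolding of_nat_sum[symmetric] by simp
      have "2 * real (card M) = (real n)\<^sup>2 - (\<Sum>j<k. (?a j)\<^sup>2)"
        unfolding M_def using card_multipartite[of V \<phi> k] \<phi> cV by simp
      moreover have "2 * real (turan_number (Suc k) n) \<ge> (real n)\<^sup>2 - (real n)\<^sup>2 / real k - real k"
        using k by (intro turan_number_ge) auto
      moreover have "real (card G) \<le> real (card (X \<phi>)) + real (card M)" using Gun cM by linarith
      ultimately have "(\<Sum>j<k. (?a j)\<^sup>2) - (real n)\<^sup>2 / real k \<le> real k + \<epsilon>\<^sub>s * (real n)\<^sup>2"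
        using cG Xs by linarith
      then have *: "(\<Sum>j<k. (?a j - real n / real k)\<^sup>2) \<le> 2 * \<epsilon>\<^sub>s * (real n)\<^sup>2"
        using sum_squares_deviation[OF _ S] k eps(4) by simp
      have "(?a j - real n / real k)\<^sup>2 \<le> (\<Sum>j<k. (?a j - real n / real k)\<^sup>2)"
        using j by (intro member_le_sum) auto
      also note *
      also have "2 * \<epsilon>\<^sub>s * (real n)\<^sup>2 \<le> \<epsilon>\<^sub>b\<^sup>2 * (real n)\<^sup>2" using eps(2) by (intro mult_right_mono) auto
      finally have "(?a j - real n / real k)\<^sup>2 \<le> (\<epsilon>\<^sub>b * real n)\<^sup>2" by (simp add: power_mult_distrib)
      then have "\<bar>?a j - real n / real k\<bar> \<le> \<bar>\<epsilon>\<^sub>b * real n\<bar>" by (simp add: abs_le_square_iff)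
      then show "\<bar>?a j - real n / real k\<bar> \<le> \<epsilon>\<^sub>b * real n" using eps(3) by simp
    qed (use \<phi> in auto)
    have deg: "real (card (nbrs (X \<phi>) V u)) \<le> \<epsilon>' * real n" if u: "u \<in> V" for u
    proof (rule ccontr)
      assume big: "\<not> real (card (nbrs (X \<phi>) V u)) \<le> \<epsilon>' * real n"
      define N where "N = nbrs G V u"
      have NV: "N \<subseteq> V - {u}" using noloop[of u] by (auto simp: N_def nbrs_def)
      have "\<epsilon>' * real n \<le> real (card {v \<in> N. \<phi> v = j})" if j: "j < k" for j
      proof -
        define \<psi> where "\<psi> = \<phi>(u := j)"
        have "\<psi> v < k" if "v \<in> V" for v using that \<phi> j by (auto simp: \<psi>_def)
        then have "card (X \<phi>) \<le> card (X \<psi>)" by (rule min)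
        moreover have "{e \<in> X \<psi>. u \<notin> e} = {e \<in> X \<phi>. u \<notin> e}"
          by (auto simp: X_def mono_col_def \<psi>_def)
        moreover have "nbrs (X \<psi>) V u = {v \<in> N. \<phi> v = j}"
          using NV by (auto simp: nbrs_def Xmem N_def \<psi>_def)
        ultimately have "card (nbrs (X \<phi>) V u) \<le> card {v \<in> N. \<phi> v = j}"
          using card_edges_split_vertex[OF finV XV, of \<phi> u] card_edges_split_vertex[OF finV XV, of \<psi> u]
          by simp
        then show ?thesis using big by linarith
      qed
      from E4[OF u YV Ys NV \<phi> this] obtain f where f: "f \<in> F" "f \<in> transversal_sets A u \<phi> N Y" by auto
      have fV: "f \<subseteq> V" using f(2) by (auto simp: transversal_sets_def A_def nsets_def V_def)
      have "clique f G"
        unfolding clique_def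
      proof (intro ballI impI)
        fix x y assume xy: "x \<in> f" "y \<in> f" "x \<noteq> y"
        consider "x = u" | "y = u" | "x \<noteq> u" "y \<noteq> u" by blast
        then show "{x, y} \<in> G"
        proof cases
          case 1
          then show ?thesis using xy f(2) by (auto simp: transversal_sets_def N_def nbrs_def)
        next
          case 2
          then show ?thesis using xy f(2) by (auto simp: transversal_sets_def N_def nbrs_def insert_commute)
        next
          case 3
          then have "\<phi> x \<noteq> \<phi> y" "{x, y} \<notin> Y"
            using f(2) xy by (auto simp: transversal_sets_def inj_on_def)
          then show ?thesis using xy fV by (auto simp: Y_def M_def doubleton_in_multipartite)
        qed
      qed
      then show False using nocl f(1) by blast
    qed
    have "X \<phi> \<noteq> {}" using YX by auto
    from E2[OF XV YV XY this less_imp_le[OF YX] Ys deg]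
    have lt: "real (card (F \<inter> hitting_sets A (X \<phi>) Y)) < \<delta> * real n * real (card (X \<phi>))" by simp
    have sub: "F \<inter> rainbow_sets A \<phi> e \<subseteq> F \<inter> hitting_sets A (X \<phi>) Y" if e: "e \<in> X \<phi>" for e
    proof
      fix f assume f: "f \<in> F \<inter> rainbow_sets A \<phi> e"
      then have fA: "f \<in> A" "e \<subseteq> f" "rainbow \<phi> e f" by (auto simp: rainbow_sets_def)
      obtain x y where xy: "x \<in> f" "y \<in> f" "x \<noteq> y" "{x, y} \<notin> G"
        using nocl[of f] f by (auto simp: clique_def)
      then have "{x, y} \<noteq> e" using e XG by auto
      then have "\<phi> x \<noteq> \<phi> y" using xy fA(3) by (auto simp: rainbow_def)
      moreover have "x \<in> V" "y \<in> V" using fA(1) xy by (auto simp: A_def V_def nsets_def)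
      ultimately have "{x, y} \<in> Y" using xy by (auto simp: Y_def M_def doubleton_in_multipartite)
      moreover have "e \<union> {x, y} \<subseteq> f" using fA xy by auto
      ultimately show "f \<in> F \<inter> hitting_sets A (X \<phi>) Y"
        using f fA(1) e unfolding hitting_sets_def by blast
    qed
    have disj: "(F \<inter> rainbow_sets A \<phi> e) \<inter> (F \<inter> rainbow_sets A \<phi> e') = {}"
      if e: "e \<in> X \<phi>" "e' \<in> X \<phi>" "e \<noteq> e'" for e e'
    proof (rule ccontr)
      assume "\<not> ?thesis"
      then obtain f where f: "rainbow \<phi> e f" "e' \<subseteq> f" by (auto simp: rainbow_sets_def)
      have "e' \<in> [V]\<^bsup>2\<^esup>" using e XV by blast
      then obtain a b where ab: "a \<noteq> b" "e' = {a, b}" by (auto simp: nsets_def card_2_iff)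
      then have "\<phi> a = \<phi> b" using e(2) Xmem by simp
      moreover have "\<phi> a \<noteq> \<phi> b" using f ab e(3) unfolding rainbow_def by blast
      ultimately show False by simp
    qed
    have "\<delta> * real n * real (card (X \<phi>)) = (\<Sum>e\<in>X \<phi>. \<delta> * real n)" by simp
    also have "\<dots> \<le> (\<Sum>e\<in>X \<phi>. real (card (F \<inter> rainbow_sets A \<phi> e)))"
    proof (intro sum_mono E1 bal)
      fix e assume e: "e \<in> X \<phi>"
      then show "e \<in> [V]\<^bsup>2\<^esup>" using XV by blast
      show "mono_col \<phi> e" using e by (simp add: X_def)
    qed
    also have "\<dots> = real (card (\<Union>e\<in>X \<phi>. F \<inter> rainbow_sets A \<phi> e))"
      unfolding of_nat_sum[symmetric] using finX finF disj
      by (intro arg_cong[of _ _ real] card_UN_disjoint[symmetric]) auto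
    also have "\<dots> \<le> real (card (F \<inter> hitting_sets A (X \<phi>) Y))"
      using sub finF by (intro of_nat_mono card_mono) auto
    finally show False using lt by simp
  qed
qed

section \<open>Union bounds\<close>

lemma sum_power_card_Pow:
  fixes z :: real
  assumes "finite P"
  shows "(\<Sum>X\<in>Pow P. z ^ card X) = (1 + z) ^ card P"
  using assms
proof (induction P rule: finite_induct)
  case (insert x P)
  have inj: "inj_on (insert x) (Pow P)"
    using insert.hyps by (auto simp: inj_on_def)
  have "(\<Sum>X\<in>Pow (insert x P). z ^ card X) = (\<Sum>X\<in>Pow P. z ^ card X) + (\<Sum>X\<in>insert x ` Pow P. z ^ card X)"
    unfolding Pow_insert using insert.hyps by (intro sum.union_disjoint) auto
  also have "(\<Sum>X\<in>insert x ` Pow P. z ^ card X) = (\<Sum>X\<in>Pow P. z * z ^ card X)"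
    unfolding sum.reindex[OF inj] o_def
  proof (intro sum.cong refl)
    fix X assume "X \<in> Pow P"
    then have "finite X" "x \<notin> X" using insert.hyps finite_subset by auto
    then show "z ^ card (insert x X) = z * z ^ card X" by simp
  qed
  finally show ?case
    using insert by (simp add: sum_distrib_left[symmetric] algebra_simps)
qed simp

lemma card_small_subsets_le:
  assumes "finite P" "0 \<le> s"
  shows "real (card {Y \<in> Pow P. real (card Y) \<le> m}) \<le> exp (s * m + real (card P) * exp (-s))"
proof -
  have "real (card {Y \<in> Pow P. real (card Y) \<le> m}) = (\<Sum>Y\<in>{Y \<in> Pow P. real (card Y) \<le> m}. 1)" by simp
  also have "\<dots> \<le> (\<Sum>Y\<in>{Y \<in> Pow P. real (card Y) \<le> m}. exp (s * m) * exp (-s) ^ card Y)"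
  proof (intro sum_mono)
    fix Y assume "Y \<in> {Y \<in> Pow P. real (card Y) \<le> m}"
    then have "0 \<le> s * (m - real (card Y))" using assms by auto
    then show "1 \<le> exp (s * m) * exp (-s) ^ card Y"
      by (simp add: exp_of_nat_mult[symmetric] exp_add[symmetric] algebra_simps)
  qed
  also have "\<dots> \<le> (\<Sum>Y\<in>Pow P. exp (s * m) * exp (-s) ^ card Y)"
    using assms by (intro sum_mono2) auto
  also have "\<dots> = exp (s * m) * (1 + exp (-s)) ^ card P"
    using sum_power_card_Pow[OF assms(1), of "exp (-s)"] by (simp add: sum_distrib_left[symmetric])
  also have "\<dots> \<le> exp (s * m) * exp (real (card P) * exp (-s))"
    by (intro mult_left_mono one_plus_power_le_exp) (auto intro: order_trans[of _ 0])
  finally show ?thesis by (simp add: exp_add)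
qed

lemma card_nsets_le_power: "finite V \<Longrightarrow> card ([V]\<^bsup>j\<^esup>) \<le> card V ^ j"
  by (cases "j \<le> card V") (auto simp: card_nsets binomial_le_pow binomial_eq_0)

lemma card_supersets_le:
  assumes "finite V" "finite T" "card T \<le> m"
  shows "card {f \<in> [V]\<^bsup>m\<^esup>. T \<subseteq> f} \<le> card V ^ (m - card T)"
proof -
  have "card {f \<in> [V]\<^bsup>m\<^esup>. T \<subseteq> f} \<le> card (nsets V (m - card T))"
  proof (rule card_inj_on_le)
    show "inj_on (\<lambda>f. f - T) {f \<in> [V]\<^bsup>m\<^esup>. T \<subseteq> f}" by (auto simp: inj_on_def)
    show "(\<lambda>f. f - T) ` {f \<in> [V]\<^bsup>m\<^esup>. T \<subseteq> f} \<subseteq> nsets V (m - card T)"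
      using assms by (auto simp: nsets_def card_Diff_subset)
  qed (simp add: assms finite_imp_finite_nsets)
  with card_nsets_le_power[OF assms(1), of "m - card T"] show ?thesis by linarith
qed

lemma expected_supersets_le:
  assumes "k \<ge> 2" "n > 0" "0 \<le> p" "p * real n ^ (k - 2) \<le> C" "finite T"
  shows "card T = 2 \<Longrightarrow> p * real (card {f \<in> [{1..n}]\<^bsup>Suc k\<^esup>. T \<subseteq> f}) \<le> C * real n"
    and "card T = 3 \<Longrightarrow> p * real (card {f \<in> [{1..n}]\<^bsup>Suc k\<^esup>. T \<subseteq> f}) \<le> C"
    and "card T = 4 \<Longrightarrow> p * real (card {f \<in> [{1..n}]\<^bsup>Suc k\<^esup>. T \<subseteq> f}) \<le> C / real n"
proof -
  have C: "0 \<le> C" using assms(3,4) by (intro order_trans[OF _ assms(4)]) auto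
  have le: "p * real (card {f \<in> [{1..n}]\<^bsup>Suc k\<^esup>. T \<subseteq> f}) \<le> p * real n ^ (Suc k - card T)" if "card T \<le> Suc k"
  proof (intro mult_left_mono assms)
    show "real (card {f \<in> [{1..n}]\<^bsup>Suc k\<^esup>. T \<subseteq> f}) \<le> real n ^ (Suc k - card T)"
      using card_supersets_le[of "{1..n}" T "Suc k"] that assms(5) unfolding of_nat_power[symmetric] by simp
  qed
  show "p * real (card {f \<in> [{1..n}]\<^bsup>Suc k\<^esup>. T \<subseteq> f}) \<le> C * real n" if "card T = 2"
  proof -
    have "Suc k - card T = Suc (k - 2)" using that assms(1) by simp
    then have "p * real n ^ (Suc k - card T) = (p * real n ^ (k - 2)) * real n" by simp
    also have "\<dots> \<le> C * real n" using assms by (intro mult_right_mono) auto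
    finally show ?thesis using le that assms(1) by simp
  qed
  show "p * real (card {f \<in> [{1..n}]\<^bsup>Suc k\<^esup>. T \<subseteq> f}) \<le> C" if "card T = 3"
  proof -
    have "Suc k - card T = k - 2" using that assms(1) by simp
    then show ?thesis using le that assms(1,4) by simp
  qed
  show "p * real (card {f \<in> [{1..n}]\<^bsup>Suc k\<^esup>. T \<subseteq> f}) \<le> C / real n" if "card T = 4"
  proof (cases "k = 2")
    case True
    have "\<not> T \<subseteq> f" if "f \<in> [{1..n}]\<^bsup>Suc k\<^esup>" for f
      using card_mono[of f T] that \<open>card T = 4\<close> True by (auto simp: nsets_def)
    then have "{f \<in> [{1..n}]\<^bsup>Suc k\<^esup>. T \<subseteq> f} = {}" by blast
    then have z: "card {f \<in> [{1..n}]\<^bsup>Suc k\<^esup>. T \<subseteq> f} = 0" by (simp only: card.empty)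
    show ?thesis unfolding z using C by simp
  next
    case False
    then have "k - 2 = Suc (Suc k - card T)" using that assms(1) by simp
    then have "real n * (p * real n ^ (Suc k - card T)) = p * real n ^ (k - 2)" by simp
    then have "real n * (p * real n ^ (Suc k - card T)) \<le> C" using assms(4) by (simp only:)
    then have "p * real n ^ (Suc k - card T) \<le> C / real n"
      using assms(2) by (simp add: pos_le_divide_eq mult.commute del: power_Suc)
    then show ?thesis using le that assms(1) False by force
  qed
qed

lemma card_pairs_le: "card ([{1..n::nat}]\<^bsup>2\<^esup>) \<le> n\<^sup>2"
  using card_nsets_le_power[of "{1..n}" 2] by simp

lemma bprob_Bex_le_const:
  assumes "0 \<le> p" "p \<le> 1" "finite I" "\<And>i. i \<in> I \<Longrightarrow> bprob p A (Q i) \<le> b"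
  shows "bprob p A (\<lambda>S. \<exists>i\<in>I. Q i S) \<le> real (card I) * b"
  using order_trans[OF bprob_Bex_le[OF assms(1-3), of A Q] sum_bounded_above[of I "\<lambda>i. bprob p A (Q i)" b]] assms(4)
  by simp

lemma prob_undetected_many_cliques_le:
  assumes k: "k \<ge> 2" and n: "n > 0" and p: "0 \<le> p" "p \<le> 1" and c: "c \<le> p * real n ^ (k - 2)" and \<eta>: "\<eta> \<ge> 0"
  shows "bprob p ([{1..n}]\<^bsup>Suc k\<^esup>) (\<lambda>S. \<exists>G\<in>Pow ([{1..n}]\<^bsup>2\<^esup>).
      \<eta> * real n ^ Suc k \<le> real (card (cliques (Suc k) {1..n} G)) \<and> S \<inter> cliques (Suc k) {1..n} G = {})
    \<le> exp ((real n)\<^sup>2 - c * \<eta> * real n ^ 3)"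
proof -
  let ?A = "[{1..n}]\<^bsup>Suc k\<^esup>" and ?I = "Pow ([{1..n}]\<^bsup>2\<^esup>)"
  have fin: "finite ?A" "finite ([{1..n}]\<^bsup>2\<^esup>)" by (simp_all add: finite_imp_finite_nsets)
  have "bprob p ?A (\<lambda>S. \<exists>G\<in>?I. \<eta> * real n ^ Suc k \<le> real (card (cliques (Suc k) {1..n} G))
       \<and> S \<inter> cliques (Suc k) {1..n} G = {}) \<le> real (card ?I) * exp (- (c * \<eta> * real n ^ 3))"
  proof (intro bprob_Bex_le_const p)
    fix G
    let ?K = "cliques (Suc k) {1..n} G"
    show "bprob p ?A (\<lambda>S. \<eta> * real n ^ Suc k \<le> real (card ?K) \<and> S \<inter> ?K = {}) \<le> exp (- (c * \<eta> * real n ^ 3))"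
    proof (cases "\<eta> * real n ^ Suc k \<le> real (card ?K)")
      case True
      have "Suc k = (k - 2) + 3" using k by simp
      then have e: "real n ^ Suc k = real n ^ (k - 2) * real n ^ 3" by (metis power_add)
      have "c * \<eta> * real n ^ 3 \<le> (p * real n ^ (k - 2)) * (\<eta> * real n ^ 3)"
        unfolding mult.assoc[of c] using \<eta> by (intro mult_right_mono c) auto
      also have "\<dots> = p * (\<eta> * real n ^ Suc k)" unfolding e by (simp only: mult_ac)
      also have "\<dots> \<le> p * real (card ?K)" using True p by (intro mult_left_mono) auto
      finally have "exp (- (p * real (card ?K))) \<le> exp (- (c * \<eta> * real n ^ 3))" by simp
      moreover have "bprob p ?A (\<lambda>S. S \<inter> ?K = {}) \<le> exp (- (p * real (card ?K)))"
        using fin p by (intro bprob_disjoint_le) (auto simp: cliques_def)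
      ultimately have "bprob p ?A (\<lambda>S. S \<inter> ?K = {}) \<le> exp (- (c * \<eta> * real n ^ 3))" by (rule order_trans[rotated])
      then show ?thesis using True by simp
    next
      case False
      then show ?thesis using fin by (simp add: bexp_const)
    qed
  qed (use fin in auto)
  also have "real (card ?I) \<le> exp ((real n)\<^sup>2)"
  proof -
    have "real (card ?I) = 2 ^ card ([{1..n}]\<^bsup>2\<^esup>)" using fin by (simp add: card_Pow)
    also have "\<dots> \<le> 2 ^ (n\<^sup>2)" by (intro power_increasing card_pairs_le) auto
    also have "\<dots> \<le> exp 1 ^ (n\<^sup>2)" using exp_ge_add_one_self[of "1::real"] by (intro power_mono) auto
    finally show ?thesis by (simp add: exp_of_nat_mult[symmetric])
  qed
  finally show ?thesis by (simp add: exp_diff exp_minus field_simps)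
qed

lemma card_transversals:
  assumes "finite J" "finite N"
  shows "card ((\<lambda>x. x ` J) ` (\<Pi>\<^sub>E j\<in>J. {v \<in> N. \<phi> v = j})) = (\<Prod>j\<in>J. card {v \<in> N. \<phi> v = j})"
proof -
  have "inj_on (\<lambda>x. x ` J) (\<Pi>\<^sub>E j\<in>J. {v \<in> N. \<phi> v = j})"
  proof (rule inj_onI)
    fix x y assume x: "x \<in> (\<Pi>\<^sub>E j\<in>J. {v \<in> N. \<phi> v = j})" and y: "y \<in> (\<Pi>\<^sub>E j\<in>J. {v \<in> N. \<phi> v = j})"
      and eq: "x ` J = y ` J"
    show "x = y"
    proof (rule PiE_ext[OF x y])
      fix j assume j: "j \<in> J"
      then obtain i where i: "i \<in> J" "x j = y i" using eq by blast
      then have "i = j" using x y j by (metis (mono_tags, lifting) PiE_mem mem_Collect_eq)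
      then show "x j = y j" using i by simp
    qed
  qed
  then have "card ((\<lambda>x. x ` J) ` (\<Pi>\<^sub>E j\<in>J. {v \<in> N. \<phi> v = j})) = card (\<Pi>\<^sub>E j\<in>J. {v \<in> N. \<phi> v = j})"
    by (rule card_image)
  then show ?thesis using assms by (simp add: card_PiE)
qed

lemma transversal_props:
  assumes "x \<in> (\<Pi>\<^sub>E j\<in>J. {v \<in> N. \<phi> v = j})"
  shows "x ` J \<subseteq> N" "inj_on \<phi> (x ` J)" "card (x ` J) = card J" "\<phi> ` x ` J = J"
proof -
  have x: "x j \<in> N" "\<phi> (x j) = j" if "j \<in> J" for j using PiE_mem[OF assms that] by auto
  then show "x ` J \<subseteq> N" "inj_on \<phi> (x ` J)" by (auto simp: inj_on_def)
  have "inj_on x J" using x by (auto simp: inj_on_def) metis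
  then show "card (x ` J) = card J" by (rule card_image)
  show "\<phi> ` x ` J = J" using x by (force simp: image_iff)
qed

lemma card_transversal_sets_ge:
  assumes k: "k \<ge> 2" and u: "u \<in> {1..n}" and Y: "Y \<subseteq> [{1..n}]\<^bsup>2\<^esup>" "real (card Y) \<le> \<zeta> * (real n)\<^sup>2"
    and N: "N \<subseteq> {1..n} - {u}" and big: "\<And>j. j < k \<Longrightarrow> \<epsilon> * real n \<le> real (card {v \<in> N. \<phi> v = j})"
    and eps: "0 \<le> \<epsilon>" "\<zeta> \<le> \<epsilon> ^ k / 2"
  shows "\<epsilon> ^ k / 2 * real n ^ k \<le> real (card (transversal_sets ([{1..n}]\<^bsup>Suc k\<^esup>) u \<phi> N Y))"
proof -
  let ?A = "[{1..n}]\<^bsup>Suc k\<^esup>"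
  have finN: "finite N" using N finite_subset by blast
  have fin: "finite ?A" "finite ([{1..n}]\<^bsup>2\<^esup>)" by (simp_all add: finite_imp_finite_nsets)
  have finY: "finite Y" using Y(1) fin finite_subset by blast
  define T where "T = (\<lambda>x. x ` {..<k}) ` (\<Pi>\<^sub>E j\<in>{..<k}. {v \<in> N. \<phi> v = j})"
  have T: "g \<subseteq> N" "inj_on \<phi> g" "card g = k" if "g \<in> T" for g
    using that transversal_props[of _ "{..<k}" N \<phi>] by (auto simp: T_def)
  have finT: "finite T" unfolding T_def using finN by (intro finite_imageI finite_PiE) auto
  define H where "H = (\<Union>y\<in>{y \<in> Y. u \<notin> y}. {f \<in> ?A. insert u y \<subseteq> f})"
  have finH: "finite H" using fin finY by (auto simp: H_def)
  have "insert u ` T \<subseteq> transversal_sets ?A u \<phi> N Y \<union> H"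
  proof
    fix f assume "f \<in> insert u ` T"
    then obtain g where g: "g \<in> T" "f = insert u g" by blast
    have ug: "u \<notin> g" using T(1)[OF g(1)] N by auto
    have "finite g" using T(1)[OF g(1)] finN finite_subset by blast
    then have fA: "f \<in> ?A" using T[OF g(1)] ug g(2) N u by (auto simp: nsets_def)
    have fu: "f - {u} = g" using ug g(2) by auto
    show "f \<in> transversal_sets ?A u \<phi> N Y \<union> H"
    proof (cases "\<exists>y\<in>Y. y \<subseteq> g")
      case True
      then obtain y where "y \<in> Y" "y \<subseteq> g" by blast
      then have "f \<in> H" using fA ug g(2) unfolding H_def by blast
      then show ?thesis ..
    next
      case False
      then have "f \<in> transversal_sets ?A u \<phi> N Y"
        using fA fu T[OF g(1)] g(2) by (auto simp: transversal_sets_def)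
      then show ?thesis ..
    qed
  qed
  then have "card (insert u ` T) \<le> card (transversal_sets ?A u \<phi> N Y \<union> H)"
    using fin finH by (intro card_mono) (auto simp: transversal_sets_def)
  also have "\<dots> \<le> card (transversal_sets ?A u \<phi> N Y) + card H" by (rule card_Un_le)
  also have "card (insert u ` T) = card T"
  proof (rule card_image, rule inj_onI)
    fix g g' assume "g \<in> T" "g' \<in> T" "insert u g = insert u g'"
    moreover have "u \<notin> g" "u \<notin> g'" using T(1)[of g] T(1)[of g'] N calculation by auto
    ultimately show "g = g'" by (metis Diff_insert_absorb)
  qed
  finally have 1: "real (card T) \<le> real (card (transversal_sets ?A u \<phi> N Y)) + real (card H)" by linarith
  have "card T = (\<Prod>j<k. card {v \<in> N. \<phi> v = j})" unfolding T_def using finN by (intro card_transversals) auto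
  then have "real (card T) = (\<Prod>j<k. real (card {v \<in> N. \<phi> v = j}))" by simp
  also have "\<dots> \<ge> (\<Prod>j<k. \<epsilon> * real n)" using big eps by (intro prod_mono) auto
  finally have 2: "\<epsilon> ^ k * real n ^ k \<le> real (card T)" by (simp add: power_mult_distrib)
  have "card H \<le> (\<Sum>y\<in>{y \<in> Y. u \<notin> y}. card {f \<in> ?A. insert u y \<subseteq> f})"
    unfolding H_def using finY by (intro card_UN_le) auto
  also have "\<dots> \<le> (\<Sum>y\<in>{y \<in> Y. u \<notin> y}. n ^ (k - 2))"
  proof (intro sum_mono)
    fix y assume y: "y \<in> {y \<in> Y. u \<notin> y}"
    then have "y \<in> [{1..n}]\<^bsup>2\<^esup>" using Y(1) by blast
    then have "finite y" "card y = 2" by (auto simp: nsets_def)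
    then have "card (insert u y) = 3" "finite (insert u y)" using y by auto
    then show "card {f \<in> ?A. insert u y \<subseteq> f} \<le> n ^ (k - 2)"
      using card_supersets_le[of "{1..n}" "insert u y" "Suc k"] k by simp
  qed
  also have "\<dots> \<le> card Y * n ^ (k - 2)" using finY by (auto intro!: card_mono)
  finally have "real (card H) \<le> real (card Y) * real n ^ (k - 2)" by (metis of_nat_le_iff of_nat_mult of_nat_power)
  also have "\<dots> \<le> \<zeta> * (real n)\<^sup>2 * real n ^ (k - 2)" using Y(2) by (intro mult_right_mono) auto
  also have "\<dots> = \<zeta> * real n ^ k"
    using k by (metis le_add_diff_inverse mult.assoc power_add)
  also have "\<dots> \<le> \<epsilon> ^ k / 2 * real n ^ k" using eps by (intro mult_right_mono) auto
  finally show ?thesis using 1 2 by (simp add: algebra_simps)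
qed

lemma prob_no_transversal_le:
  assumes k: "k \<ge> 2" and n: "n > 0" and p: "0 \<le> p" "p \<le> 1" and c: "0 \<le> c" "c \<le> p * real n ^ (k - 2)"
    and eps: "0 \<le> \<epsilon>" "\<zeta> \<le> \<epsilon> ^ k / 2" and s: "0 \<le> s"
  shows "bprob p ([{1..n}]\<^bsup>Suc k\<^esup>) (\<lambda>S. \<exists>(u, \<phi>, N, Y)\<in>{1..n} \<times> ({1..n} \<rightarrow>\<^sub>E {..<k}) \<times> Pow {1..n} \<times>
        {Y \<in> Pow ([{1..n}]\<^bsup>2\<^esup>). real (card Y) \<le> \<zeta> * (real n)\<^sup>2}.
      N \<subseteq> {1..n} - {u} \<and> (\<forall>j<k. \<epsilon> * real n \<le> real (card {v \<in> N. \<phi> v = j})) \<and>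
      S \<inter> transversal_sets ([{1..n}]\<^bsup>Suc k\<^esup>) u \<phi> N Y = {})
    \<le> real n * (2 * real k) ^ n * exp ((s * \<zeta> + exp (-s) - c * \<epsilon> ^ k / 2) * (real n)\<^sup>2)"
proof -
  let ?A = "[{1..n}]\<^bsup>Suc k\<^esup>" and ?Y = "{Y \<in> Pow ([{1..n}]\<^bsup>2\<^esup>). real (card Y) \<le> \<zeta> * (real n)\<^sup>2}"
  let ?I = "{1..n} \<times> ({1..n} \<rightarrow>\<^sub>E {..<k}) \<times> Pow {1..n} \<times> ?Y"
  let ?b = "exp (- (c * \<epsilon> ^ k / 2 * (real n)\<^sup>2))"
  have fin: "finite ?A" "finite ([{1..n}]\<^bsup>2\<^esup>)" by (simp_all add: finite_imp_finite_nsets)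
  have "bprob p ?A (\<lambda>S. \<exists>i\<in>?I. (case i of (u, \<phi>, N, Y) \<Rightarrow>
      N \<subseteq> {1..n} - {u} \<and> (\<forall>j<k. \<epsilon> * real n \<le> real (card {v \<in> N. \<phi> v = j})) \<and>
      S \<inter> transversal_sets ?A u \<phi> N Y = {})) \<le> real (card ?I) * ?b"
  proof (intro bprob_Bex_le_const p)
    show "finite ?I" using fin by (intro finite_cartesian_product finite_PiE) auto
    fix i assume "i \<in> ?I"
    then obtain u \<phi> N Y where i: "i = (u, \<phi>, N, Y)" "u \<in> {1..n}" "Y \<subseteq> [{1..n}]\<^bsup>2\<^esup>" "real (card Y) \<le> \<zeta> * (real n)\<^sup>2" by auto
    let ?T = "transversal_sets ?A u \<phi> N Y"
    show "bprob p ?A (\<lambda>S. case i of (u, \<phi>, N, Y) \<Rightarrow>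
      N \<subseteq> {1..n} - {u} \<and> (\<forall>j<k. \<epsilon> * real n \<le> real (card {v \<in> N. \<phi> v = j})) \<and>
      S \<inter> transversal_sets ?A u \<phi> N Y = {}) \<le> ?b"
    proof (cases "N \<subseteq> {1..n} - {u} \<and> (\<forall>j<k. \<epsilon> * real n \<le> real (card {v \<in> N. \<phi> v = j}))")
      case True
      then have ge: "\<epsilon> ^ k / 2 * real n ^ k \<le> real (card ?T)"
        using i k eps by (intro card_transversal_sets_ge[where \<zeta> = \<zeta>]) auto
      have e: "k = (k - 2) + 2" using k by simp
      have "c * \<epsilon> ^ k / 2 * (real n)\<^sup>2 = c * (\<epsilon> ^ k / 2 * (real n)\<^sup>2)" by simp
      also have "\<dots> \<le> (p * real n ^ (k - 2)) * (\<epsilon> ^ k / 2 * (real n)\<^sup>2)"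
        using eps c by (intro mult_right_mono) auto
      also have "\<dots> = p * (\<epsilon> ^ k / 2 * (real n ^ (k - 2) * (real n)\<^sup>2))" by (simp only: mult_ac)
      also have "real n ^ (k - 2) * (real n)\<^sup>2 = real n ^ k" by (metis e power_add)
      also have "p * (\<epsilon> ^ k / 2 * real n ^ k) \<le> p * real (card ?T)" using ge p by (intro mult_left_mono) auto
      finally have "exp (- (p * real (card ?T))) \<le> ?b" by simp
      moreover have "bprob p ?A (\<lambda>S. S \<inter> ?T = {}) \<le> exp (- (p * real (card ?T)))"
        using fin p by (intro bprob_disjoint_le) (auto simp: transversal_sets_def)
      ultimately have "bprob p ?A (\<lambda>S. S \<inter> ?T = {}) \<le> ?b" by (rule order_trans[rotated])
      then show ?thesis using True i(1) by simp
    next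
      case False
      then have "(case i of (u, \<phi>, N, Y) \<Rightarrow>
      N \<subseteq> {1..n} - {u} \<and> (\<forall>j<k. \<epsilon> * real n \<le> real (card {v \<in> N. \<phi> v = j})) \<and>
      S \<inter> transversal_sets ?A u \<phi> N Y = {}) = False" for S using i(1) by auto
      then show ?thesis using bexp_const[OF fin(1), of p 0] by simp
    qed
  qed
  also have "real (card ?I) * ?b \<le> real n * real k ^ n * 2 ^ n * exp (s * (\<zeta> * (real n)\<^sup>2) + (real n)\<^sup>2 * exp (-s)) * ?b"
  proof (intro mult_right_mono)
    have "real (card ?Y) \<le> exp (s * (\<zeta> * (real n)\<^sup>2) + real (card ([{1..n}]\<^bsup>2\<^esup>)) * exp (-s))"
      by (rule card_small_subsets_le) (use fin s in auto)
    also have "\<dots> \<le> exp (s * (\<zeta> * (real n)\<^sup>2) + (real n)\<^sup>2 * exp (-s))"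
    proof -
      have "real (card ([{1..n}]\<^bsup>2\<^esup>)) \<le> (real n)\<^sup>2"
        using card_pairs_le[of n] unfolding of_nat_power[symmetric] by (simp only: of_nat_le_iff)
      then show ?thesis by simp
    qed
    finally have "real n * real k ^ n * 2 ^ n * real (card ?Y)
      \<le> real n * real k ^ n * 2 ^ n * exp (s * (\<zeta> * (real n)\<^sup>2) + (real n)\<^sup>2 * exp (-s))"
      by (intro mult_left_mono) auto
    moreover have "real (card ?I) = real n * real k ^ n * 2 ^ n * real (card ?Y)"
      by (simp add: card_cartesian_product card_PiE card_Pow)
    ultimately show "real (card ?I) \<le> real n * real k ^ n * 2 ^ n * exp (s * (\<zeta> * (real n)\<^sup>2) + (real n)\<^sup>2 * exp (-s))"
      by (simp only:)
  qed simp
  finally have *: "bprob p ?A (\<lambda>S. \<exists>i\<in>?I. (case i of (u, \<phi>, N, Y) \<Rightarrow>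
      N \<subseteq> {1..n} - {u} \<and> (\<forall>j<k. \<epsilon> * real n \<le> real (card {v \<in> N. \<phi> v = j})) \<and>
      S \<inter> transversal_sets ?A u \<phi> N Y = {}))
    \<le> real n * real k ^ n * 2 ^ n * exp (s * (\<zeta> * (real n)\<^sup>2) + (real n)\<^sup>2 * exp (-s)) * ?b" .
  have "real n * real k ^ n * 2 ^ n * exp (s * (\<zeta> * (real n)\<^sup>2) + (real n)\<^sup>2 * exp (-s)) * ?b
    = real n * (2 * real k) ^ n * (exp (s * (\<zeta> * (real n)\<^sup>2) + (real n)\<^sup>2 * exp (-s)) * ?b)"
    by (simp add: power_mult_distrib)
  also have "exp (s * (\<zeta> * (real n)\<^sup>2) + (real n)\<^sup>2 * exp (-s)) * ?b
    = exp ((s * \<zeta> + exp (-s) - c * \<epsilon> ^ k / 2) * (real n)\<^sup>2)"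
    unfolding exp_add[symmetric] by (rule arg_cong[of _ _ exp]) (simp add: algebra_simps)
  finally show ?thesis using * by (simp only:)
qed

lemma expected_hitting_sets_le:
  assumes k: "k \<ge> 2" and n: "n > 0" and p: "0 \<le> p" "p * real n ^ (k - 2) \<le> C"
    and X: "X \<subseteq> [{1..n}]\<^bsup>2\<^esup>" and Y: "Y \<subseteq> [{1..n}]\<^bsup>2\<^esup>" and XY: "X \<inter> Y = {}" "card Y \<le> card X"
    and small: "real (card Y) \<le> \<zeta> * (real n)\<^sup>2"
    and deg: "\<And>u. u \<in> {1..n} \<Longrightarrow> real (card (nbrs X {1..n} u)) \<le> \<epsilon> * real n"
  shows "p * real (card (hitting_sets ([{1..n}]\<^bsup>Suc k\<^esup>) X Y)) \<le> C * (\<zeta> + 2 * \<epsilon>) * real n * real (card X)"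
proof -
  let ?A = "[{1..n}]\<^bsup>Suc k\<^esup>"
  have fin: "finite ?A" "finite ([{1..n}]\<^bsup>2\<^esup>)" by (simp_all add: finite_imp_finite_nsets)
  have finX: "finite X" and finY: "finite Y" using X Y fin finite_subset by blast+
  have C: "0 \<le> C" using p by (intro order_trans[OF _ p(2)]) auto
  have eps: "0 \<le> \<epsilon>"
  proof -
    have "1 \<in> {1..n}" using n by simp
    then have "0 \<le> \<epsilon> * real n" using deg[of 1] by linarith
    then show ?thesis using n by (simp add: zero_le_mult_iff)
  qed
  have pair: "p * real (card {f \<in> ?A. a \<union> b \<subseteq> f}) \<le> C / real n + C * of_bool (a \<inter> b \<noteq> {})"
    if a: "a \<in> X" and b: "b \<in> Y" for a b
  proof -
    have "a \<in> [{1..n}]\<^bsup>2\<^esup>" "b \<in> [{1..n}]\<^bsup>2\<^esup>" using a b X Y by blast+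
    then have ab: "finite a" "finite b" "card a = 2" "card b = 2" by (auto simp: nsets_def)
    have ne: "a \<noteq> b" using a b XY by auto
    have un: "card (a \<union> b) + card (a \<inter> b) = 4" using card_Un_Int[of a b] ab by simp
    show ?thesis
    proof (cases "a \<inter> b = {}")
      case True
      then have "card (a \<union> b) = 4" using un by simp
      then show ?thesis using expected_supersets_le(3)[OF k n p, of "a \<union> b"] ab True by simp
    next
      case False
      then have "card (a \<inter> b) > 0" using ab by (simp add: card_gt_0_iff)
      moreover have "card (a \<inter> b) < card a"
      proof (intro psubset_card_mono ab psubsetI)
        show "a \<inter> b \<noteq> a"
        proof
          assume "a \<inter> b = a"
          then have "a \<subseteq> b" by blast
          then show False using ne ab card_subset_eq[of b a] by simp
        qed
      qed auto
      ultimately have "card (a \<union> b) = 3" using un ab by simp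
      then have "p * real (card {f \<in> ?A. a \<union> b \<subseteq> f}) \<le> C"
        using expected_supersets_le(2)[OF k n p, of "a \<union> b"] ab by simp
      moreover have "0 \<le> C / real n" using C by simp
      ultimately show ?thesis using False by simp
    qed
  qed
  have inc: "(\<Sum>a\<in>X. of_bool (a \<inter> b \<noteq> {})) \<le> 2 * \<epsilon> * real n" if b: "b \<in> Y" for b
  proof -
    have "b \<in> [{1..n}]\<^bsup>2\<^esup>" using b Y by blast
    then obtain w z where wz: "w \<in> {1..n}" "z \<in> {1..n}" "b = {w, z}"
      by (auto simp: nsets_def card_2_iff)
    have "(\<Sum>a\<in>X. of_bool (a \<inter> b \<noteq> {})) \<le> (\<Sum>a\<in>X. of_bool (w \<in> a) + (of_bool (z \<in> a) :: real))"
      using wz(3) by (intro sum_mono) auto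
    also have "\<dots> = real (card {a \<in> X. w \<in> a}) + real (card {a \<in> X. z \<in> a})"
      using finX by (simp add: sum.distrib Int_def)
    also have "\<dots> \<le> 2 * \<epsilon> * real n"
      using deg[OF wz(1)] deg[OF wz(2)] card_incident_edges[OF X, of w] card_incident_edges[OF X, of z] by simp
    finally show ?thesis .
  qed
  have "p * real (card (hitting_sets ?A X Y)) \<le> p * (\<Sum>b\<in>Y. \<Sum>a\<in>X. real (card {f \<in> ?A. a \<union> b \<subseteq> f}))"
  proof (intro mult_left_mono p)
    have "hitting_sets ?A X Y = (\<Union>b\<in>Y. \<Union>a\<in>X. {f \<in> ?A. a \<union> b \<subseteq> f})"
      by (auto simp: hitting_sets_def)
    then have "card (hitting_sets ?A X Y) \<le> (\<Sum>b\<in>Y. card (\<Union>a\<in>X. {f \<in> ?A. a \<union> b \<subseteq> f}))"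
      using card_UN_le[OF finY] by simp
    also have "\<dots> \<le> (\<Sum>b\<in>Y. \<Sum>a\<in>X. card {f \<in> ?A. a \<union> b \<subseteq> f})"
      by (intro sum_mono card_UN_le finX)
    finally show "real (card (hitting_sets ?A X Y)) \<le> (\<Sum>b\<in>Y. \<Sum>a\<in>X. real (card {f \<in> ?A. a \<union> b \<subseteq> f}))"
      unfolding of_nat_sum[symmetric] by (rule of_nat_mono)
  qed
  also have "\<dots> \<le> (\<Sum>b\<in>Y. \<Sum>a\<in>X. C / real n + C * of_bool (a \<inter> b \<noteq> {}))"
    unfolding sum_distrib_left by (intro sum_mono pair)
  also have "\<dots> = (\<Sum>b\<in>Y. real (card X) * (C / real n) + C * (\<Sum>a\<in>X. of_bool (a \<inter> b \<noteq> {})))"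
    by (simp only: sum.distrib sum_distrib_left sum_constant)
  also have "\<dots> \<le> (\<Sum>b\<in>Y. real (card X) * (C / real n) + C * (2 * \<epsilon> * real n))"
    using C inc by (intro sum_mono add_left_mono mult_left_mono) auto
  also have "\<dots> = real (card Y) * (real (card X) * (C / real n)) + C * (2 * \<epsilon> * real n) * real (card Y)"
    by (simp add: algebra_simps)
  also have "\<dots> \<le> (\<zeta> * (real n)\<^sup>2) * (real (card X) * (C / real n)) + C * (2 * \<epsilon> * real n) * real (card X)"
    using small XY C eps by (intro add_mono mult_right_mono mult_left_mono) auto
  also have "\<dots> = C * (\<zeta> + 2 * \<epsilon>) * real n * real (card X)"
    using n by (simp add: power2_eq_square field_simps)
  finally show ?thesis .
qed

lemma prob_many_hitting_le:
  assumes k: "k \<ge> 2" and n: "n > 0" and p: "0 \<le> p" "p \<le> 1" "p * real n ^ (k - 2) \<le> C"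
    and eps: "4 * C * (\<zeta> + 2 * \<epsilon>) \<le> \<delta>"
  shows "bprob p ([{1..n}]\<^bsup>Suc k\<^esup>) (\<lambda>S. \<exists>(X, Y)\<in>{(X, Y) \<in> Pow ([{1..n}]\<^bsup>2\<^esup>) \<times> Pow ([{1..n}]\<^bsup>2\<^esup>). X \<inter> Y = {} \<and> X \<noteq> {} \<and>
        card Y \<le> card X \<and> real (card Y) \<le> \<zeta> * (real n)\<^sup>2 \<and> (\<forall>u\<in>{1..n}. real (card (nbrs X {1..n} u)) \<le> \<epsilon> * real n)}.
      \<delta> * real n * real (card X) \<le> real (card (S \<inter> hitting_sets ([{1..n}]\<^bsup>Suc k\<^esup>) X Y)))
    \<le> exp 1 * (exp ((real n)\<^sup>2 * (((real n)\<^sup>2 + 1) * exp (- (\<delta> / 2 * real n)))) - 1)"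
proof -
  let ?A = "[{1..n}]\<^bsup>Suc k\<^esup>" and ?P = "[{1..n}]\<^bsup>2\<^esup>"
  let ?I = "{(X, Y) \<in> Pow ?P \<times> Pow ?P. X \<inter> Y = {} \<and> X \<noteq> {} \<and>
        card Y \<le> card X \<and> real (card Y) \<le> \<zeta> * (real n)\<^sup>2 \<and> (\<forall>u\<in>{1..n}. real (card (nbrs X {1..n} u)) \<le> \<epsilon> * real n)}"
  let ?J = "SIGMA X:Pow ?P - {{}}. {Y \<in> Pow ?P. real (card Y) \<le> real (card X)}"
  define w where "w = exp (- (\<delta> / 2 * real n))"
  define v where "v = (real n)\<^sup>2 + 1"
  have v: "v \<ge> 1" by (simp add: v_def)
  have fin: "finite ?A" "finite ?P" by (simp_all add: finite_imp_finite_nsets)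
  have finI: "finite ?I" by (rule finite_subset[of _ "Pow ?P \<times> Pow ?P"]) (use fin in auto)
  have cP: "real (card ?P) \<le> (real n)\<^sup>2"
    using card_pairs_le[of n] unfolding of_nat_power[symmetric] by (simp only: of_nat_le_iff)
  let ?Q = "\<lambda>i S. case i of (X, Y) \<Rightarrow> \<delta> * real n * real (card X) \<le> real (card (S \<inter> hitting_sets ?A X Y))"
  have "bprob p ?A (\<lambda>S. \<exists>i\<in>?I. ?Q i S) \<le> (\<Sum>i\<in>?I. bprob p ?A (?Q i))"
    by (intro bprob_Bex_le p finI)
  also have "\<dots> \<le> (\<Sum>i\<in>?I. w ^ card (fst i))"
  proof (intro sum_mono)
    fix i assume i: "i \<in> ?I"
    obtain X Y where XY: "i = (X, Y)" by fastforce
    have "p * real (card (hitting_sets ?A X Y)) \<le> C * (\<zeta> + 2 * \<epsilon>) * real n * real (card X)"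
      using i XY by (intro expected_hitting_sets_le k n p) auto
    also have "\<dots> \<le> \<delta> / 4 * real n * real (card X)"
      using eps by (intro mult_right_mono) auto
    finally have "2 * (p * real (card (hitting_sets ?A X Y))) - \<delta> * real n * real (card X) \<le> real (card X) * - (\<delta> / 2 * real n)"
      by (simp add: algebra_simps)
    then have "exp (2 * (p * real (card (hitting_sets ?A X Y))) - \<delta> * real n * real (card X)) \<le> w ^ card X"
      unfolding w_def exp_of_nat_mult[symmetric] by simp
    moreover have "bprob p ?A (\<lambda>S. \<delta> * real n * real (card X) \<le> real (card (S \<inter> hitting_sets ?A X Y)))
       \<le> exp (2 * (p * real (card (hitting_sets ?A X Y))) - \<delta> * real n * real (card X))"
      using fin p by (intro bprob_card_ge) (auto simp: hitting_sets_def)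
    ultimately show "bprob p ?A (?Q i) \<le> w ^ card (fst i)" using XY by simp
  qed
  also have "\<dots> \<le> (\<Sum>i\<in>?J. w ^ card (fst i))"
  proof (intro sum_mono2)
    show "finite ?J" using fin by (intro finite_SigmaI) auto
    show "?I \<subseteq> ?J" by auto
  qed (simp add: w_def)
  also have "\<dots> = (\<Sum>X\<in>Pow ?P - {{}}. \<Sum>Y\<in>{Y \<in> Pow ?P. real (card Y) \<le> real (card X)}. w ^ card X)"
    using fin by (subst sum.Sigma) (auto simp: split_def)
  also have "\<dots> = (\<Sum>X\<in>Pow ?P - {{}}. real (card {Y \<in> Pow ?P. real (card Y) \<le> real (card X)}) * w ^ card X)"
    by simp
  also have "\<dots> \<le> (\<Sum>X\<in>Pow ?P - {{}}. exp 1 * v ^ card X * w ^ card X)"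
  proof (intro sum_mono mult_right_mono)
    fix X
    have "real (card {Y \<in> Pow ?P. real (card Y) \<le> real (card X)}) \<le> exp (ln v * real (card X) + real (card ?P) * exp (- ln v))"
      using fin v by (intro card_small_subsets_le) auto
    also have "\<dots> \<le> exp (real (card X) * ln v + 1)"
    proof -
      have "real (card ?P) * exp (- ln v) \<le> 1"
      proof -
        have "exp (- ln v) = 1 / v" using v by (simp add: exp_minus inverse_eq_divide)
        moreover have "real (card ?P) \<le> v" using cP unfolding v_def by linarith
        ultimately show ?thesis using v by (simp only: times_divide_eq_right mult_1_right) simp
      qed
      then show ?thesis by (simp add: mult.commute)
    qed
    also have "\<dots> = exp 1 * v ^ card X" using v by (simp add: exp_add exp_of_nat_mult)
    finally show "real (card {Y \<in> Pow ?P. real (card Y) \<le> real (card X)}) \<le> exp 1 * v ^ card X" .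
  qed (simp add: w_def)
  also have "\<dots> = exp 1 * ((\<Sum>X\<in>Pow ?P. (v * w) ^ card X) - 1)"
    using fin by (subst sum_diff1) (auto simp: sum_distrib_left[symmetric] power_mult_distrib mult.assoc algebra_simps)
  also have "(\<Sum>X\<in>Pow ?P. (v * w) ^ card X) = (1 + v * w) ^ card ?P" using fin by (intro sum_power_card_Pow)
  also have "exp 1 * ((1 + v * w) ^ card ?P - 1) \<le> exp 1 * (exp ((real n)\<^sup>2 * (v * w)) - 1)"
  proof (intro mult_left_mono diff_right_mono)
    have vw: "0 \<le> v * w" using v by (simp add: w_def)
    have "(1 + v * w) ^ card ?P \<le> exp (real (card ?P) * (v * w))"
      by (rule one_plus_power_le_exp) (use vw in linarith)
    also have "\<dots> \<le> exp ((real n)\<^sup>2 * (v * w))" using cP vw by (simp add: mult_right_mono)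
    finally show "(1 + v * w) ^ card ?P \<le> exp ((real n)\<^sup>2 * (v * w))" .
  qed simp
  finally show ?thesis unfolding v_def w_def by simp
qed

definition rich :: "nat \<Rightarrow> nat \<Rightarrow> real \<Rightarrow> real \<Rightarrow> nat set set \<Rightarrow> nat set \<Rightarrow> bool" where
  "rich k n \<epsilon> \<delta> S e \<longleftrightarrow> (\<forall>\<phi>. near_balanced k n \<epsilon> \<phi> \<and> mono_col \<phi> e \<longrightarrow>
     \<delta> * real n \<le> real (card (S \<inter> rainbow_sets ([{1..n}]\<^bsup>Suc k\<^esup>) \<phi> e)))"

lemma prob_rich_not_turannical:
  fixes k :: nat and \<delta> \<epsilon>\<^sub>b c C \<eta>\<^sub>0 :: real
  assumes k: "k \<ge> 2" and pos: "\<delta> > 0" "\<epsilon>\<^sub>b > 0" "c > 0" "C > 0" "\<eta>\<^sub>0 > 0"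
  shows "\<forall>\<^sub>F n in sequentially. \<forall>p. 0 \<le> p \<and> p \<le> 1 \<and> c \<le> p * real n ^ (k - 2) \<and> p * real n ^ (k - 2) \<le> C \<longrightarrow>
    bprob p ([{1..n}]\<^bsup>Suc k\<^esup>) (\<lambda>S. (\<forall>e\<in>[{1..n}]\<^bsup>2\<^esup>. rich k n \<epsilon>\<^sub>b \<delta> S e) \<and> \<not> turannical (Suc k) n S) \<le> \<eta>\<^sub>0"
proof -
  define \<epsilon> where "\<epsilon> = \<delta> / (16 * C)"
  define a where "a = c * \<epsilon> ^ k / 2"
  define s where "s = ln (1 + 4 / a)"
  define \<zeta> where "\<zeta> = min (min (\<delta> / (8 * C)) (\<epsilon> ^ k / 2)) (a / (4 * s))"
  define \<epsilon>\<^sub>s where "\<epsilon>\<^sub>s = min (2 * \<zeta>) (\<epsilon>\<^sub>b\<^sup>2 / 2)"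
  have eps: "\<epsilon> > 0" using pos by (simp add: \<epsilon>_def)
  have a: "a > 0" using pos eps by (simp add: a_def)
  have s: "s > 0" unfolding s_def using a by (intro ln_gt_zero) simp
  have zeta: "\<zeta> > 0" using pos eps a s by (simp add: \<zeta>_def)
  have epss: "\<epsilon>\<^sub>s > 0" using zeta pos by (simp add: \<epsilon>\<^sub>s_def)
  have z1: "4 * C * (\<zeta> + 2 * \<epsilon>) \<le> \<delta>"
  proof -
    have "\<zeta> \<le> \<delta> / (8 * C)" by (simp add: \<zeta>_def)
    then have "4 * C * (\<zeta> + 2 * \<epsilon>) \<le> 4 * C * (\<delta> / (8 * C) + 2 * \<epsilon>)" using pos by (intro mult_left_mono) auto
    also have "\<dots> = \<delta>" using pos by (simp add: \<epsilon>_def field_simps)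
    finally show ?thesis .
  qed
  have z2: "s * \<zeta> + exp (- s) - a \<le> - a / 2"
  proof -
    have "\<zeta> \<le> a / (4 * s)" by (simp add: \<zeta>_def)
    then have "s * \<zeta> \<le> a / 4" using s by (simp add: field_simps)
    moreover have "exp (- s) \<le> a / 4"
      using a by (simp add: s_def exp_minus field_simps add_pos_pos)
    ultimately show ?thesis by simp
  qed
  obtain \<eta> where eta: "\<eta> > 0" and stab: "\<And>(G :: nat set set) U (m::real). finite U \<and> (\<forall>x. {x} \<notin> G) \<and> real (card U) \<le> m \<and>
    real (card (cliques (Suc k) U G)) < \<eta> * m ^ Suc k \<Longrightarrow>
    (\<exists>\<phi>. (\<forall>v\<in>U. \<phi> v < k) \<and>
      dsum U U (\<lambda>y z. {y, z} \<in> G) + dsum U U (\<lambda>y z. {y, z} \<in> G \<and> \<phi> y = \<phi> z)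
      \<le> dsum U U (\<lambda>y z. \<phi> y \<noteq> \<phi> z) + \<epsilon>\<^sub>s * m\<^sup>2)"
    using few_cliques_imp_almost_partite[of k \<epsilon>\<^sub>s, where ?'a = nat] k epss by auto
  define b1 where "b1 n = exp 1 * (exp ((real n)\<^sup>2 * (((real n)\<^sup>2 + 1) * exp (- (\<delta> / 2 * real n)))) - 1)" for n
  define b2 where "b2 n = exp ((real n)\<^sup>2 - c * \<eta> * real n ^ 3)" for n
  define b3 where "b3 n = real n * (2 * real k) ^ n * exp ((- a / 2) * (real n)\<^sup>2)" for n
  have "b1 \<longlonglongrightarrow> 0" unfolding b1_def using pos by real_asymp
  moreover have "b2 \<longlonglongrightarrow> 0" unfolding b2_def using pos eta by real_asymp
  moreover have "b3 \<longlonglongrightarrow> 0"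
  proof -
    have K: "2 * real k > 0" using k by simp
    show ?thesis unfolding b3_def using K a by real_asymp
  qed
  ultimately have ev: "\<forall>\<^sub>F n in sequentially. b1 n < \<eta>\<^sub>0 / 3" "\<forall>\<^sub>F n in sequentially. b2 n < \<eta>\<^sub>0 / 3"
      "\<forall>\<^sub>F n in sequentially. b3 n < \<eta>\<^sub>0 / 3"
    using pos by (auto intro!: order_tendstoD(2)[of _ 0])
  have evk: "\<forall>\<^sub>F n in sequentially. real k \<le> \<epsilon>\<^sub>s * (real n)\<^sup>2"
    using epss by real_asymp
  show ?thesis
    using ev evk eventually_gt_at_top[of 0]
  proof eventually_elim
    case (elim n)
    note n = \<open>n > 0\<close>
    show ?case
    proof (intro allI impI, elim conjE)
      fix p :: real
      assume p: "0 \<le> p" "p \<le> 1" "c \<le> p * real n ^ (k - 2)" "p * real n ^ (k - 2) \<le> C"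
      let ?A = "[{1..n}]\<^bsup>Suc k\<^esup>" and ?P = "[{1..n}]\<^bsup>2\<^esup>"
      define B1 where "B1 S \<longleftrightarrow> (\<exists>(X, Y)\<in>{(X, Y) \<in> Pow ?P \<times> Pow ?P. X \<inter> Y = {} \<and> X \<noteq> {} \<and>
        card Y \<le> card X \<and> real (card Y) \<le> \<zeta> * (real n)\<^sup>2 \<and> (\<forall>u\<in>{1..n}. real (card (nbrs X {1..n} u)) \<le> \<epsilon> * real n)}.
        \<delta> * real n * real (card X) \<le> real (card (S \<inter> hitting_sets ?A X Y)))" for S
      define B2 where "B2 S \<longleftrightarrow> (\<exists>G\<in>Pow ?P. \<eta> * real n ^ Suc k \<le> real (card (cliques (Suc k) {1..n} G)) \<and>
        S \<inter> cliques (Suc k) {1..n} G = {})" for S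
      define B3 where "B3 S \<longleftrightarrow> (\<exists>(u, \<phi>, N, Y)\<in>{1..n} \<times> ({1..n} \<rightarrow>\<^sub>E {..<k}) \<times> Pow {1..n} \<times>
        {Y \<in> Pow ?P. real (card Y) \<le> \<zeta> * (real n)\<^sup>2}.
        N \<subseteq> {1..n} - {u} \<and> (\<forall>j<k. \<epsilon> * real n \<le> real (card {v \<in> N. \<phi> v = j})) \<and>
        S \<inter> transversal_sets ?A u \<phi> N Y = {})" for S
      have p1: "bprob p ?A B1 \<le> b1 n"
        unfolding B1_def b1_def by (intro prob_many_hitting_le[where C = C] k n p z1)
      have p2: "bprob p ?A B2 \<le> b2 n"
        unfolding B2_def b2_def using eta by (intro prob_undetected_many_cliques_le k n p) auto
      have p3: "bprob p ?A B3 \<le> b3 n"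
      proof -
        have "bprob p ?A B3 \<le> real n * (2 * real k) ^ n * exp ((s * \<zeta> + exp (-s) - c * \<epsilon> ^ k / 2) * (real n)\<^sup>2)"
          unfolding B3_def using eps pos s by (intro prob_no_transversal_le k n p) (auto simp: \<zeta>_def)
        also have "\<dots> \<le> b3 n"
          unfolding b3_def using z2 by (intro mult_left_mono iffD2[OF exp_le_cancel_iff] mult_right_mono) (auto simp: a_def)
        finally show ?thesis .
      qed
      have "bprob p ?A (\<lambda>S. (\<forall>e\<in>?P. rich k n \<epsilon>\<^sub>b \<delta> S e) \<and> \<not> turannical (Suc k) n S)
        \<le> bprob p ?A (\<lambda>S. B1 S \<or> (B2 S \<or> B3 S))"
      proof (intro bprob_mono p)
        fix S assume S: "S \<subseteq> ?A" and R: "(\<forall>e\<in>?P. rich k n \<epsilon>\<^sub>b \<delta> S e) \<and> \<not> turannical (Suc k) n S"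
        show "B1 S \<or> (B2 S \<or> B3 S)"
        proof (rule ccontr)
          assume "\<not> ?thesis"
          then have nB: "\<not> B1 S" "\<not> B2 S" "\<not> B3 S" by auto
          have "turannical (Suc k) n S"
          proof (rule turannicalI[where \<delta> = \<delta> and \<epsilon>\<^sub>b = \<epsilon>\<^sub>b and \<zeta> = \<zeta> and \<epsilon>' = \<epsilon> and \<eta> = \<eta> and \<epsilon>\<^sub>s = \<epsilon>\<^sub>s])
            show "\<delta> * real n \<le> real (card (S \<inter> rainbow_sets ?A \<phi> e))"
              if "e \<in> ?P" "near_balanced k n \<epsilon>\<^sub>b \<phi>" "mono_col \<phi> e" for e \<phi>
              using R that by (auto simp: rich_def)
            show "real (card (S \<inter> hitting_sets ?A X Y)) < \<delta> * real n * real (card X)"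
              if "X \<subseteq> ?P" "Y \<subseteq> ?P" "X \<inter> Y = {}" "X \<noteq> {}" "card Y \<le> card X" "real (card Y) \<le> \<zeta> * (real n)\<^sup>2"
                "\<And>u. u \<in> {1..n} \<Longrightarrow> real (card (nbrs X {1..n} u)) \<le> \<epsilon> * real n" for X Y
            proof (rule ccontr)
              assume "\<not> ?thesis"
              then have "B1 S" unfolding B1_def using that by (intro bexI[of _ "(X, Y)"]) auto
              then show False using nB by simp
            qed
            show "S \<inter> cliques (Suc k) {1..n} G \<noteq> {}"
              if "G \<subseteq> ?P" "\<eta> * real n ^ Suc k \<le> real (card (cliques (Suc k) {1..n} G))" for G
              using that nB(2) by (auto simp: B2_def)
            show "S \<inter> transversal_sets ?A u \<phi> N Y \<noteq> {}"
              if A: "u \<in> {1..n}" "Y \<subseteq> ?P" "real (card Y) \<le> \<zeta> * (real n)\<^sup>2" "N \<subseteq> {1..n} - {u}"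
                "\<And>v. v \<in> {1..n} \<Longrightarrow> \<phi> v < k" "\<And>j. j < k \<Longrightarrow> \<epsilon> * real n \<le> real (card {v \<in> N. \<phi> v = j})" for u \<phi> N Y
            proof
              assume *: "S \<inter> transversal_sets ?A u \<phi> N Y = {}"
              define \<psi> where "\<psi> = restrict \<phi> {1..n}"
              have \<psi>: "\<psi> v = \<phi> v" if "v \<in> N" for v using that A(4) by (auto simp: \<psi>_def)
              have "{v \<in> N. \<psi> v = j} = {v \<in> N. \<phi> v = j}" for j using \<psi> by auto
              moreover have "transversal_sets ?A u \<psi> N Y = transversal_sets ?A u \<phi> N Y"
                unfolding transversal_sets_def using \<psi> by (intro Collect_cong conj_cong refl inj_on_cong) auto
              moreover have "\<psi> \<in> {1..n} \<rightarrow>\<^sub>E {..<k}" using A(5) by (auto simp: \<psi>_def)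
              ultimately have "B3 S" unfolding B3_def using A * by (intro bexI[of _ "(u, \<psi>, N, Y)"]) auto
              then show False using nB by simp
            qed
            show "\<exists>\<phi>. (\<forall>v\<in>{1..n}. \<phi> v < k) \<and>
              dsum {1..n} {1..n} (\<lambda>y z. {y, z} \<in> G) + dsum {1..n} {1..n} (\<lambda>y z. {y, z} \<in> G \<and> \<phi> y = \<phi> z)
              \<le> dsum {1..n} {1..n} (\<lambda>y z. \<phi> y \<noteq> \<phi> z) + \<epsilon>\<^sub>s * (real n)\<^sup>2"
              if "\<And>x. {x} \<notin> G" "real (card (cliques (Suc k) {1..n} G)) < \<eta> * real n ^ Suc k" for G
              using that by (intro stab) auto
            show "\<epsilon>\<^sub>s \<le> 2 * \<zeta>" "2 * \<epsilon>\<^sub>s \<le> \<epsilon>\<^sub>b\<^sup>2" by (auto simp: \<epsilon>\<^sub>s_def)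
          qed (use S k n pos elim in auto)
          then show False using R by simp
        qed
      qed
      also have "\<dots> \<le> bprob p ?A B1 + (bprob p ?A B2 + bprob p ?A B3)"
        using bprob_disj_le[OF p(1,2), of ?A B1 "\<lambda>S. B2 S \<or> B3 S"] bprob_disj_le[OF p(1,2), of ?A B2 B3] by linarith
      also have "\<dots> \<le> \<eta>\<^sub>0" using p1 p2 p3 elim by linarith
      finally show "bprob p ?A (\<lambda>S. (\<forall>e\<in>?P. rich k n \<epsilon>\<^sub>b \<delta> S e) \<and> \<not> turannical (Suc k) n S) \<le> \<eta>\<^sub>0" .
    qed
  qed
qed

section \<open>Splittable pairs\<close>

definition splittable :: "nat \<Rightarrow> nat \<Rightarrow> nat set set \<Rightarrow> nat set \<Rightarrow> bool" where
  "splittable k n S e \<longleftrightarrow> (\<exists>\<phi>. (\<forall>v\<in>{1..n}. \<phi> v < k) \<and>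
     (\<forall>j<k. card {v \<in> {1..n}. \<phi> v = j} = residue_class_size k n j) \<and>
     mono_col \<phi> e \<and> (\<forall>f\<in>S. e \<subseteq> f \<longrightarrow> \<not> rainbow \<phi> e f))"

lemma splittable_antimono: "splittable k n T e \<Longrightarrow> (\<And>f. f \<in> S \<Longrightarrow> e \<subseteq> f \<Longrightarrow> f \<in> T) \<Longrightarrow> splittable k n S e"
  unfolding splittable_def by blast

lemma splittable_imp_not_turannical:
  assumes k: "k > 0" and S: "S \<subseteq> [{1..n}]\<^bsup>Suc k\<^esup>" and e: "e \<in> [{1..n}]\<^bsup>2\<^esup>" and spl: "splittable k n S e"
  shows "\<not> turannical (Suc k) n S"
proof
  assume T: "turannical (Suc k) n S"
  obtain \<phi> where \<phi>: "\<And>v. v \<in> {1..n} \<Longrightarrow> \<phi> v < k"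
    and sz: "\<And>j. j < k \<Longrightarrow> card {v \<in> {1..n}. \<phi> v = j} = residue_class_size k n j"
    and mono: "mono_col \<phi> e" and nr: "\<And>f. f \<in> S \<Longrightarrow> e \<subseteq> f \<Longrightarrow> \<not> rainbow \<phi> e f"
    using spl unfolding splittable_def by blast
  let ?M = "multipartite {1..n} \<phi>"
  define G where "G = insert e ?M"
  have "2 * real (card ?M) = 2 * real (turan_number (Suc k) n)"
    using card_multipartite[of "{1..n}" \<phi> k] \<phi> sz turan_number_eq[OF k, of n] by simp
  then have cM: "card ?M = turan_number (Suc k) n" by simp
  have finM: "finite ?M"
    by (rule finite_subset[OF multipartite_subset]) (simp add: finite_imp_finite_nsets)
  have "e \<notin> ?M" using mono by (auto simp: mono_col_def multipartite_def)
  then have "card G > turan_number (Suc k) n" using finM cM by (simp add: G_def)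
  moreover have "G \<subseteq> [{1..n}]\<^bsup>2\<^esup>" using multipartite_subset[of "{1..n}" \<phi>] e by (auto simp: G_def)
  ultimately have "detects (Suc k) S G" using T by (auto simp: turannical_def)
  then obtain f where f: "f \<in> S" "card f = Suc k" "clique f G" by (auto simp: detects_def)
  have fV: "f \<subseteq> {1..n}" using f(1) S by (auto simp: nsets_def)
  have ne: "\<phi> x \<noteq> \<phi> y" if "x \<in> f" "y \<in> f" "x \<noteq> y" "{x, y} \<noteq> e" for x y
    using f(3) that by (auto simp: clique_def G_def doubleton_in_multipartite)
  show False
  proof (cases "e \<subseteq> f")
    case True
    then show False using nr[OF f(1)] ne by (auto simp: rainbow_def)
  next
    case False
    then have "inj_on \<phi> f" using ne unfolding inj_on_def by blast
    moreover have "\<phi> ` f \<subseteq> {..<k}" using \<phi> fV by auto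
    ultimately have "card f \<le> card {..<k}" by (intro card_inj_on_le) auto
    then show False using f(2) by simp
  qed
qed

lemma ex_distribution:
  fixes d :: "'b \<Rightarrow> nat"
  assumes "finite J" "finite I" "i0 \<notin> J" "(\<Sum>j\<in>J. d j) \<le> card I"
  shows "\<exists>\<theta>. (\<forall>v. \<theta> v \<in> insert i0 J) \<and> (\<forall>j\<in>J. card {v \<in> I. \<theta> v = j} = d j)"
  using assms
proof (induction J arbitrary: I rule: finite_induct)
  case empty
  then show ?case by (intro exI[of _ "\<lambda>_. i0"]) auto
next
  case (insert j J)
  then have "d j \<le> card I" by simp
  then obtain I' where I': "I' \<subseteq> I" "card I' = d j" "finite I'" by (rule obtain_subset_with_card_n)
  have "(\<Sum>j\<in>J. d j) \<le> card (I - I')" using I' insert by (simp add: card_Diff_subset)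
  then obtain \<theta> where \<theta>: "\<forall>v. \<theta> v \<in> insert i0 J" "\<forall>j\<in>J. card {v \<in> I - I'. \<theta> v = j} = d j"
    using insert.IH[of "I - I'"] insert.prems by auto
  define \<theta>' where "\<theta>' v = (if v \<in> I' then j else \<theta> v)" for v
  have nj: "\<theta> v \<noteq> j" for v using \<theta>(1)[rule_format, of v] insert.hyps insert.prems by auto
  have "{v \<in> I. \<theta>' v = j} = I'" using I' nj by (auto simp: \<theta>'_def)
  moreover have "{v \<in> I. \<theta>' v = i} = {v \<in> I - I'. \<theta> v = i}" if "i \<in> J" for i
    using that insert by (auto simp: \<theta>'_def)
  ultimately have "\<forall>i\<in>insert j J. card {v \<in> I. \<theta>' v = i} = d i" using \<theta>(2) I' by auto
  moreover have "\<forall>v. \<theta>' v \<in> insert i0 (insert j J)" using \<theta>(1) by (auto simp: \<theta>'_def)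
  ultimately show ?case by blast
qed

lemma recolour:
  fixes V :: "'a set" and \<phi> :: "'a \<Rightarrow> nat"
  assumes V: "finite V" and i0: "i0 < k" and \<phi>: "\<And>v. v \<in> V \<Longrightarrow> \<phi> v < k" and I: "I \<subseteq> V" "\<And>v. v \<in> I \<Longrightarrow> \<phi> v = i0"
    and s: "(\<Sum>j<k. s j) = card V"
    and need: "(\<Sum>j\<in>{..<k} - {i0}. s j - card ({v \<in> V. \<phi> v = j} - M)) \<le> card I"
  shows "\<exists>\<psi>. (\<forall>v\<in>V. \<psi> v < k) \<and> (\<forall>j<k. card {v \<in> V. \<psi> v = j} = s j) \<and>
    (\<forall>v\<in>V - I. \<phi> v = i0 \<longrightarrow> \<psi> v = i0) \<and> (\<forall>v\<in>V - I. \<psi> v \<noteq> i0 \<longrightarrow> \<psi> v = \<phi> v \<and> v \<notin> M)"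
proof -
  let ?K = "\<lambda>j. {v \<in> V. \<phi> v = j} - M" and ?J = "{..<k} - {i0}"
  define d where "d j = s j - card (?K j)" for j
  have finI: "finite I" using V I finite_subset by blast
  define B where "B j = (SOME B. B \<subseteq> ?K j \<and> card B = min (s j) (card (?K j)))" for j
  have B: "B j \<subseteq> ?K j" "card (B j) = min (s j) (card (?K j))" for j
  proof -
    obtain B' where "B' \<subseteq> ?K j" "card B' = min (s j) (card (?K j))"
      by (rule obtain_subset_with_card_n[OF min.cobounded2])
    then have "\<exists>B. B \<subseteq> ?K j \<and> card B = min (s j) (card (?K j))" by blast
    from someI_ex[OF this] show "B j \<subseteq> ?K j" "card (B j) = min (s j) (card (?K j))"
      unfolding B_def by blast+
  qed
  have finB: "finite (B j)" for j by (rule finite_subset[OF B(1)]) (use V in simp)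
  obtain \<theta> where \<theta>: "\<And>v. \<theta> v \<in> insert i0 ?J" "\<And>j. j \<in> ?J \<Longrightarrow> card {v \<in> I. \<theta> v = j} = d j"
    using ex_distribution[of ?J I i0 d] finI need unfolding d_def by auto
  define \<psi> where "\<psi> v = (if v \<in> I then \<theta> v else if \<phi> v \<noteq> i0 \<and> v \<in> B (\<phi> v) then \<phi> v else i0)" for v
  have 1: "\<psi> v < k" if "v \<in> V" for v using that \<phi> i0 \<theta>(1)[of v] by (auto simp: \<psi>_def)
  have 2: "card {v \<in> V. \<psi> v = j} = s j" if "j \<in> ?J" for j
  proof -
    have "{v \<in> V. \<psi> v = j} = B j \<union> {v \<in> I. \<theta> v = j}"
      using that I B(1)[of j] by (auto simp: \<psi>_def)
    moreover have "B j \<inter> {v \<in> I. \<theta> v = j} = {}" using that I(2) B(1)[of j] by auto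
    ultimately have "card {v \<in> V. \<psi> v = j} = card (B j) + card {v \<in> I. \<theta> v = j}"
      using finB finI by (simp add: card_Un_disjoint)
    also have "\<dots> = s j" using \<theta>(2)[OF that] B(2)[of j] by (simp add: d_def)
    finally show ?thesis .
  qed
  have "card {v \<in> V. \<psi> v = i0} + (\<Sum>j\<in>?J. card {v \<in> V. \<psi> v = j}) = s i0 + (\<Sum>j\<in>?J. s j)"
    using sum_card_classes[OF V 1] s i0 sum.remove[of "{..<k}" i0 s]
      sum.remove[of "{..<k}" i0 "\<lambda>j. card {v \<in> V. \<psi> v = j}"] by simp
  moreover have "(\<Sum>j\<in>?J. card {v \<in> V. \<psi> v = j}) = (\<Sum>j\<in>?J. s j)" by (intro sum.cong refl 2)
  ultimately have 3: "card {v \<in> V. \<psi> v = i0} = s i0" by simp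
  show ?thesis
  proof (intro exI[of _ \<psi>] conjI ballI allI impI)
    show "card {v \<in> V. \<psi> v = j} = s j" if "j < k" for j using 2 3 that by (cases "j = i0") auto
    fix v assume v: "v \<in> V - I"
    show "\<psi> v = i0" if "\<phi> v = i0" using v that by (simp add: \<psi>_def)
    assume n: "\<psi> v \<noteq> i0"
    then show "\<psi> v = \<phi> v" using v by (auto simp: \<psi>_def split: if_splits)
    show "v \<notin> M" using n v B(1)[of "\<phi> v"] by (auto simp: \<psi>_def split: if_splits)
  qed (rule 1)
qed

lemma pair_extra_vertex:
  assumes "k \<ge> 2" "f \<in> [V]\<^bsup>Suc k\<^esup>" "e \<in> [V]\<^bsup>2\<^esup>"
  shows "\<exists>w. w \<in> f - e"
proof -
  have "card e < card f" "finite e" using assms by (auto simp: nsets_def)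
  then have "\<not> f \<subseteq> e" using card_mono[of e f] by auto
  then show ?thesis by blast
qed

lemma small_link_imp_splittable:
  assumes k: "k \<ge> 2" and S: "S \<subseteq> [{1..n}]\<^bsup>Suc k\<^esup>" and e: "e \<in> [{1..n}]\<^bsup>2\<^esup>"
    and small: "card {f \<in> S. e \<subseteq> f} + 2 \<le> residue_class_size k n 0"
  shows "splittable k n S e"
proof -
  let ?L = "{f \<in> S. e \<subseteq> f}"
  have "finite ([{1..n}]\<^bsup>Suc k\<^esup>)" by (simp add: finite_imp_finite_nsets)
  then have "finite S" using S finite_subset by blast
  then have finL: "finite ?L" by simp
  have "\<forall>f\<in>?L. \<exists>w. w \<in> f - e" using pair_extra_vertex[OF k _ e] S by blast
  then obtain w where w: "\<And>f. f \<in> ?L \<Longrightarrow> w f \<in> f - e" by metis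
  define W where "W = e \<union> w ` ?L"
  have WV: "W \<subseteq> {1..n}" using e S w by (force simp: W_def nsets_def)
  have e2: "card e = 2" "finite e" using e by (auto simp: nsets_def)
  have "card W \<le> card e + card (w ` ?L)" unfolding W_def by (rule card_Un_le)
  also have "\<dots> \<le> 2 + card ?L" using e2 card_image_le[OF finL, of w] by simp
  finally have cW: "card W \<le> residue_class_size k n 0" using small by simp
  let ?I = "{1..n} - W"
  have "(\<Sum>j\<in>{..<k} - {0}. residue_class_size k n j - card ({v \<in> {1..n}. (\<lambda>_. 0) v = j} - {}))
     = (\<Sum>j\<in>{..<k} - {0}. residue_class_size k n j)"
    by (intro sum.cong refl) auto
  also have "\<dots> = n - residue_class_size k n 0"
    using sum_residue_class_size[of k n] k by (simp add: sum.remove[of "{..<k}" 0])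
  also have "\<dots> \<le> card ?I" using cW WV by (simp add: card_Diff_subset finite_subset[OF WV])
  finally have need: "(\<Sum>j\<in>{..<k} - {0}. residue_class_size k n j - card ({v \<in> {1..n}. (\<lambda>_. 0) v = j} - {})) \<le> card ?I" .
  have k0: "0 < k" using k by simp
  have sum: "(\<Sum>j<k. residue_class_size k n j) = card {1..n}" using sum_residue_class_size[OF k0] by simp
  obtain \<psi> where \<psi>: "\<forall>v\<in>{1..n}. \<psi> v < k" "\<forall>j<k. card {v \<in> {1..n}. \<psi> v = j} = residue_class_size k n j"
    and "\<forall>v\<in>{1..n} - ?I. (0::nat) = 0 \<longrightarrow> \<psi> v = 0"
    using recolour[OF finite_atLeastAtMost k0 k0 Diff_subset refl sum need] by blast
  then have W0: "\<psi> v = 0" if "v \<in> W" for v using that WV by blast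
  show ?thesis
    unfolding splittable_def
  proof (intro exI[of _ \<psi>] conjI \<psi> ballI impI)
    show "mono_col \<psi> e" using W0 by (auto simp: mono_col_def W_def)
    fix f assume f: "f \<in> S" "e \<subseteq> f"
    then have wf: "w f \<in> f - e" "w f \<in> W" using w by (auto simp: W_def)
    obtain x where x: "x \<in> e" using e2 by fastforce
    then have "x \<noteq> w f" "{x, w f} \<noteq> e" "\<psi> x = \<psi> (w f)" "x \<in> f" using wf f W0[of x] W0[of "w f"] by (auto simp: W_def)
    then show "\<not> rainbow \<psi> e f" using wf unfolding rainbow_def by blast
  qed
qed

text \<open>
  One vertex of each remaining rainbow hyperedge is moved into the class of \<open>e\<close>, where it is harmless; vertices
  of that class which are isolated in the link of \<open>e\<close> can be moved out freely and restore exact balance.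
\<close>

lemma isolated_imp_splittable:
  assumes k: "k \<ge> 2" and S: "S \<subseteq> [{1..n}]\<^bsup>Suc k\<^esup>" and e: "e \<in> [{1..n}]\<^bsup>2\<^esup>" and T: "T \<subseteq> S"
    and bal: "near_balanced k n \<epsilon> \<phi>" "0 \<le> \<epsilon>" and mono: "mono_col \<phi> e" and u: "u \<in> e"
    and I: "I \<subseteq> {v \<in> {1..n}. \<phi> v = \<phi> u} - e" "\<And>v f. v \<in> I \<Longrightarrow> f \<in> T \<Longrightarrow> e \<subseteq> f \<Longrightarrow> v \<notin> f"
    and big: "real k * (\<epsilon> * real n + 1) + real (card (S \<inter> rainbow_sets ([{1..n}]\<^bsup>Suc k\<^esup>) \<phi> e)) \<le> real (card I)"
  shows "splittable k n T e"
proof -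
  let ?A = "[{1..n}]\<^bsup>Suc k\<^esup>" and ?i = "\<phi> u" and ?C = "\<lambda>j. {v \<in> {1..n}. \<phi> v = j}" and ?s = "residue_class_size k n"
  define R where "R = S \<inter> rainbow_sets ?A \<phi> e"
  have "finite ?A" by (simp add: finite_imp_finite_nsets)
  then have "finite S" using S finite_subset by blast
  then have finR: "finite R" by (simp add: R_def)
  have "\<forall>f\<in>R. \<exists>w. w \<in> f - e" using pair_extra_vertex[OF k _ e] S by (auto simp: R_def)
  then obtain w where w: "\<And>f. f \<in> R \<Longrightarrow> w f \<in> f - e" by metis
  define M where "M = w ` R"
  have MV: "M \<subseteq> {1..n}" using S w by (force simp: M_def R_def nsets_def)
  have finM: "finite M" using finR by (simp add: M_def)
  have cM: "card M \<le> card R" unfolding M_def by (rule card_image_le[OF finR])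
  have eV: "e \<subseteq> {1..n}" using e by (auto simp: nsets_def)
  have \<phi>: "\<phi> v < k" if "v \<in> {1..n}" for v using bal(1) that unfolding near_balanced_def by blast
  have ei: "\<phi> x = ?i" if "x \<in> e" for x using mono u that unfolding mono_col_def by blast
  have def1: "real (?s j - card (?C j - M)) \<le> (\<epsilon> * real n + 1) + real (card {v \<in> M. \<phi> v = j})" if j: "j < k" for j
  proof -
    have "card (?C j) - card {v \<in> M. \<phi> v = j} \<le> card (?C j - {v \<in> M. \<phi> v = j})"
      by (rule diff_card_le_card_Diff) (use finM in auto)
    moreover have "?C j - {v \<in> M. \<phi> v = j} = ?C j - M" by auto
    ultimately have "real (card (?C j)) \<le> real (card (?C j - M)) + real (card {v \<in> M. \<phi> v = j})" by simp
    moreover have "real n / real k - \<epsilon> * real n \<le> real (card (?C j))"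
      using bal j by (auto simp: near_balanced_def abs_le_iff)
    moreover have "real (?s j) \<le> real n / real k + 1" by (rule residue_class_size_bounds[OF j])
    moreover have "0 \<le> \<epsilon> * real n" using bal(2) by simp
    ultimately show ?thesis by linarith
  qed
  have "real (\<Sum>j\<in>{..<k} - {?i}. ?s j - card (?C j - M)) \<le> (\<Sum>j\<in>{..<k} - {?i}. (\<epsilon> * real n + 1) + real (card {v \<in> M. \<phi> v = j}))"
    unfolding of_nat_sum using def1 by (intro sum_mono) auto
  also have "\<dots> \<le> (\<Sum>j<k. (\<epsilon> * real n + 1) + real (card {v \<in> M. \<phi> v = j}))"
    using bal(2) by (intro sum_mono2) auto
  also have "\<dots> = real k * (\<epsilon> * real n + 1) + real (\<Sum>j<k. card {v \<in> M. \<phi> v = j})"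
    by (simp add: sum.distrib)
  also have "(\<Sum>j<k. card {v \<in> M. \<phi> v = j}) = card M"
    using MV \<phi> finM by (intro sum_card_classes) auto
  also have "real k * (\<epsilon> * real n + 1) + real (card M) \<le> real (card I)"
    using big cM unfolding R_def by linarith
  finally have need: "(\<Sum>j\<in>{..<k} - {?i}. ?s j - card (?C j - M)) \<le> card I" by (simp only: of_nat_le_iff)
  have ik: "?i < k" using \<phi> eV u by blast
  have sum: "(\<Sum>j<k. ?s j) = card {1..n}" using sum_residue_class_size[of k n] k by simp
  have IV: "I \<subseteq> {1..n}" and Ii: "\<And>v. v \<in> I \<Longrightarrow> \<phi> v = ?i" using I(1) by blast+
  obtain \<psi> where \<psi>: "\<forall>v\<in>{1..n}. \<psi> v < k" "\<forall>j<k. card {v \<in> {1..n}. \<psi> v = j} = ?s j"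
    and \<psi>i: "\<forall>v\<in>{1..n} - I. \<phi> v = ?i \<longrightarrow> \<psi> v = ?i"
    and \<psi>n: "\<forall>v\<in>{1..n} - I. \<psi> v \<noteq> ?i \<longrightarrow> \<psi> v = \<phi> v \<and> v \<notin> M"
    using recolour[OF finite_atLeastAtMost ik \<phi> IV Ii sum need] by blast
  have \<psi>e: "\<psi> x = ?i" if "x \<in> e" for x
    using that eV I(1) ei[OF that] \<psi>i by blast
  show ?thesis
    unfolding splittable_def
  proof (intro exI[of _ \<psi>] conjI \<psi> ballI impI)
    show "mono_col \<psi> e" using \<psi>e by (auto simp: mono_col_def)
    fix f assume f: "f \<in> T" "e \<subseteq> f"
    have fA: "f \<in> ?A" using f T S by blast
    then have fV: "f \<subseteq> {1..n}" by (auto simp: nsets_def)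
    show "\<not> rainbow \<psi> e f"
    proof
      assume r: "rainbow \<psi> e f"
      have out: "\<psi> v = \<phi> v \<and> v \<notin> M" if v: "v \<in> f - e" for v
      proof -
        have "v \<notin> I" using I(2)[of v f] v f by blast
        moreover have "v \<in> {1..n}" using v fV by blast
        moreover have "{v, u} \<noteq> e" "v \<noteq> u" "v \<in> f" "u \<in> f" using v u f by blast+
        then have "\<psi> v \<noteq> \<psi> u" using r unfolding rainbow_def by blast
        then have "\<psi> v \<noteq> ?i" using \<psi>e[OF u] by simp
        ultimately show ?thesis using \<psi>n by blast
      qed
      have same: "\<psi> v = \<phi> v" if "v \<in> f" for v
        using out[of v] that \<psi>e[of v] ei[of v] by (cases "v \<in> e") auto
      have "rainbow \<phi> e f" using r same by (auto simp: rainbow_def)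
      then have "f \<in> R" using f T fA by (auto simp: R_def rainbow_sets_def)
      then show False using w[of f] out[of "w f"] by (auto simp: M_def)
    qed
  qed
qed

lemma sum_degrees:
  assumes "finite L" "\<And>f. f \<in> L \<Longrightarrow> f \<subseteq> V \<and> card f = m" "finite V"
  shows "(\<Sum>v\<in>V. card {f \<in> L. v \<in> f}) = m * card L"
proof -
  have "(\<Sum>v\<in>V. card {f \<in> L. v \<in> f}) = (\<Sum>v\<in>V. \<Sum>f\<in>L. of_bool (v \<in> f))"
    using assms by (simp add: Int_def)
  also have "\<dots> = (\<Sum>f\<in>L. \<Sum>v\<in>V. of_bool (v \<in> f))" by (rule sum.swap)
  also have "\<dots> = (\<Sum>f\<in>L. m)"
  proof (intro sum.cong refl)
    fix f assume "f \<in> L"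
    then have "V \<inter> f = f" "card f = m" using assms(2) by auto
    then show "(\<Sum>v\<in>V. of_bool (v \<in> f)) = m" using assms(3) by (simp add: Int_def[symmetric])
  qed
  finally show ?thesis by simp
qed

lemma prob_thinned_splittable_ge:
  fixes D :: nat
  assumes k: "k \<ge> 2" and S: "S \<subseteq> [{1..n}]\<^bsup>Suc k\<^esup>" and e: "e \<in> [{1..n}]\<^bsup>2\<^esup>" and n: "n > 0"
    and bal: "near_balanced k n \<epsilon> \<phi>" "0 \<le> \<epsilon>" and mono: "mono_col \<phi> e"
    and link: "real (card {f \<in> S. e \<subseteq> f}) \<le> 4 * C * real n"
    and D: "16 * real k * real (Suc k) * C \<le> real D"
    and q: "0 \<le> q" "q \<le> 1 - g" and g: "0 < g" "g \<le> 1"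
    and large: "real n / (2 * real k) \<le> real n / real k - \<epsilon> * real n - 2"
    and big: "real k * (\<epsilon> * real n + 1) + real (card (S \<inter> rainbow_sets ([{1..n}]\<^bsup>Suc k\<^esup>) \<phi> e))
       \<le> g ^ D / (8 * real k) * real n"
  shows "bprob q S (\<lambda>T. splittable k n T e) \<ge> g ^ D / 2"
proof -
  let ?A = "[{1..n}]\<^bsup>Suc k\<^esup>"
  define \<theta> where "\<theta> = g ^ D"
  have \<theta>: "\<theta> > 0" using g by (simp add: \<theta>_def)
  have "finite ?A" by (simp add: finite_imp_finite_nsets)
  then have finS: "finite S" using S finite_subset by blast
  obtain u where u: "u \<in> e" using e by (auto simp: nsets_def card_2_iff)
  have eV: "e \<subseteq> {1..n}" and ce: "card e = 2" "finite e" using e by (auto simp: nsets_def)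
  define lk where "lk v = {f \<in> {f \<in> S. e \<subseteq> f}. v \<in> f}" for v
  define U where "U = {v \<in> {1..n}. \<phi> v = \<phi> u} - e"
  define L where "L = {v \<in> U. card (lk v) \<le> D}"
  have finU: "finite U" by (simp add: U_def)
  have finL: "finite L" using finU by (simp add: L_def)
  have cU: "real (card U) \<ge> real n / (2 * real k)"
  proof -
    have "\<phi> u < k" using bal u eV by (auto simp: near_balanced_def)
    then have "real n / real k - \<epsilon> * real n \<le> real (card {v \<in> {1..n}. \<phi> v = \<phi> u})"
      using bal by (auto simp: near_balanced_def abs_le_iff)
    moreover have "card {v \<in> {1..n}. \<phi> v = \<phi> u} - card e \<le> card U"
      unfolding U_def by (rule diff_card_le_card_Diff[OF ce(2)])
    ultimately show ?thesis using large ce(1) by linarith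
  qed
  have cH: "real (card (U - L)) \<le> real n / (4 * real k)"
  proof -
    have "real (card (U - L)) * (16 * real k * real (Suc k) * C) \<le> real (card (U - L)) * real D"
      using D by (intro mult_left_mono) auto
    also have "\<dots> = (\<Sum>v\<in>U - L. real D)" by simp
    also have "\<dots> \<le> (\<Sum>v\<in>U - L. real (card (lk v)))" by (intro sum_mono) (auto simp: L_def)
    also have "\<dots> \<le> (\<Sum>v\<in>{1..n}. real (card (lk v)))" by (intro sum_mono2) (auto simp: U_def)
    also have "\<dots> = real (Suc k) * real (card {f \<in> S. e \<subseteq> f})"
      unfolding lk_def of_nat_sum[symmetric] of_nat_mult[symmetric] using finS S
      by (intro arg_cong[of _ _ real] sum_degrees) (auto simp: nsets_def)
    also have "\<dots> \<le> real (Suc k) * (4 * C * real n)" using link by (intro mult_left_mono) auto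
    finally have *: "real (card (U - L)) * (16 * real k * real (Suc k) * C) \<le> real (Suc k) * (4 * C * real n)" .
    have "C \<ge> 0" 
    proof (rule ccontr)
      assume "\<not> C \<ge> 0"
      then have "4 * C * real n < 0" using mult_neg_pos[of "4 * C" "real n"] n by simp
      then show False using link by linarith
    qed
    show ?thesis
    proof (cases "C = 0")
      case True
      then have "card {f \<in> S. e \<subseteq> f} = 0" using link by simp
      then have "{f \<in> S. e \<subseteq> f} = {}" using finS by simp
      then have "lk v = {}" for v by (simp only: lk_def) simp
      then have "U - L = {}" by (auto simp: L_def)
      then show ?thesis by (simp only:) simp
    next
      case False
      then have "4 * real (Suc k) * C > 0" using \<open>C \<ge> 0\<close> by simp
      moreover have "(real (card (U - L)) * (4 * real k)) * (4 * real (Suc k) * C) \<le> real n * (4 * real (Suc k) * C)"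
        using * by (simp add: algebra_simps)
      ultimately have "real (card (U - L)) * (4 * real k) \<le> real n"
        by (rule mult_right_le_imp_le[rotated])
      then show ?thesis using k by (simp add: field_simps)
    qed
  qed
  have cL: "real (card L) \<ge> real n / (4 * real k)"
  proof -
    have "card U = card L + card (U - L)"
      using finU card_Int_Diff[of U L] by (simp add: L_def Int_def)
    moreover have "real n / (2 * real k) = real n / (4 * real k) + real n / (4 * real k)" by simp
    ultimately show ?thesis using cU cH by linarith
  qed
  have Lpos: "real (card L) > 0" using cL n k by (intro less_le_trans[OF _ cL]) auto
  define iso where "iso T = {v \<in> L. T \<inter> lk v = {}}" for T
  have "real (card L) * \<theta> \<le> (\<Sum>v\<in>L. (1 - q) ^ card (lk v))"
  proof -
    have "\<theta> \<le> (1 - q) ^ card (lk v)" if "v \<in> L" for v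
    proof -
      have "\<theta> \<le> g ^ card (lk v)" unfolding \<theta>_def using that g by (intro power_decreasing) (auto simp: L_def)
      also have "\<dots> \<le> (1 - q) ^ card (lk v)" using g q by (intro power_mono) auto
      finally show ?thesis .
    qed
    then have "(\<Sum>v\<in>L. \<theta>) \<le> (\<Sum>v\<in>L. (1 - q) ^ card (lk v))" by (intro sum_mono)
    then show ?thesis by simp
  qed
  also have "\<dots> = (\<Sum>v\<in>L. bprob q S (\<lambda>T. T \<inter> lk v = {}))"
    using finS by (intro sum.cong refl bprob_disjoint[symmetric]) (auto simp: lk_def)
  also have "\<dots> = bexp q S (\<lambda>T. real (card (iso T)))"
    unfolding bexp_sum[symmetric] using finL by (intro bexp_cong refl) (simp add: iso_def Int_def)
  also have "\<dots> \<le> bexp q S (\<lambda>T. real (card L) * of_bool (real (card (iso T)) \<ge> \<theta> / 2 * real (card L)) + \<theta> / 2 * real (card L))"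
  proof (intro bexp_mono)
    fix T
    have "card (iso T) \<le> card L" using finL by (intro card_mono) (auto simp: iso_def)
    moreover have "0 \<le> \<theta> / 2 * real (card L)" using \<theta> by simp
    ultimately show "real (card (iso T)) \<le> real (card L) * of_bool (real (card (iso T)) \<ge> \<theta> / 2 * real (card L)) + \<theta> / 2 * real (card L)"
      by auto
  qed (use q g in auto)
  also have "\<dots> = real (card L) * bprob q S (\<lambda>T. real (card (iso T)) \<ge> \<theta> / 2 * real (card L)) + \<theta> / 2 * real (card L)"
    using finS by (simp add: bexp_add bexp_cmult bexp_const)
  finally have "real (card L) * (\<theta> / 2) \<le> real (card L) * bprob q S (\<lambda>T. real (card (iso T)) \<ge> \<theta> / 2 * real (card L))"
    by (simp add: algebra_simps)
  then have "\<theta> / 2 \<le> bprob q S (\<lambda>T. real (card (iso T)) \<ge> \<theta> / 2 * real (card L))"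
    using Lpos by (simp add: mult_le_cancel_left_pos)
  also have "\<dots> \<le> bprob q S (\<lambda>T. splittable k n T e)"
  proof (intro bprob_mono)
    fix T assume T: "T \<subseteq> S" and i: "\<theta> / 2 * real (card L) \<le> real (card (iso T))"
    show "splittable k n T e"
    proof (rule isolated_imp_splittable[OF k S e T bal mono u])
      show "iso T \<subseteq> {v \<in> {1..n}. \<phi> v = \<phi> u} - e" by (auto simp: iso_def L_def U_def)
      show "v \<notin> f" if "v \<in> iso T" "f \<in> T" "e \<subseteq> f" for v f
        using that T by (auto simp: iso_def lk_def)
      have "g ^ D / (8 * real k) * real n = \<theta> / 2 * (real n / (4 * real k))" by (simp add: \<theta>_def)
      also have "\<dots> \<le> \<theta> / 2 * real (card L)" using cL \<theta> by (intro mult_left_mono) auto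
      finally show "real k * (\<epsilon> * real n + 1) + real (card (S \<inter> rainbow_sets ?A \<phi> e)) \<le> real (card (iso T))"
        using big i by linarith
    qed
  qed (use q g in auto)
  finally show ?thesis by (simp add: \<theta>_def)
qed

section \<open>Concentration, symmetry and near-independence\<close>

lemma min_intersection_concentration:
  fixes m :: real
  assumes A: "finite A" and B: "finite \<B>" "\<And>B. B \<in> \<B> \<Longrightarrow> B \<subseteq> L" and L: "L \<subseteq> A" and p: "0 \<le> p" "p \<le> 1"
    and C: "p * real (card L) \<le> C * m" and \<delta>: "0 < \<delta>" "\<delta> \<le> C" and m: "m > 0"
    and ge: "exp (- (\<delta>\<^sup>2 / C * m)) \<le> bprob p A (\<lambda>S. \<exists>B\<in>\<B>. real (card (S \<inter> B)) < \<delta> * m)"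
  shows "3 / 4 \<le> bprob p A (\<lambda>S. \<exists>B\<in>\<B>. real (card (S \<inter> B)) \<le> 12 * \<delta> * m)"
proof -
  have finL: "finite L" using L A finite_subset by blast
  have red: "bprob p A (\<lambda>S. \<exists>B\<in>\<B>. Q (card (S \<inter> B))) = bprob p L (\<lambda>S. \<exists>B\<in>\<B>. Q (card (S \<inter> B)))" for Q
  proof -
    have "S \<inter> L \<inter> B = S \<inter> B" if "B \<in> \<B>" for S B using B(2)[OF that] by blast
    then have "(\<exists>B\<in>\<B>. Q (card (S \<inter> L \<inter> B))) = (\<exists>B\<in>\<B>. Q (card (S \<inter> B)))" for S by auto
    with bexp_Int[OF A L, of p "\<lambda>S. of_bool (\<exists>B\<in>\<B>. Q (card (S \<inter> B)))"] show ?thesis by simp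
  qed
  have ne: "\<B> \<noteq> {}"
  proof
    assume "\<B> = {}"
    then have "exp (- (\<delta>\<^sup>2 / C * m)) \<le> 0" using ge bexp_const[OF A, of p 0] by simp
    then show False by (simp add: not_le[symmetric])
  qed
  define g where "g S = Min ((\<lambda>B. card (S \<inter> B)) ` \<B>)" for S
  have g_le: "g S \<le> card (S \<inter> B)" if "B \<in> \<B>" for S B
    unfolding g_def using that B(1) by (intro Min_le) auto
  have g_ex: "\<exists>B\<in>\<B>. g S = card (S \<inter> B)" for S
  proof -
    have "g S \<in> (\<lambda>B. card (S \<inter> B)) ` \<B>" unfolding g_def using ne B(1) by (intro Min_in) auto
    then show ?thesis by blast
  qed
  have lt_iff: "(\<exists>B\<in>\<B>. real (card (S \<inter> B)) < r) \<longleftrightarrow> real (g S) < r" for S r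
    using g_le[of _ S] g_ex[of S] by (metis le_less_trans of_nat_le_iff)
  have le_iff: "(\<exists>B\<in>\<B>. real (card (S \<inter> B)) \<le> r) \<longleftrightarrow> real (g S) \<le> r" for S r
    using g_le[of _ S] g_ex[of S] by (metis order_trans of_nat_le_iff)
  have lip: "real (g S) \<le> real (g (insert x S)) \<and> real (g (insert x S)) \<le> real (g S) + 1" if S: "S \<subseteq> L" for S x
  proof
    have finS: "finite S" using S finL finite_subset by blast
    obtain B1 where B1: "B1 \<in> \<B>" "g (insert x S) = card (insert x S \<inter> B1)" using g_ex by blast
    have "card (S \<inter> B1) \<le> card (insert x S \<inter> B1)" using finS by (intro card_mono) auto
    then show "real (g S) \<le> real (g (insert x S))" using g_le[OF B1(1), of S] B1(2) by simp
    obtain B2 where B2: "B2 \<in> \<B>" "g S = card (S \<inter> B2)" using g_ex by blast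
    have "card (insert x S \<inter> B2) \<le> card (insert x (S \<inter> B2))" using finS by (intro card_mono) auto
    also have "\<dots> \<le> card (S \<inter> B2) + 1" using finS by (simp add: card_insert_if)
    finally show "real (g (insert x S)) \<le> real (g S) + 1" using g_le[OF B2(1), of "insert x S"] B2(2) by simp
  qed
  define E where "E = bexp p L (\<lambda>S. real (g S))"
  define t where "t = \<delta> / C"
  have t: "0 < t" "t \<le> 1" using \<delta> by (auto simp: t_def)
  have "exp (- (\<delta>\<^sup>2 / C * m)) * exp (- t * (\<delta> * m)) \<le> bprob p L (\<lambda>S. real (g S) < \<delta> * m) * exp (- t * (\<delta> * m))"
    using ge unfolding red[of "\<lambda>c. real c < \<delta> * m"] unfolding lt_iff by (intro mult_right_mono) auto
  also have "\<dots> = bexp p L (\<lambda>S. exp (- t * (\<delta> * m)) * of_bool (real (g S) < \<delta> * m))"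
    by (simp add: bexp_cmult)
  also have "\<dots> \<le> bexp p L (\<lambda>S. exp (- t * real (g S)))"
    using t p by (intro bexp_mono) auto
  also have "\<dots> \<le> exp (- t * E + real (card L) * p * t\<^sup>2)"
    unfolding E_def using t lip by (intro bexp_laplace finL p) auto
  finally have "- (\<delta>\<^sup>2 / C * m) - t * (\<delta> * m) \<le> - t * E + real (card L) * p * t\<^sup>2"
    by (simp add: exp_add[symmetric])
  moreover have "real (card L) * p * t\<^sup>2 \<le> C * m * t\<^sup>2"
    using C by (intro mult_right_mono) (auto simp: mult.commute)
  ultimately have "t * E \<le> \<delta>\<^sup>2 / C * m + t * (\<delta> * m) + C * m * t\<^sup>2" by linarith
  also have "\<dots> = t * (3 * \<delta> * m)"
    using \<delta> by (simp add: t_def power2_eq_square field_simps)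
  finally have "E \<le> 3 * \<delta> * m" using t by (simp add: mult_le_cancel_left_pos)
  then have "E / (12 * \<delta> * m) \<le> 1 / 4" using \<delta> m by (simp add: field_simps)
  moreover have "bprob p L (\<lambda>S. real (g S) \<ge> 12 * \<delta> * m) \<le> E / (12 * \<delta> * m)"
    unfolding E_def using \<delta> m by (intro bprob_markov p) auto
  moreover have "bprob p L (\<lambda>S. \<not> real (g S) \<le> 12 * \<delta> * m) \<le> bprob p L (\<lambda>S. real (g S) \<ge> 12 * \<delta> * m)"
    by (intro bprob_mono p) auto
  ultimately have "bprob p L (\<lambda>S. \<not> real (g S) \<le> 12 * \<delta> * m) \<le> 1 / 4" by linarith
  then show ?thesis unfolding red[of "\<lambda>c. real c \<le> 12 * \<delta> * m"] unfolding le_iff using bprob_not[OF finL, of p "\<lambda>S. real (g S) \<le> 12 * \<delta> * m"] by linarith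
qed

lemma prob_splittable_ge:
  fixes D :: nat
  assumes k: "k \<ge> 2" and e: "e \<in> [{1..n}]\<^bsup>2\<^esup>" and n: "n > 0"
    and p: "0 \<le> p'" "p' \<le> 1" "p' * real n ^ (k - 2) \<le> C" "p = p' * q"
    and q: "0 \<le> q" "q \<le> 1 - g" and g: "0 < g" "g \<le> 1"
    and \<delta>: "0 < \<delta>" "\<delta> \<le> C" and \<epsilon>: "0 \<le> \<epsilon>"
    and D: "16 * real k * real (Suc k) * C \<le> real D"
    and large: "real n / (2 * real k) \<le> real n / real k - \<epsilon> * real n - 2"
    and big: "real k * (\<epsilon> * real n + 1) + 12 * \<delta> * real n \<le> g ^ D / (8 * real k) * real n"
    and ge: "exp (- (\<delta>\<^sup>2 / C * real n)) \<le> bprob p' ([{1..n}]\<^bsup>Suc k\<^esup>) (\<lambda>S. \<not> rich k n \<epsilon> \<delta> S e)"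
  shows "g ^ D / 4 \<le> bprob p ([{1..n}]\<^bsup>Suc k\<^esup>) (\<lambda>S. splittable k n S e)"
proof -
  let ?A = "[{1..n}]\<^bsup>Suc k\<^esup>"
  define L where "L = {f \<in> ?A. e \<subseteq> f}"
  define \<B> where "\<B> = {rainbow_sets ?A \<phi> e | \<phi>. near_balanced k n \<epsilon> \<phi> \<and> mono_col \<phi> e}"
  have finA: "finite ?A" by (simp add: finite_imp_finite_nsets)
  have BL: "B \<subseteq> L" if "B \<in> \<B>" for B using that by (auto simp: \<B>_def L_def rainbow_sets_def)
  have LA: "L \<subseteq> ?A" by (auto simp: L_def)
  have finL: "finite L" using LA finA finite_subset by blast
  have "\<B> \<subseteq> Pow L" using BL by blast
  then have finB: "finite \<B>" using finL finite_subset by blast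
  have pL: "p' * real (card L) \<le> C * real n"
    unfolding L_def using e by (intro expected_supersets_le(1)[OF k n p(1,3)]) (auto simp: nsets_def)
  have nr: "\<not> rich k n \<epsilon> \<delta> S e \<longleftrightarrow> (\<exists>B\<in>\<B>. real (card (S \<inter> B)) < \<delta> * real n)" for S
    unfolding rich_def \<B>_def by (auto simp: not_le)
  have c1: "3 / 4 \<le> bprob p' ?A (\<lambda>S. \<exists>B\<in>\<B>. real (card (S \<inter> B)) \<le> 12 * \<delta> * real n)"
    using n ge unfolding nr by (intro min_intersection_concentration[OF finA finB BL LA p(1,2) pL \<delta>]) auto
  have c2: "bprob p' ?A (\<lambda>S. real (card (S \<inter> L)) \<ge> 4 * C * real n) \<le> 1 / 4"
  proof -
    have pos: "4 * C * real n > 0" using \<delta> n by simp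
    have "bprob p' ?A (\<lambda>S. real (card (S \<inter> L)) \<ge> 4 * C * real n) \<le> bexp p' ?A (\<lambda>S. real (card (S \<inter> L))) / (4 * C * real n)"
      by (rule bprob_markov[OF p(1,2) pos]) simp
    also have "\<dots> = p' * real (card L) / (4 * C * real n)" using bexp_card[OF finA LA, of p'] by simp
    also have "\<dots> \<le> 1 / 4" using pL pos by (simp add: field_simps)
    finally show ?thesis .
  qed
  define good where "good S \<longleftrightarrow> (\<exists>B\<in>\<B>. real (card (S \<inter> B)) \<le> 12 * \<delta> * real n) \<and> real (card (S \<inter> L)) \<le> 4 * C * real n" for S
  have "bprob p' ?A (\<lambda>S. \<exists>B\<in>\<B>. real (card (S \<inter> B)) \<le> 12 * \<delta> * real n)
     \<le> bprob p' ?A (\<lambda>S. good S \<or> real (card (S \<inter> L)) \<ge> 4 * C * real n)"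
    by (intro bprob_mono p) (auto simp: good_def)
  also have "\<dots> \<le> bprob p' ?A good + bprob p' ?A (\<lambda>S. real (card (S \<inter> L)) \<ge> 4 * C * real n)"
    by (intro bprob_disj_le p)
  finally have half: "1 / 2 \<le> bprob p' ?A good" using c1 c2 by linarith
  have gD: "0 < g ^ D" using g by simp
  have "g ^ D / 4 \<le> g ^ D / 2 * bprob p' ?A good" using half gD by simp
  also have "\<dots> = bexp p' ?A (\<lambda>S. g ^ D / 2 * of_bool (good S))" by (rule bexp_cmult[symmetric])
  also have "\<dots> \<le> bexp p' ?A (\<lambda>S. bprob q S (\<lambda>T. splittable k n T e))"
  proof (intro bexp_mono p)
    fix S assume S: "S \<subseteq> ?A"
    show "g ^ D / 2 * of_bool (good S) \<le> bprob q S (\<lambda>T. splittable k n T e)"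
    proof (cases "good S")
      case True
      then obtain \<phi> where \<phi>: "near_balanced k n \<epsilon> \<phi>" "mono_col \<phi> e"
        and few: "real (card (S \<inter> rainbow_sets ?A \<phi> e)) \<le> 12 * \<delta> * real n"
        by (auto simp: good_def \<B>_def)
      have "S \<inter> L = {f \<in> S. e \<subseteq> f}" using S by (auto simp: L_def)
      then have "real (card {f \<in> S. e \<subseteq> f}) \<le> 4 * C * real n" using True by (simp add: good_def)
      moreover have "real k * (\<epsilon> * real n + 1) + real (card (S \<inter> rainbow_sets ?A \<phi> e)) \<le> g ^ D / (8 * real k) * real n"
        using big few by linarith
      ultimately show ?thesis
        using prob_thinned_splittable_ge[OF k S e n \<phi>(1) \<epsilon> \<phi>(2) _ D q g large] True by simp
    next
      case False
      then show ?thesis using q g by (auto intro: bexp_nonneg)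
    qed
  qed
  also have "\<dots> = bprob p ?A (\<lambda>S. splittable k n S e)"
    unfolding p(4) by (rule bexp_thin[OF finA, symmetric])
  finally show ?thesis .
qed

lemma ex_bij_mapping_pair:
  assumes "finite V" "e \<in> [V]\<^bsup>2\<^esup>" "e' \<in> [V]\<^bsup>2\<^esup>"
  shows "\<exists>\<pi>. bij_betw \<pi> V V \<and> \<pi> ` e = e'"
proof -
  have e: "finite e" "finite e'" "card e = card e'" "e \<subseteq> V" "e' \<subseteq> V" using assms by (auto simp: nsets_def)
  obtain f where f: "bij_betw f e e'" using finite_same_card_bij[OF e(1-3)] by blast
  have "card (V - e) = card (V - e')" using e assms(1) by (simp add: card_Diff_subset)
  then obtain h where h: "bij_betw h (V - e) (V - e')"
    using finite_same_card_bij[of "V - e" "V - e'"] assms(1) by blast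
  define \<pi> where "\<pi> v = (if v \<in> e then f v else h v)" for v
  have "bij_betw \<pi> e e'" using f by (rule bij_betw_cong[THEN iffD1, rotated]) (simp add: \<pi>_def)
  moreover have "bij_betw \<pi> (V - e) (V - e')" using h by (rule bij_betw_cong[THEN iffD1, rotated]) (simp add: \<pi>_def)
  ultimately have "bij_betw \<pi> (e \<union> (V - e)) (e' \<union> (V - e'))" by (rule bij_betw_combine) auto
  moreover have "e \<union> (V - e) = V" "e' \<union> (V - e') = V" using e by auto
  moreover have "\<pi> ` e = e'" using \<open>bij_betw \<pi> e e'\<close> by (simp add: bij_betw_def)
  ultimately show ?thesis by metis
qed

lemma prob_rich_symmetric:
  assumes e: "e \<in> [{1..n}]\<^bsup>2\<^esup>" "e' \<in> [{1..n}]\<^bsup>2\<^esup>" and p: "0 \<le> p" "p \<le> 1"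
  shows "bprob p ([{1..n}]\<^bsup>Suc k\<^esup>) (\<lambda>S. \<not> rich k n \<epsilon> \<delta> S e) \<le> bprob p ([{1..n}]\<^bsup>Suc k\<^esup>) (\<lambda>S. \<not> rich k n \<epsilon> \<delta> S e')"
proof -
  let ?A = "[{1..n}]\<^bsup>Suc k\<^esup>" and ?V = "{1..n}"
  have finA: "finite ?A" by (simp add: finite_imp_finite_nsets)
  obtain \<pi> where \<pi>: "bij_betw \<pi> ?V ?V" "\<pi> ` e = e'" using ex_bij_mapping_pair[OF _ e] by auto
  define \<sigma> where "\<sigma> = the_inv_into ?V \<pi>"
  have inj: "inj_on \<pi> ?V" and im: "\<pi> ` ?V = ?V" using \<pi> by (auto simp: bij_betw_def)
  have \<sigma>\<pi>: "\<sigma> (\<pi> v) = v" if "v \<in> ?V" for v unfolding \<sigma>_def using inj that by (rule the_inv_into_f_f)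
  have \<sigma>V: "bij_betw \<sigma> ?V ?V" unfolding \<sigma>_def by (rule bij_betw_the_inv_into[OF \<pi>(1)])
  have eV: "e \<subseteq> ?V" using e by (auto simp: nsets_def)
  have bA: "bij_betw (image \<pi>) ?A ?A" by (rule bij_betw_nsets[OF \<pi>(1)])
  have "\<not> rich k n \<epsilon> \<delta> (image \<pi> ` S) e'" if S: "S \<subseteq> ?A" and nr: "\<not> rich k n \<epsilon> \<delta> S e" for S
  proof -
    obtain \<phi> where \<phi>: "near_balanced k n \<epsilon> \<phi>" "mono_col \<phi> e"
      and few: "real (card (S \<inter> rainbow_sets ?A \<phi> e)) < \<delta> * real n"
      using nr unfolding rich_def not_all not_imp not_le by blast
    define \<psi> where "\<psi> = \<phi> \<circ> \<sigma>"
    have \<psi>\<pi>: "\<psi> (\<pi> v) = \<phi> v" if "v \<in> ?V" for v using \<sigma>\<pi>[OF that] by (simp add: \<psi>_def)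
    have cl: "card {v \<in> ?V. \<psi> v = j} = card {v \<in> ?V. \<phi> v = j}" for j
    proof -
      have "{v \<in> ?V. \<psi> v = j} = \<pi> ` {v \<in> ?V. \<phi> v = j}"
      proof (intro equalityI subsetI)
        fix v assume v: "v \<in> {v \<in> ?V. \<psi> v = j}"
        then have "v \<in> \<pi> ` ?V" unfolding im by simp
        then obtain w where w: "w \<in> ?V" "v = \<pi> w" by (elim imageE)
        then have "\<phi> w = j" using v \<psi>\<pi>[OF w(1)] by simp
        then show "v \<in> \<pi> ` {v \<in> ?V. \<phi> v = j}" unfolding w(2) using w(1) by (intro imageI) simp
      next
        fix v assume "v \<in> \<pi> ` {v \<in> ?V. \<phi> v = j}"
        then obtain w where w: "w \<in> {v \<in> ?V. \<phi> v = j}" "v = \<pi> w" by (elim imageE)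
        then have "\<pi> w \<in> \<pi> ` ?V" by (intro imageI) simp
        then have "\<pi> w \<in> ?V" unfolding im .
        then show "v \<in> {v \<in> ?V. \<psi> v = j}" using w \<psi>\<pi>[of w] by simp
      qed
      moreover have "inj_on \<pi> {v \<in> ?V. \<phi> v = j}" using inj by (rule inj_on_subset) auto
      ultimately show ?thesis by (simp only: card_image)
    qed
    have "\<psi> v < k" if v: "v \<in> ?V" for v
    proof -
      have "\<sigma> v \<in> ?V" using bij_betwE[OF \<sigma>V] v by blast
      then show ?thesis using \<phi>(1) unfolding near_balanced_def \<psi>_def o_def by blast
    qed
    then have 1: "near_balanced k n \<epsilon> \<psi>" using \<phi>(1) unfolding near_balanced_def cl by blast
    have 2: "mono_col \<psi> e'"
      unfolding mono_col_def \<pi>(2)[symmetric]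
    proof (intro ballI)
      fix x y assume "x \<in> \<pi> ` e" "y \<in> \<pi> ` e"
      then obtain a b where ab: "a \<in> e" "b \<in> e" "x = \<pi> a" "y = \<pi> b" by blast
      then have "\<phi> a = \<phi> b" using \<phi>(2) unfolding mono_col_def by blast
      moreover have "a \<in> ?V" "b \<in> ?V" using ab eV by blast+
      ultimately show "\<psi> x = \<psi> y" using ab \<psi>\<pi>[of a] \<psi>\<pi>[of b] by simp
    qed
    have "image \<pi> ` S \<inter> rainbow_sets ?A \<psi> e' \<subseteq> image \<pi> ` (S \<inter> rainbow_sets ?A \<phi> e)"
    proof
      fix f assume f: "f \<in> image \<pi> ` S \<inter> rainbow_sets ?A \<psi> e'"
      then obtain h where h: "h \<in> S" "f = \<pi> ` h" by blast
      have hA: "h \<in> ?A" using h S by blast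
      then have hV: "h \<subseteq> ?V" by (auto simp: nsets_def)
      have r: "\<pi> ` e \<subseteq> \<pi> ` h" "rainbow \<psi> e' (\<pi> ` h)" using f h \<pi>(2) by (auto simp: rainbow_sets_def)
      have "e \<subseteq> h" using r(1) inj_on_image_subset_iff[OF inj eV hV] by simp
      moreover have "rainbow \<phi> e h"
        unfolding rainbow_def
      proof (intro ballI impI)
        fix x y assume xy: "x \<in> h" "y \<in> h" "x \<noteq> y \<and> {x, y} \<noteq> e"
        have V: "x \<in> ?V" "y \<in> ?V" using xy hV by blast+
        have "\<pi> x \<noteq> \<pi> y" using xy(3) V inj by (meson inj_on_contraD)
        moreover have "{\<pi> x, \<pi> y} \<noteq> e'"
        proof
          assume "{\<pi> x, \<pi> y} = e'"
          then have "\<pi> ` {x, y} = \<pi> ` e" using \<pi>(2) by simp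
          then have "{x, y} = e" using V eV inj_on_image_eq_iff[OF inj, of "{x, y}" e] by simp
          then show False using xy(3) by simp
        qed
        ultimately have "\<psi> (\<pi> x) \<noteq> \<psi> (\<pi> y)" using r(2) xy(1,2) unfolding rainbow_def by blast
        then show "\<phi> x \<noteq> \<phi> y" using \<psi>\<pi>[OF V(1)] \<psi>\<pi>[OF V(2)] by simp
      qed
      ultimately have "h \<in> rainbow_sets ?A \<phi> e" using hA by (simp add: rainbow_sets_def)
      then show "f \<in> image \<pi> ` (S \<inter> rainbow_sets ?A \<phi> e)" using h by blast
    qed
    moreover have finR: "finite (S \<inter> rainbow_sets ?A \<phi> e)" using S finA finite_subset by blast
    ultimately have "card (image \<pi> ` S \<inter> rainbow_sets ?A \<psi> e') \<le> card (S \<inter> rainbow_sets ?A \<phi> e)"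
      by (intro order_trans[OF card_mono card_image_le]) auto
    then have "\<not> \<delta> * real n \<le> real (card (image \<pi> ` S \<inter> rainbow_sets ?A \<psi> e'))" using few by linarith
    then show ?thesis using 1 2 unfolding rich_def by blast
  qed
  then have "bprob p ?A (\<lambda>S. \<not> rich k n \<epsilon> \<delta> S e) \<le> bprob p ?A (\<lambda>S. \<not> rich k n \<epsilon> \<delta> (image \<pi> ` S) e')"
    by (intro bprob_mono p) blast
  also have "\<dots> = bprob p ?A (\<lambda>S. \<not> rich k n \<epsilon> \<delta> S e')"
    by (rule bexp_reindex[OF finA bA, symmetric])
  finally show ?thesis .
qed

text \<open>
  The pairs \<open>{2 i + 1, 2 i + 2}\<close> are disjoint, and with high probability no hyperedge contains two of them,
  so the events that they are splittable are almost independent.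
\<close>

lemma prob_turannical_le:
  assumes k: "k \<ge> 2" and n: "n > 0" "2 * K \<le> n" and p: "0 \<le> p" "p \<le> 1" "p * real n ^ (k - 2) \<le> C"
    and \<beta>: "\<And>e. e \<in> [{1..n}]\<^bsup>2\<^esup> \<Longrightarrow> \<beta> \<le> bprob p ([{1..n}]\<^bsup>Suc k\<^esup>) (\<lambda>S. splittable k n S e)"
  shows "bprob p ([{1..n}]\<^bsup>Suc k\<^esup>) (turannical (Suc k) n) \<le> (1 - \<beta>) ^ K + (real K)\<^sup>2 * (C / real n)"
proof -
  let ?A = "[{1..n}]\<^bsup>Suc k\<^esup>"
  have finA: "finite ?A" by (simp add: finite_imp_finite_nsets)
  define e where "e i = {2 * i + 1, 2 * i + 2}" for i :: nat
  have ep: "e i \<in> [{1..n}]\<^bsup>2\<^esup>" if "i < K" for i using that n(2) by (auto simp: e_def nsets_def)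
  have e4: "card (e i \<union> e j) = 4" "finite (e i \<union> e j)" if "i \<noteq> j" for i j
  proof -
    have "e i \<inter> e j = {}" using that by (auto simp: e_def)
    then have "card (e i \<union> e j) = card (e i) + card (e j)" by (intro card_Un_disjoint) (auto simp: e_def)
    then show "card (e i \<union> e j) = 4" by (simp add: e_def)
    show "finite (e i \<union> e j)" by (simp add: e_def)
  qed
  define H where "H i = {f \<in> ?A. e i \<subseteq> f \<and> (\<forall>j<K. j \<noteq> i \<longrightarrow> \<not> e j \<subseteq> f)}" for i
  have HA: "H i \<subseteq> ?A" for i by (auto simp: H_def)
  have disj: "disjoint_family_on H {..<K}"
    unfolding disjoint_family_on_def
  proof (intro ballI impI equals0I)
    fix i j f assume "i \<in> {..<K}" "j \<in> {..<K}" "i \<noteq> j" "f \<in> H i \<inter> H j"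
    then have "e i \<subseteq> f" "\<not> e i \<subseteq> f" unfolding H_def by blast+
    then show False by blast
  qed
  let ?I = "{(i, j). i < K \<and> j < K \<and> i \<noteq> j}"
  have finI: "finite ?I" by (rule finite_subset[of _ "{..<K} \<times> {..<K}"]) auto
  have cI: "card ?I \<le> K\<^sup>2"
    using card_mono[of "{..<K} \<times> {..<K}" ?I] by (auto simp: power2_eq_square card_cartesian_product)
  define B where "B S \<longleftrightarrow> (\<exists>x\<in>?I. S \<inter> {f \<in> ?A. e (fst x) \<union> e (snd x) \<subseteq> f} \<noteq> {})" for S
  have pB: "bprob p ?A B \<le> (real K)\<^sup>2 * (C / real n)"
  proof -
    have "bprob p ?A B \<le> real (card ?I) * (C / real n)"
      unfolding B_def
    proof (rule bprob_Bex_le_const[OF p(1,2) finI])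
      fix x assume x: "x \<in> ?I"
      let ?F = "{f \<in> ?A. e (fst x) \<union> e (snd x) \<subseteq> f}"
      have FA: "?F \<subseteq> ?A" by blast
      have finS: "finite S" if "S \<subseteq> ?A" for S using that finA finite_subset by blast
      have "bprob p ?A (\<lambda>S. S \<inter> ?F \<noteq> {}) \<le> bprob p ?A (\<lambda>S. real (card (S \<inter> ?F)) \<ge> 1)"
      proof (intro bprob_mono p)
        fix S assume "S \<subseteq> ?A" "S \<inter> ?F \<noteq> {}"
        then have "card (S \<inter> ?F) > 0" using finS[of S] by (simp add: card_gt_0_iff)
        then show "real (card (S \<inter> ?F)) \<ge> 1" by linarith
      qed
      also have "\<dots> \<le> bexp p ?A (\<lambda>S. real (card (S \<inter> ?F))) / 1" by (rule bprob_markov[OF p(1,2)]) simp_all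
      also have "\<dots> = p * real (card ?F)" using bexp_card[OF finA FA, of p] by simp
      also have "\<dots> \<le> C / real n"
      proof (rule expected_supersets_le(3)[OF k n(1) p(1,3)])
        have "fst x \<noteq> snd x" using x by (simp add: case_prod_beta)
        then show "finite (e (fst x) \<union> e (snd x))" "card (e (fst x) \<union> e (snd x)) = 4" using e4 by blast+
      qed
      finally show "bprob p ?A (\<lambda>S. S \<inter> ?F \<noteq> {}) \<le> C / real n" .
    qed
    also have "\<dots> \<le> (real K)\<^sup>2 * (C / real n)"
    proof (intro mult_right_mono)
      show "real (card ?I) \<le> (real K)\<^sup>2" unfolding of_nat_power[symmetric] of_nat_le_iff by (rule cI)
      have "0 \<le> C" using p by (intro order_trans[OF _ p(3)]) auto
      then show "0 \<le> C / real n" by simp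
    qed
    finally show ?thesis .
  qed
  have "bprob p ?A (turannical (Suc k) n) \<le> bprob p ?A (\<lambda>S. (\<forall>i\<in>{..<K}. \<not> splittable k n (S \<inter> H i) (e i)) \<or> B S)"
  proof (intro bprob_mono p)
    fix S assume S: "S \<subseteq> ?A" and T: "turannical (Suc k) n S"
    show "(\<forall>i\<in>{..<K}. \<not> splittable k n (S \<inter> H i) (e i)) \<or> B S"
    proof (rule ccontr)
      assume "\<not> ?thesis"
      then obtain i where i: "i < K" "splittable k n (S \<inter> H i) (e i)" and nB: "\<not> B S" by blast
      have "f \<in> S \<inter> H i" if f: "f \<in> S" "e i \<subseteq> f" for f
      proof -
        have "\<not> e j \<subseteq> f" if j: "j < K" "j \<noteq> i" for j
        proof
          assume "e j \<subseteq> f"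
          then have "f \<in> S \<inter> {f \<in> ?A. e (fst (i, j)) \<union> e (snd (i, j)) \<subseteq> f}" using f S by simp blast
          then have "S \<inter> {f \<in> ?A. e (fst (i, j)) \<union> e (snd (i, j)) \<subseteq> f} \<noteq> {}" by blast
          moreover have "(i, j) \<in> ?I" using i j by auto
          ultimately show False using nB unfolding B_def by blast
        qed
        then show ?thesis using f S unfolding H_def by blast
      qed
      then have "splittable k n S (e i)" using i(2) splittable_antimono by blast
      then show False using splittable_imp_not_turannical[OF _ S ep[OF i(1)]] T k by simp
    qed
  qed
  also have "\<dots> \<le> bprob p ?A (\<lambda>S. \<forall>i\<in>{..<K}. \<not> splittable k n (S \<inter> H i) (e i)) + bprob p ?A B"
    by (intro bprob_disj_le p)
  also have "bprob p ?A (\<lambda>S. \<forall>i\<in>{..<K}. \<not> splittable k n (S \<inter> H i) (e i))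
      = (\<Prod>i\<in>{..<K}. bprob p ?A (\<lambda>S. \<not> splittable k n (S \<inter> H i) (e i)))"
    by (rule bprob_indep_family[OF finite_lessThan finA HA disj p(1,2), where Q = "\<lambda>i T. \<not> splittable k n T (e i)"])
  also have "\<dots> \<le> (\<Prod>i\<in>{..<K}. 1 - \<beta>)"
  proof (intro prod_mono conjI)
    fix i assume i: "i \<in> {..<K}"
    show "0 \<le> bprob p ?A (\<lambda>S. \<not> splittable k n (S \<inter> H i) (e i))" by (intro bexp_nonneg p) auto
    have "bprob p ?A (\<lambda>S. \<not> splittable k n (S \<inter> H i) (e i)) \<le> bprob p ?A (\<lambda>S. \<not> splittable k n S (e i))"
    proof (intro bprob_mono p notI)
      fix S assume "\<not> splittable k n (S \<inter> H i) (e i)" "splittable k n S (e i)"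
      then show False using splittable_antimono[of k n S "e i" "S \<inter> H i"] by blast
    qed
    also have "\<dots> \<le> 1 - \<beta>" using \<beta>[OF ep, of i] i bprob_not[OF finA, of p "\<lambda>S. splittable k n S (e i)"] by simp
    finally show "bprob p ?A (\<lambda>S. \<not> splittable k n (S \<inter> H i) (e i)) \<le> 1 - \<beta>" .
  qed
  finally show ?thesis using pB by simp
qed

section \<open>The sharp threshold\<close>

lemma turannical_mono:
  assumes "turannical r n S" "S \<subseteq> T" "T \<subseteq> [{1..n}]\<^bsup>r\<^esup>"
  shows "turannical r n T"
  using assms unfolding turannical_def detects_def by blast

lemma prob_turannical_mono:
  assumes "0 \<le> p" "p \<le> p'" "p' \<le> 1"
  shows "bprob p ([{1..n}]\<^bsup>r\<^esup>) (turannical r n) \<le> bprob p' ([{1..n}]\<^bsup>r\<^esup>) (turannical r n)"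
proof (rule bprob_up_mono[OF _ assms])
  show "finite ([{1..n}]\<^bsup>r\<^esup>)" by (simp add: finite_imp_finite_nsets)
qed (rule turannical_mono)

lemma turannical_dichotomy:
  fixes k :: nat and \<gamma> c C \<eta> :: real
  assumes k: "k \<ge> 2" and \<gamma>: "0 < \<gamma>" "\<gamma> \<le> C" and c: "0 < c" and \<eta>: "0 < \<eta>"
  shows "\<forall>\<^sub>F n in sequentially. \<forall>p p'. 0 \<le> p \<and> p' \<le> 1 \<and> c \<le> p' * real n ^ (k - 2) \<and> p' * real n ^ (k - 2) \<le> C \<and>
      p * real n ^ (k - 2) + \<gamma> \<le> p' * real n ^ (k - 2) \<longrightarrow>
    1 - \<eta> \<le> bprob p' ([{1..n}]\<^bsup>Suc k\<^esup>) (turannical (Suc k) n) \<or>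
    bprob p ([{1..n}]\<^bsup>Suc k\<^esup>) (turannical (Suc k) n) \<le> \<eta>"
proof -
  have C: "C > 0" using \<gamma> by simp
  have k0: "real k > 0" using k by simp
  define g where "g = \<gamma> / C"
  have g: "0 < g" "g \<le> 1" using \<gamma> C by (auto simp: g_def)
  define D where "D = nat \<lceil>16 * real k * real (Suc k) * C\<rceil>"
  have D: "16 * real k * real (Suc k) * C \<le> real D" unfolding D_def by (rule real_nat_ceiling_ge)
  define \<beta> where "\<beta> = g ^ D / 4"
  have \<beta>: "0 < \<beta>" "\<beta> < 1" using g power_le_one[of g D] by (auto simp: \<beta>_def)
  define \<kappa> where "\<kappa> = g ^ D / (8 * real k)"
  have \<kappa>: "\<kappa> > 0" using g k0 by (simp add: \<kappa>_def)
  define \<epsilon> where "\<epsilon> = min (\<kappa> / (4 * real k)) (1 / (4 * real k))"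
  have \<epsilon>: "\<epsilon> > 0" using \<kappa> k0 by (simp add: \<epsilon>_def)
  define \<delta> where "\<delta> = min (\<kappa> / 48) C"
  have \<delta>: "0 < \<delta>" "\<delta> \<le> C" using \<kappa> C by (auto simp: \<delta>_def)
  have "\<exists>K. (1 - \<beta>) ^ K < \<eta> / 2" by (rule real_arch_pow_inv) (use \<eta> \<beta> in auto)
  then obtain K where K: "(1 - \<beta>) ^ K < \<eta> / 2" by blast
  define d where "d = \<delta>\<^sup>2 / C"
  have d: "d > 0" using \<delta> C by (simp add: d_def)
  have e1: "\<forall>\<^sub>F n in sequentially. (real n)\<^sup>2 * exp (- (d * real n)) < \<eta> / 2"
  proof -
    have "(\<lambda>n. (real n)\<^sup>2 * exp (- (d * real n))) \<longlonglongrightarrow> 0" using d by real_asymp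
    then show ?thesis using \<eta> by (intro order_tendstoD(2)) auto
  qed
  have e2: "\<forall>\<^sub>F n in sequentially. (real K)\<^sup>2 * (C / real n) < \<eta> / 2"
  proof -
    have "(\<lambda>n. (real K)\<^sup>2 * (C / real n)) \<longlonglongrightarrow> 0" by real_asymp
    then show ?thesis using \<eta> by (intro order_tendstoD(2)) auto
  qed
  have e3: "\<forall>\<^sub>F n in sequentially. 2 * real k \<le> \<kappa> * real n" using \<kappa> by real_asymp
  have e4: "\<forall>\<^sub>F n in sequentially. 8 * k + 2 * K < n" by (rule eventually_gt_at_top)
  have \<eta>2: "\<eta> / 2 > 0" using \<eta> by simp
  show ?thesis
    using prob_rich_not_turannical[OF k \<delta>(1) \<epsilon> c C \<eta>2] e1 e2 e3 e4
  proof eventually_elim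
    case (elim n)
    note U = elim(1) and e = elim(2-5)
    have n: "n > 0" using e(4) by simp
    define X where "X = real n ^ (k - 2)"
    have X: "X > 0" using n by (simp add: X_def)
    let ?A = "[{1..n}]\<^bsup>Suc k\<^esup>" and ?P = "[{1..n}]\<^bsup>2\<^esup>"
    let ?T = "turannical (Suc k) n"
    have finA: "finite ?A" and finP: "finite ?P" by (simp_all add: finite_imp_finite_nsets)
    have large: "real n / (2 * real k) \<le> real n / real k - \<epsilon> * real n - 2"
    proof -
      have "\<epsilon> * real n \<le> 1 / (4 * real k) * real n" by (intro mult_right_mono) (auto simp: \<epsilon>_def)
      moreover have "8 * real k \<le> real n" using e(4) by linarith
      then have "2 \<le> real n / (4 * real k)" using k0 by (simp add: field_simps)
      moreover have "real n / real k = real n / (2 * real k) + real n / (4 * real k) + real n / (4 * real k)"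
        using k0 by (simp add: field_simps)
      ultimately show ?thesis by simp
    qed
    have big: "real k * (\<epsilon> * real n + 1) + 12 * \<delta> * real n \<le> g ^ D / (8 * real k) * real n"
    proof -
      have "\<epsilon> \<le> \<kappa> / (4 * real k)" by (simp add: \<epsilon>_def)
      then have "real k * \<epsilon> \<le> \<kappa> / 4" using k0 by (simp add: field_simps)
      then have "real k * \<epsilon> * real n \<le> \<kappa> / 4 * real n" by (intro mult_right_mono) auto
      moreover have "12 * \<delta> \<le> \<kappa> / 4" by (simp add: \<delta>_def)
      then have "12 * \<delta> * real n \<le> \<kappa> / 4 * real n" by (intro mult_right_mono) auto
      ultimately show ?thesis using e(3) unfolding \<kappa>_def[symmetric] by (simp add: algebra_simps)
    qed
    show ?case
    proof (intro allI impI, elim conjE)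
      fix p p' :: real
      assume p: "0 \<le> p" "p' \<le> 1" "c \<le> p' * real n ^ (k - 2)" "p' * real n ^ (k - 2) \<le> C"
        "p * real n ^ (k - 2) + \<gamma> \<le> p' * real n ^ (k - 2)"
      have "0 < p' * X" using p(3) c by (simp add: X_def)
      then have p'0: "p' > 0" using X by (simp add: zero_less_mult_iff)
      have pp: "p < p'"
      proof -
        have "p * X < p' * X" using p(5) \<gamma> by (simp add: X_def)
        then show ?thesis using X by simp
      qed
      define q where "q = p / p'"
      have q: "0 \<le> q" "p = p' * q" using p p'0 by (auto simp: q_def)
      have q1: "q \<le> 1 - g"
      proof -
        have "g * (p' * X) \<le> \<gamma>"
          using p(4) g C unfolding X_def[symmetric] by (simp add: g_def field_simps \<gamma>(1))
        then have "p * X \<le> (1 - g) * p' * X" using p(5) unfolding X_def[symmetric] by (simp add: algebra_simps)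
        then have "p \<le> (1 - g) * p'" using X by simp
        then show ?thesis using p'0 by (simp add: q_def divide_le_eq)
      qed
      show "1 - \<eta> \<le> bprob p' ?A ?T \<or> bprob p ?A ?T \<le> \<eta>"
      proof (rule disjCI)
        assume "\<not> bprob p ?A ?T \<le> \<eta>"
        then have np: "bprob p ?A ?T > \<eta>" by simp
        have poor: "bprob p' ?A (\<lambda>S. \<not> rich k n \<epsilon> \<delta> S e) \<le> exp (- (d * real n))" if e0: "e \<in> ?P" for e
        proof (rule ccontr)
          assume "\<not> ?thesis"
          then have h: "exp (- (d * real n)) \<le> bprob p' ?A (\<lambda>S. \<not> rich k n \<epsilon> \<delta> S e)" by simp
          have "\<beta> \<le> bprob p ?A (\<lambda>S. splittable k n S e')" if e': "e' \<in> ?P" for e'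
          proof -
            have p0: "0 \<le> p'" using p'0 by simp
            have "exp (- (d * real n)) \<le> bprob p' ?A (\<lambda>S. \<not> rich k n \<epsilon> \<delta> S e')"
              using h prob_rich_symmetric[OF e0 e' p0 p(2), of k \<epsilon> \<delta>] by linarith
            then show ?thesis
              unfolding \<beta>_def d_def
              using prob_splittable_ge[OF k e' n p0 p(2) p(4) q(2) q(1) q1 g \<delta> less_imp_le[OF \<epsilon>] D large big] by blast
          qed
          then have "bprob p ?A ?T \<le> (1 - \<beta>) ^ K + (real K)\<^sup>2 * (C / real n)"
            using e(4) p pp n \<gamma> by (intro prob_turannical_le k) auto
          then show False using K e(2) np by linarith
        qed
        have "bprob p' ?A (\<lambda>S. \<exists>e\<in>?P. \<not> rich k n \<epsilon> \<delta> S e) \<le> real (card ?P) * exp (- (d * real n))"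
          using p'0 p by (intro bprob_Bex_le_const finP poor) auto
        also have "\<dots> \<le> (real n)\<^sup>2 * exp (- (d * real n))"
        proof (intro mult_right_mono)
          show "real (card ?P) \<le> (real n)\<^sup>2"
            unfolding of_nat_power[symmetric] of_nat_le_iff by (rule card_pairs_le)
        qed simp
        also have "\<dots> < \<eta> / 2" by (rule e(1))
        finally have 1: "bprob p' ?A (\<lambda>S. \<exists>e\<in>?P. \<not> rich k n \<epsilon> \<delta> S e) < \<eta> / 2" .
        have 2: "bprob p' ?A (\<lambda>S. (\<forall>e\<in>?P. rich k n \<epsilon> \<delta> S e) \<and> \<not> ?T S) \<le> \<eta> / 2"
          using U p p'0 by simp
        have "bprob p' ?A (\<lambda>S. \<not> ?T S) \<le> bprob p' ?A (\<lambda>S. (\<exists>e\<in>?P. \<not> rich k n \<epsilon> \<delta> S e) \<or>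
             ((\<forall>e\<in>?P. rich k n \<epsilon> \<delta> S e) \<and> \<not> ?T S))"
          using p p'0 by (intro bprob_mono) auto
        also have "\<dots> \<le> bprob p' ?A (\<lambda>S. \<exists>e\<in>?P. \<not> rich k n \<epsilon> \<delta> S e) +
            bprob p' ?A (\<lambda>S. (\<forall>e\<in>?P. rich k n \<epsilon> \<delta> S e) \<and> \<not> ?T S)"
          using p p'0 by (intro bprob_disj_le) auto
        finally have "bprob p' ?A (\<lambda>S. \<not> ?T S) \<le> \<eta>" using 1 2 by linarith
        then show "1 - \<eta> \<le> bprob p' ?A ?T" using bprob_not[OF finA, of p' ?T] by linarith
      qed
    qed
  qed
qed

lemma card_rainbow_sets_ge:
  fixes n k :: nat
  assumes k: "k \<ge> 2" and e: "e \<in> [{1..n}]\<^bsup>2\<^esup>" and \<phi>: "\<And>v. v \<in> {1..n} \<Longrightarrow> \<phi> v < k" and mono: "mono_col \<phi> e"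
    and cls: "\<And>j. j < k \<Longrightarrow> b \<le> real (card {v \<in> {1..n}. \<phi> v = j})" and b: "0 \<le> b"
  shows "b ^ (k - 1) \<le> real (card (rainbow_sets ([{1..n}]\<^bsup>Suc k\<^esup>) \<phi> e))"
proof -
  let ?A = "[{1..n}]\<^bsup>Suc k\<^esup>" and ?V = "{1..n}"
  have finA: "finite ?A" by (simp add: finite_imp_finite_nsets)
  have e2: "e \<subseteq> ?V" "finite e" "card e = 2" using e by (auto simp: nsets_def)
  then have "e \<noteq> {}" by auto
  then obtain u where u: "u \<in> e" by blast
  have eu: "\<phi> x = \<phi> u" if "x \<in> e" for x using mono u that unfolding mono_col_def by blast
  define J where "J = {..<k} - {\<phi> u}"
  have uk: "\<phi> u < k" using \<phi> u e2 by blast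
  have cJ: "card J = k - 1" using uk by (simp add: J_def)
  define T where "T = (\<lambda>x. x ` J) ` (\<Pi>\<^sub>E j\<in>J. {v \<in> ?V. \<phi> v = j})"
  have T: "h \<subseteq> ?V" "inj_on \<phi> h" "card h = k - 1" "\<phi> ` h = J" if hT: "h \<in> T" for h
  proof -
    from hT[unfolded T_def] obtain x where x: "h = x ` J" "x \<in> (\<Pi>\<^sub>E j\<in>J. {v \<in> ?V. \<phi> v = j})"
      by (rule imageE)
    show "h \<subseteq> ?V" "inj_on \<phi> h" "card h = k - 1" "\<phi> ` h = J"
      unfolding x(1) using transversal_props[OF x(2)] cJ by simp_all
  qed
  have dis: "e \<inter> h = {}" if "h \<in> T" for h
  proof (rule ccontr)
    assume "e \<inter> h \<noteq> {}"
    then obtain x where x: "x \<in> e" "x \<in> h" by blast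
    then have "\<phi> x \<in> J" using T(4)[OF that] by blast
    then show False using eu[OF x(1)] by (simp add: J_def)
  qed
  have sub: "(\<lambda>h. e \<union> h) ` T \<subseteq> rainbow_sets ?A \<phi> e"
  proof (intro image_subsetI)
    fix h assume h: "h \<in> T"
    have finh: "finite h" using T(1)[OF h] finite_subset by blast
    have "card (e \<union> h) = Suc k" using dis[OF h] finh e2 T(3)[OF h] k by (simp add: card_Un_disjoint)
    then have "e \<union> h \<in> ?A" using T(1)[OF h] e2 finh by (auto simp: nsets_def)
    moreover have "rainbow \<phi> e (e \<union> h)"
      unfolding rainbow_def
    proof (intro ballI impI)
      fix x y assume xy: "x \<in> e \<union> h" "y \<in> e \<union> h" "x \<noteq> y \<and> {x, y} \<noteq> e"
      have hJ: "\<phi> z \<noteq> \<phi> u" if "z \<in> h" for z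
      proof -
        have "\<phi> z \<in> J" using T(4)[OF h] that by blast
        then show ?thesis by (simp add: J_def)
      qed
      have "\<not> (x \<in> e \<and> y \<in> e)"
      proof
        assume "x \<in> e \<and> y \<in> e"
        then have "{x, y} \<subseteq> e" "card {x, y} = card e" using xy(3) e2 by auto
        then have "{x, y} = e" by (intro card_subset_eq e2)
        then show False using xy(3) by simp
      qed
      then consider "x \<in> e" "y \<in> h" | "x \<in> h" "y \<in> e" | "x \<in> h" "y \<in> h" using xy by blast
      then show "\<phi> x \<noteq> \<phi> y"
      proof cases
        case 1
        then show ?thesis using eu[of x] hJ[of y] by simp
      next
        case 2
        then show ?thesis using eu[of y] hJ[of x] by simp
      next
        case 3
        then show ?thesis using T(2)[OF h] xy(3) by (meson inj_onD)
      qed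
    qed
    ultimately show "e \<union> h \<in> rainbow_sets ?A \<phi> e" by (simp add: rainbow_sets_def)
  qed
  have "inj_on (\<lambda>h. e \<union> h) T"
  proof (rule inj_onI)
    fix h h' assume h: "h \<in> T" "h' \<in> T" "e \<union> h = e \<union> h'"
    then show "h = h'" using dis[OF h(1)] dis[OF h(2)] by blast
  qed
  then have "card T = card ((\<lambda>h. e \<union> h) ` T)" by (rule card_image[symmetric])
  also have "\<dots> \<le> card (rainbow_sets ?A \<phi> e)"
  proof (rule card_mono[OF _ sub])
    have "rainbow_sets ?A \<phi> e \<subseteq> ?A" by (auto simp: rainbow_sets_def)
    then show "finite (rainbow_sets ?A \<phi> e)" using finA finite_subset by blast
  qed
  finally have le: "real (card T) \<le> real (card (rainbow_sets ?A \<phi> e))" by simp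
  have "b ^ (k - 1) = (\<Prod>j\<in>J. b)" using cJ by simp
  also have "\<dots> \<le> (\<Prod>j\<in>J. real (card {v \<in> ?V. \<phi> v = j}))"
    using cls b by (intro prod_mono) (auto simp: J_def)
  also have "\<dots> = real (\<Prod>j\<in>J. card {v \<in> ?V. \<phi> v = j})" by (rule of_nat_prod[symmetric])
  also have "(\<Prod>j\<in>J. card {v \<in> ?V. \<phi> v = j}) = card T"
    unfolding T_def by (rule card_transversals[symmetric]) (auto simp: J_def)
  finally show ?thesis using le by linarith
qed

lemma bexp_one: "finite A \<Longrightarrow> bexp 1 A f = f A"
  by (induction A arbitrary: f rule: finite_induct) (simp_all add: bexp_insert)

lemma prob_turannical_large:
  fixes k :: nat
  assumes k: "k \<ge> 2"
  shows "\<exists>C\<ge>1. \<forall>\<eta>>0. \<forall>\<^sub>F n in sequentially. \<forall>p. 0 \<le> p \<and> p \<le> 1 \<and> (p = 1 \<or> C \<le> p * real n ^ (k - 2)) \<longrightarrow>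
    1 - \<eta> \<le> bprob p ([{1..n}]\<^bsup>Suc k\<^esup>) (turannical (Suc k) n)"
proof -
  have k0: "real k > 0" using k by simp
  define a where "a = (1 / (2 * real k)) ^ (k - 1)"
  have a: "0 < a" "a \<le> 1" using k0 k by (auto simp: a_def intro!: power_le_one)
  define C where "C = 2 * (2 + real k) / a"
  have "1 * a \<le> 2 * (2 + real k)" using a k0 by simp
  then have C1: "1 \<le> C" unfolding C_def using a by (simp add: pos_le_divide_eq)
  define \<epsilon> where "\<epsilon> = 1 / (2 * real k)"
  have \<epsilon>: "\<epsilon> > 0" using k0 by (simp add: \<epsilon>_def)
  define \<delta> where "\<delta> = a / 2"
  have \<delta>: "\<delta> > 0" using a by (simp add: \<delta>_def)
  show ?thesis
  proof (intro exI[of _ C] conjI allI impI C1)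
    fix \<eta> :: real assume \<eta>: "\<eta> > 0"
    have \<eta>2: "\<eta> / 2 > 0" using \<eta> by simp
    have C0: "0 < C" using C1 by simp
    have e1: "\<forall>\<^sub>F n in sequentially. (real n)\<^sup>2 * exp (- real n) < \<eta> / 2"
    proof -
      have "(\<lambda>n. (real n)\<^sup>2 * exp (- real n)) \<longlonglongrightarrow> 0" by real_asymp
      then show ?thesis using \<eta> by (intro order_tendstoD(2)) auto
    qed
    show "\<forall>\<^sub>F n in sequentially. \<forall>p. 0 \<le> p \<and> p \<le> 1 \<and> (p = 1 \<or> C \<le> p * real n ^ (k - 2)) \<longrightarrow>
      1 - \<eta> \<le> bprob p ([{1..n}]\<^bsup>Suc k\<^esup>) (turannical (Suc k) n)"
      using prob_rich_not_turannical[OF k \<delta> \<epsilon> zero_less_one C0 \<eta>2] e1 eventually_gt_at_top[of 0]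
    proof eventually_elim
      case (elim n)
      note U = elim(1) and e1 = elim(2) and n = elim(3)
      define X where "X = real n ^ (k - 2)"
      have X: "X \<ge> 1" unfolding X_def using n by (intro one_le_power) simp
      define p0 where "p0 = min 1 (C / X)"
      have p0: "0 \<le> p0" "p0 \<le> 1" using X C1 by (auto simp: p0_def)
      have p0X: "p0 * X = min X C" using X by (simp add: p0_def min_mult_distrib_right)
      let ?A = "[{1..n}]\<^bsup>Suc k\<^esup>" and ?P = "[{1..n}]\<^bsup>2\<^esup>" and ?V = "{1..n}"
      let ?T = "turannical (Suc k) n"
      have finA: "finite ?A" and finP: "finite ?P" by (simp_all add: finite_imp_finite_nsets)
      let ?b = "exp (- ((1 + real k) * real n))"
      let ?I = "?P \<times> (?V \<rightarrow>\<^sub>E {..<k})"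
      have finI: "finite ?I" using finP by (intro finite_cartesian_product finite_PiE) auto
      define Q where "Q i S \<longleftrightarrow> near_balanced k n \<epsilon> (snd i) \<and> mono_col (snd i) (fst i) \<and>
        real (card (S \<inter> rainbow_sets ?A (snd i) (fst i))) < \<delta> * real n" for i S
      have one: "bprob p0 ?A (Q i) \<le> ?b" if i: "i \<in> ?I" for i
      proof (cases "near_balanced k n \<epsilon> (snd i) \<and> mono_col (snd i) (fst i)")
        case False
        then have "Q i S = False" for S unfolding Q_def by blast
        then show ?thesis using bexp_const[OF finA, of p0 0] by simp
      next
        case True
        define e where "e = fst i"
        define \<phi> where "\<phi> = snd i"
        have bal: "near_balanced k n \<epsilon> \<phi>" and mono: "mono_col \<phi> e" using True unfolding e_def \<phi>_def by blast+
        have e: "e \<in> ?P" unfolding e_def using i by (rule mem_Times_iff[THEN iffD1, THEN conjunct1])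
        let ?R = "rainbow_sets ?A \<phi> e"
        have RA: "?R \<subseteq> ?A" by (auto simp: rainbow_sets_def)
        have R: "a * real n ^ (k - 1) \<le> real (card ?R)"
        proof -
          have "(\<epsilon> * real n) ^ (k - 1) \<le> real (card ?R)"
          proof (rule card_rainbow_sets_ge[OF k e _ mono])
            show "\<phi> v < k" if "v \<in> {1..n}" for v using bal that unfolding near_balanced_def by blast
            fix j assume "j < k"
            then have "\<bar>real (card {v \<in> {1..n}. \<phi> v = j}) - real n / real k\<bar> \<le> \<epsilon> * real n"
              using bal unfolding near_balanced_def by blast
            moreover have "real n / real k = 2 * (\<epsilon> * real n)" using k0 by (simp add: \<epsilon>_def)
            ultimately show "\<epsilon> * real n \<le> real (card {v \<in> {1..n}. \<phi> v = j})" by linarith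
          qed (use \<epsilon> in simp)
          moreover have "(\<epsilon> * real n) ^ (k - 1) = a * real n ^ (k - 1)"
            unfolding a_def \<epsilon>_def by (rule power_mult_distrib)
          ultimately show ?thesis by (simp only:)
        qed
        have nk: "real n ^ (k - 1) = X * real n"
        proof -
          have "k - 1 = Suc (k - 2)" using k by simp
          then show ?thesis by (simp add: X_def)
        qed
        have Qe: "bprob p0 ?A (Q i) = bprob p0 ?A (\<lambda>S. real (card (S \<inter> ?R)) < \<delta> * real n)"
          using True by (simp add: Q_def e_def \<phi>_def)
        show ?thesis
        proof (cases "p0 = 1")
          case True
          have "\<delta> * real n < a * real n" using a n by (simp add: \<delta>_def)
          also have "\<dots> \<le> a * (X * real n)" using a X n by (intro mult_left_mono) auto
          also have "\<dots> \<le> real (card ?R)" using R nk by simp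
          finally have "\<not> real (card (?A \<inter> ?R)) < \<delta> * real n" using RA by (simp add: Int_absorb1)
          then have "\<not> Q i ?A" by (simp add: Q_def e_def \<phi>_def)
          then show ?thesis unfolding True bexp_one[OF finA] by simp
        next
          case False
          then have "p0 = C / X" using X by (auto simp: p0_def min_def split: if_splits)
          then have "p0 * (a * real n ^ (k - 1)) = C * a * real n" using X nk by (simp add: field_simps)
          moreover have "p0 * (a * real n ^ (k - 1)) \<le> p0 * real (card ?R)" using R p0 by (intro mult_left_mono)
          moreover have "C * a = 2 * (2 + real k)" using a by (simp add: C_def)
          ultimately have pr: "2 * (2 + real k) * real n \<le> p0 * real (card ?R)" by simp
          have "bprob p0 ?A (\<lambda>S. real (card (S \<inter> ?R)) < \<delta> * real n) \<le> bprob p0 ?A (\<lambda>S. real (card (S \<inter> ?R)) \<le> \<delta> * real n)"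
            by (intro bprob_mono p0) auto
          also have "\<dots> \<le> exp (\<delta> * real n - p0 * real (card ?R) / 2)" by (intro bprob_card_le finA RA p0)
          also have "\<dots> \<le> ?b"
          proof -
            have "\<delta> * real n \<le> 1 * real n" using a by (intro mult_right_mono) (auto simp: \<delta>_def)
            then show ?thesis using pr by (simp add: algebra_simps)
          qed
          finally show ?thesis unfolding Qe .
        qed
      qed
      have poor0: "bprob p0 ?A (\<lambda>S. \<exists>i\<in>?I. Q i S) < \<eta> / 2"
      proof -
        have "bprob p0 ?A (\<lambda>S. \<exists>i\<in>?I. Q i S) \<le> real (card ?I) * ?b"
          by (rule bprob_Bex_le_const[OF p0 finI one])
        also have "\<dots> \<le> (real n)\<^sup>2 * exp (real k * real n) * ?b"
        proof (rule mult_right_mono)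
          have cI: "real (card ?I) = real (card ?P) * real k ^ n"
            by (simp only: card_cartesian_product card_PiE finite_atLeastAtMost of_nat_mult) simp
          have cP: "real (card ?P) \<le> (real n)\<^sup>2"
            unfolding of_nat_power[symmetric] of_nat_le_iff by (rule card_pairs_le)
          have "real k \<le> exp (real k)" using exp_ge_add_one_self[of "real k"] by linarith
          then have "real k ^ n \<le> exp (real k) ^ n" by (rule power_mono) simp
          also have "exp (real k) ^ n = exp (real n * real k)" by (rule exp_of_nat_mult[symmetric])
          also have "real n * real k = real k * real n" by (rule mult.commute)
          finally show "real (card ?I) \<le> (real n)\<^sup>2 * exp (real k * real n)"
            unfolding cI by (intro mult_mono cP) simp_all
        qed simp
        also have "\<dots> = (real n)\<^sup>2 * exp (- real n)"
        proof -
          have "real k * real n + - ((1 + real k) * real n) = - real n" by (simp add: algebra_simps)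
          then show ?thesis unfolding mult.assoc[of "(real n)\<^sup>2"] exp_add[symmetric] by (simp only:)
        qed
        finally show ?thesis using e1 by (rule le_less_trans)
      qed
      have "bprob p0 ?A (\<lambda>S. \<not> ?T S) \<le> bprob p0 ?A (\<lambda>S. (\<exists>i\<in>?I. Q i S) \<or> ((\<forall>e\<in>?P. rich k n \<epsilon> \<delta> S e) \<and> \<not> ?T S))"
      proof (intro bprob_mono p0)
        fix S assume nT: "\<not> ?T S"
        show "(\<exists>i\<in>?I. Q i S) \<or> ((\<forall>e\<in>?P. rich k n \<epsilon> \<delta> S e) \<and> \<not> ?T S)"
        proof (cases "\<forall>e\<in>?P. rich k n \<epsilon> \<delta> S e")
          case True
          with nT show ?thesis by simp
        next
          case False
          then obtain e where e: "e \<in> ?P" "\<not> rich k n \<epsilon> \<delta> S e" unfolding Set.ball_simps(10) by (elim bexE) (rule that)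
          obtain \<phi> where \<phi>: "near_balanced k n \<epsilon> \<phi>" "mono_col \<phi> e"
            "real (card (S \<inter> rainbow_sets ?A \<phi> e)) < \<delta> * real n"
            using e(2) unfolding rich_def not_all not_imp not_le by (elim exE conjE) (rule that)
          define \<psi> where "\<psi> = restrict \<phi> ?V"
          have \<psi>: "\<psi> v = \<phi> v" if "v \<in> ?V" for v using that by (simp add: \<psi>_def)
          have \<phi>k: "\<phi> v < k" if "v \<in> ?V" for v using \<phi>(1) that unfolding near_balanced_def by blast
          have "{v \<in> ?V. \<psi> v = j} = {v \<in> ?V. \<phi> v = j}" for j by (rule Collect_cong) (use \<psi> in auto)
          then have cl: "card {v \<in> ?V. \<psi> v = j} = card {v \<in> ?V. \<phi> v = j}" for j by (rule arg_cong)
          have 1: "near_balanced k n \<epsilon> \<psi>"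
            unfolding near_balanced_def cl
          proof (intro conjI ballI)
            show "\<psi> v < k" if "v \<in> ?V" for v using \<phi>k[OF that] \<psi>[OF that] by simp
          qed (use \<phi>(1) in \<open>unfold near_balanced_def, blast\<close>)
          have eV: "e \<subseteq> ?V" using e(1) by (auto simp: nsets_def)
          have 2: "mono_col \<psi> e"
            unfolding mono_col_def
          proof (intro ballI)
            fix x y assume xy: "x \<in> e" "y \<in> e"
            then have "\<phi> x = \<phi> y" using \<phi>(2) unfolding mono_col_def by blast
            moreover have "x \<in> ?V" "y \<in> ?V" using xy eV by blast+
            ultimately show "\<psi> x = \<psi> y" using \<psi>[of x] \<psi>[of y] by simp
          qed
          have "rainbow_sets ?A \<psi> e = rainbow_sets ?A \<phi> e"
            unfolding rainbow_sets_def
          proof (intro Collect_cong conj_cong refl)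
            fix f assume "f \<in> ?A"
            then have "\<psi> x = \<phi> x" if "x \<in> f" for x using \<psi>[of x] that by (auto simp: nsets_def)
            then show "rainbow \<psi> e f = rainbow \<phi> e f" by (simp add: rainbow_def)
          qed
          then have "Q (e, \<psi>) S" using 1 2 \<phi>(3) by (simp add: Q_def)
          moreover have "(e, \<psi>) \<in> ?I" using e(1) \<phi>k by (auto simp: \<psi>_def)
          ultimately have "\<exists>i\<in>?I. Q i S" by (rule bexI)
          then show ?thesis ..
        qed
      qed
      also have "\<dots> \<le> bprob p0 ?A (\<lambda>S. \<exists>i\<in>?I. Q i S) + bprob p0 ?A (\<lambda>S. (\<forall>e\<in>?P. rich k n \<epsilon> \<delta> S e) \<and> \<not> ?T S)"
        by (intro bprob_disj_le p0)
      also have "\<dots> \<le> \<eta>"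
      proof -
        have "1 \<le> p0 * real n ^ (k - 2)" "p0 * real n ^ (k - 2) \<le> C"
          unfolding X_def[symmetric] p0X using X C1 by auto
        then have "bprob p0 ?A (\<lambda>S. (\<forall>e\<in>?P. rich k n \<epsilon> \<delta> S e) \<and> \<not> ?T S) \<le> \<eta> / 2"
          using U[rule_format, of p0] p0 by simp
        then show ?thesis using poor0 by linarith
      qed
      finally have T0: "1 - \<eta> \<le> bprob p0 ?A ?T" using bprob_not[OF finA, of p0 ?T] by linarith
      show ?case
      proof (intro allI impI, elim conjE)
        fix p :: real assume p: "0 \<le> p" "p \<le> 1" "p = 1 \<or> C \<le> p * real n ^ (k - 2)"
        have "p0 \<le> p"
          using p(3)
        proof
          assume "C \<le> p * real n ^ (k - 2)"
          then have "C / X \<le> p" using X by (simp add: X_def[symmetric] divide_le_eq)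
          then show ?thesis by (simp add: p0_def)
        qed (use p0 in simp)
        then have "bprob p0 ?A ?T \<le> bprob p ?A ?T" by (intro prob_turannical_mono p0 p)
        then show "1 - \<eta> \<le> bprob p ?A ?T" using T0 by linarith
      qed
    qed
  qed
qed

lemma prob_turannical_small:
  assumes k: "k \<ge> 2" and n: "6 * k \<le> n" "0 < n" and p: "0 \<le> p" "p \<le> 1" "p * real n ^ (k - 2) \<le> 1 / (4 * real k)"
  shows "bprob p ([{1..n}]\<^bsup>Suc k\<^esup>) (turannical (Suc k) n) \<le> 1 / 2"
proof -
  let ?A = "[{1..n}]\<^bsup>Suc k\<^esup>" and ?e = "{1, 2} :: nat set"
  have k0: "real k > 0" using k by simp
  have finA: "finite ?A" by (simp add: finite_imp_finite_nsets)
  have e: "?e \<in> [{1..n}]\<^bsup>2\<^esup>" using n k by (auto simp: nsets_def)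
  define L where "L = {f \<in> ?A. ?e \<subseteq> f}"
  have LA: "L \<subseteq> ?A" by (auto simp: L_def)
  have pL: "p * real (card L) \<le> 1 / (4 * real k) * real n"
    unfolding L_def by (intro expected_supersets_le(1)[OF k n(2) p(1,3)]) auto
  have pos: "real n / (2 * real k) > 0" using n k0 by simp
  have "bprob p ?A (turannical (Suc k) n) \<le> bprob p ?A (\<lambda>S. real (card (S \<inter> L)) \<ge> real n / (2 * real k))"
  proof (intro bprob_mono p)
    fix S assume S: "S \<subseteq> ?A" and T: "turannical (Suc k) n S"
    show "real (card (S \<inter> L)) \<ge> real n / (2 * real k)"
    proof (rule ccontr)
      assume "\<not> ?thesis"
      then have lt: "real (card (S \<inter> L)) < real n / (2 * real k)" by simp
      have SL: "S \<inter> L = {f \<in> S. ?e \<subseteq> f}" using S unfolding L_def by blast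
      have 1: "real n / real k - 1 \<le> real (residue_class_size k n 0)"
        using k by (intro residue_class_size_bounds) simp
      have 2: "real n / real k = real n / (2 * real k) + real n / (2 * real k)" using k0 by (simp add: field_simps)
      have "6 * real k \<le> real n" using n(1) by linarith
      then have 3: "3 \<le> real n / (2 * real k)" using k0 by (simp add: field_simps)
      have "real (card (S \<inter> L)) + 2 \<le> real (residue_class_size k n 0)" using lt 1 2 3 by linarith
      then have "card {f \<in> S. ?e \<subseteq> f} + 2 \<le> residue_class_size k n 0" unfolding SL by linarith
      then have "splittable k n S ?e" by (rule small_link_imp_splittable[OF k S e])
      then show False using splittable_imp_not_turannical[OF _ S e] T k by simp
    qed
  qed
  also have "\<dots> \<le> bexp p ?A (\<lambda>S. real (card (S \<inter> L))) / (real n / (2 * real k))"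
    by (rule bprob_markov[OF p(1,2) pos]) simp
  also have "\<dots> = p * real (card L) / (real n / (2 * real k))" using bexp_card[OF finA LA, of p] by simp
  also have "\<dots> \<le> 1 / (4 * real k) * real n / (real n / (2 * real k))" using pL pos by (intro divide_right_mono) auto
  also have "\<dots> = 1 / 2" using n k0 by (simp add: field_simps)
  finally show ?thesis .
qed

definition clip :: "real \<Rightarrow> real" where
  "clip p = max 0 (min 1 p)"

lemma clip_range [simp]: "0 \<le> clip p" "clip p \<le> 1"
  by (auto simp: clip_def)

lemma clip_mono: "p \<le> p' \<Longrightarrow> clip p \<le> clip p'"
  by (auto simp: clip_def)

lemma clip_id: "0 \<le> p \<Longrightarrow> p \<le> 1 \<Longrightarrow> clip p = p"
  by (simp add: clip_def)

lemma bernoulli_pmf_clip: "bernoulli_pmf p = bernoulli_pmf (clip p)"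
proof (rule pmf_eqI)
  have "min 1 (max 0 (clip p)) = min 1 (max 0 p)" by (simp add: clip_def)
  then show "pmf (bernoulli_pmf p) b = pmf (bernoulli_pmf (clip p)) b" for b
    unfolding bernoulli_pmf.rep_eq o_def by (simp only:)
qed

lemma prob_random_hypergraph_clip:
  "measure_pmf.prob (random_hypergraph r n p) {F. Q F} = bprob (clip p) ([{1..n}]\<^bsup>r\<^esup>) Q"
proof -
  have "random_hypergraph r n p = random_hypergraph r n (clip p)"
    unfolding random_hypergraph_def by (subst bernoulli_pmf_clip) (rule refl)
  then show ?thesis by (simp only: prob_random_hypergraph clip_range)
qed

theorem theorem7p1:
  fixes r :: nat
  assumes "r \<ge> 3"
  shows "\<exists>(c::real) (C::real) (cs::nat \<Rightarrow> real).
    c > 0 \<and> C > 0 \<and> (\<forall>n. cs n \<in> {c<..<C}) \<and>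
    (\<forall>\<gamma>::real. \<gamma> > 0 \<longrightarrow>
      (\<lambda>n. measure_pmf.prob
             (random_hypergraph r n ((cs n - \<gamma>) * real n powi (3 - int r)))
             {F. turannical r n F}) \<longlonglongrightarrow> 0 \<and>
      (\<lambda>n. measure_pmf.prob
             (random_hypergraph r n ((cs n + \<gamma>) * real n powi (3 - int r)))
             {F. turannical r n F}) \<longlonglongrightarrow> 1)"
proof -
  define k where "k = r - 1"
  have r: "r = Suc k" and k: "k \<ge> 2" using assms by (auto simp: k_def)
  have k0: "real k > 0" using k by simp
  define X where "X n = real n ^ (k - 2)" for n
  define h where "h n p = bprob (clip p) ([{1..n}]\<^bsup>Suc k\<^esup>) (turannical (Suc k) n)" for n p
  have h01: "0 \<le> h n p" "h n p \<le> 1" for n p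
  proof -
    show "0 \<le> h n p" unfolding h_def by (rule bexp_nonneg) simp_all
    show "h n p \<le> 1" unfolding h_def by (rule bprob_le_1) (simp_all add: finite_imp_finite_nsets)
  qed
  have hmono: "h n p \<le> h n p'" if "p \<le> p'" for n p p'
    unfolding h_def by (rule prob_turannical_mono[OF clip_range(1) clip_mono[OF that] clip_range(2)])
  from prob_turannical_large[OF k] obtain C0 where C0: "C0 \<ge> 1" and large: "\<forall>\<eta>>0. \<forall>\<^sub>F n in sequentially. \<forall>p. 0 \<le> p \<and> p \<le> 1 \<and>
      (p = 1 \<or> C0 \<le> p * real n ^ (k - 2)) \<longrightarrow> 1 - \<eta> \<le> bprob p ([{1..n}]\<^bsup>Suc k\<^esup>) (turannical (Suc k) n)"
    by (elim exE conjE) (rule that)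
  define c0 where "c0 = 1 / (4 * real k)"
  have c0: "c0 > 0" "c0 \<le> 1" using k0 k by (auto simp: c0_def)
  define Y where "Y n = {y. 0 \<le> y \<and> y \<le> C0 \<and> y \<le> X n \<and> h n (y / X n) \<le> 1 / 2}" for n
  define cs where "cs n = max c0 (min C0 (Sup (Y n)))" for n
  have cs_range: "c0 \<le> cs n" "cs n \<le> C0" for n using c0 C0 by (auto simp: cs_def)
  have main: "\<forall>\<^sub>F n in sequentially. h n ((cs n - \<gamma>) / X n) \<le> \<eta> \<and> 1 - \<eta> \<le> h n ((cs n + \<gamma>) / X n)"
    if \<gamma>: "0 < \<gamma>" "\<gamma> \<le> c0 / 2" and \<eta>: "0 < \<eta>" "\<eta> < 1 / 2" for \<gamma> \<eta>
  proof -
    have g2: "0 < \<gamma> / 2" "\<gamma> / 2 \<le> C0 + 1" "0 < c0 / 2" using \<gamma> c0 C0 by auto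
    show ?thesis
      using turannical_dichotomy[OF k g2 \<eta>(1)] large[rule_format, OF \<eta>(1)] eventually_ge_at_top[of "6 * k"] eventually_gt_at_top[of 0]
    proof eventually_elim
      case (elim n)
      note dich = elim(1)[folded X_def, rule_format] and lg = elim(2)[folded X_def, rule_format] and n = elim(3,4)
      have X: "X n \<ge> 1" unfolding X_def using n by (intro one_le_power) simp
      have hp: "h n p = bprob p ([{1..n}]\<^bsup>Suc k\<^esup>) (turannical (Suc k) n)" if "0 \<le> p" "p \<le> 1" for p
        unfolding h_def clip_id[OF that] ..
      have dich': "1 - \<eta> \<le> h n (y' / X n) \<or> h n (y / X n) \<le> \<eta>"
        if y: "0 \<le> y" "y + \<gamma> / 2 \<le> y'" "c0 / 2 \<le> y'" "y' \<le> C0 + 1" "y' \<le> X n" for y y'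
      proof -
        have "y \<le> y'" using y(2) \<gamma> by linarith
        then have p: "0 \<le> y / X n" "y / X n \<le> 1" "0 \<le> y' / X n" "y' / X n \<le> 1" using X y by auto
        have yX: "y / X n * X n = y" "y' / X n * X n = y'" using X by simp_all
        have "0 \<le> y / X n \<and> y' / X n \<le> 1 \<and> c0 / 2 \<le> y' / X n * X n \<and> y' / X n * X n \<le> C0 + 1 \<and>
            y / X n * X n + \<gamma> / 2 \<le> y' / X n * X n"
          unfolding yX using p y by blast
        from dich[OF this] show ?thesis unfolding hp[OF p(1,2)] hp[OF p(3,4)] .
      qed
      have large': "1 - \<eta> \<le> h n (y / X n)" if y: "X n \<le> y \<or> C0 \<le> y" for y
      proof (cases "X n \<le> y")
        case True
        have "1 - \<eta> \<le> h n 1" unfolding hp[OF zero_le_one order_refl] by (rule lg) simp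
        also have "\<dots> \<le> h n (y / X n)" using True X by (intro hmono) simp
        finally show ?thesis .
      next
        case False
        then have y': "C0 \<le> y" "y < X n" using y by auto
        then have p: "0 \<le> y / X n" "y / X n \<le> 1" using X C0 by auto
        have "y / X n * X n = y" using X by simp
        then show ?thesis unfolding hp[OF p] using p y'(1) by (intro lg) simp
      qed
      have c0Y: "c0 \<in> Y n"
      proof -
        have p: "0 \<le> c0 / X n" "c0 / X n \<le> 1" using c0 X by auto
        have "c0 / X n * X n \<le> 1 / (4 * real k)" using X by (simp add: c0_def)
        then have "h n (c0 / X n) \<le> 1 / 2"
          unfolding hp[OF p] unfolding X_def by (intro prob_turannical_small[OF k n] p[unfolded X_def])
        then show ?thesis using c0 C0 X by (simp add: Y_def)
      qed
      have bdd: "bdd_above (Y n)" by (rule bdd_aboveI[of _ C0]) (simp add: Y_def)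
      have "Sup (Y n) \<le> C0" using c0Y by (intro cSup_least) (auto simp: Y_def)
      moreover have "c0 \<le> Sup (Y n)" by (rule cSup_upper[OF c0Y bdd])
      ultimately have cs: "cs n = Sup (Y n)" by (simp add: cs_def)
      show ?case
      proof
        have "cs n - \<gamma> / 2 < Sup (Y n)" using cs \<gamma> by simp
        then obtain y where y: "y \<in> Y n" "cs n - \<gamma> / 2 < y"
          using less_cSup_iff[OF _ bdd, of "cs n - \<gamma> / 2"] c0Y by blast
        then have "h n ((cs n - \<gamma> / 2) / X n) \<le> h n (y / X n)"
          using X by (intro hmono divide_right_mono) auto
        also have "\<dots> \<le> 1 / 2" using y(1) by (simp add: Y_def)
        finally have "\<not> 1 - \<eta> \<le> h n ((cs n - \<gamma> / 2) / X n)" using \<eta> by linarith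
        moreover have "cs n - \<gamma> / 2 \<le> X n" using y by (simp add: Y_def)
        ultimately show "h n ((cs n - \<gamma>) / X n) \<le> \<eta>"
          using dich'[of "cs n - \<gamma>" "cs n - \<gamma> / 2"] \<gamma> c0 cs_range[of n] by simp
        show "1 - \<eta> \<le> h n ((cs n + \<gamma>) / X n)"
        proof (cases "X n \<le> cs n + \<gamma> \<or> C0 \<le> cs n + \<gamma>")
          case True
          then show ?thesis by (rule large')
        next
          case False
          then have "cs n + \<gamma> / 2 \<notin> Y n"
            using cSup_upper[OF _ bdd, of "cs n + \<gamma> / 2"] cs \<gamma> by auto
          then have "\<not> h n ((cs n + \<gamma> / 2) / X n) \<le> 1 / 2"
            using False \<gamma> c0 cs_range(1)[of n] by (auto simp: Y_def)
          then have "\<not> h n ((cs n + \<gamma> / 2) / X n) \<le> \<eta>" using \<eta> by linarith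
          then show ?thesis
            using dich'[of "cs n + \<gamma> / 2" "cs n + \<gamma>"] False \<gamma> c0 cs_range[of n] by simp
        qed
      qed
    qed
  qed
  have powi: "x * real n powi (3 - int r) = x / X n" if "n > 0" for n x
  proof -
    have "3 - int r = - int (k - 2)" using k by (simp add: r of_nat_diff)
    then show ?thesis by (simp add: X_def power_int_minus divide_inverse)
  qed
  have limits: "(\<lambda>n. h n ((cs n - \<gamma>) / X n)) \<longlonglongrightarrow> 0" "(\<lambda>n. h n ((cs n + \<gamma>) / X n)) \<longlonglongrightarrow> 1" if \<gamma>: "\<gamma> > 0" for \<gamma>
  proof -
    define \<gamma>' where "\<gamma>' = min \<gamma> (c0 / 2)"
    have \<gamma>': "0 < \<gamma>'" "\<gamma>' \<le> c0 / 2" "\<gamma>' \<le> \<gamma>" using \<gamma> c0 by (auto simp: \<gamma>'_def)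
    have Xge: "0 \<le> X n" for n by (simp add: X_def)
    have ev: "\<forall>\<^sub>F n in sequentially. h n ((cs n - \<gamma>) / X n) \<le> \<eta> \<and> 1 - \<eta> \<le> h n ((cs n + \<gamma>) / X n)"
      if \<eta>: "0 < \<eta>" "\<eta> < 1 / 2" for \<eta>
      using main[OF \<gamma>'(1,2) \<eta>]
    proof eventually_elim
      case (elim n)
      have "h n ((cs n - \<gamma>) / X n) \<le> h n ((cs n - \<gamma>') / X n)"
        using \<gamma>'(3) Xge by (intro hmono divide_right_mono) auto
      moreover have "h n ((cs n + \<gamma>') / X n) \<le> h n ((cs n + \<gamma>) / X n)"
        using \<gamma>'(3) Xge by (intro hmono divide_right_mono) auto
      ultimately show ?case using elim by linarith
    qed
    have small: "\<forall>\<^sub>F n in sequentially. h n ((cs n - \<gamma>) / X n) < e \<and> 1 - e < h n ((cs n + \<gamma>) / X n)"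
      if e: "e > 0" for e
    proof -
      have m: "0 < min (e / 2) (1 / 4)" "min (e / 2) (1 / 4) < 1 / 2" and me: "min (e / 2) (1 / 4) \<le> e / 2"
        using e by linarith+
      from ev[OF m] show ?thesis
      proof eventually_elim
        case (elim n)
        then show ?case using me e by linarith
      qed
    qed
    show "(\<lambda>n. h n ((cs n - \<gamma>) / X n)) \<longlonglongrightarrow> 0"
    proof (rule tendstoI)
      fix e :: real assume "0 < e"
      from small[OF this] show "\<forall>\<^sub>F n in sequentially. dist (h n ((cs n - \<gamma>) / X n)) 0 < e"
        by eventually_elim (simp add: dist_real_def h01)
    qed
    show "(\<lambda>n. h n ((cs n + \<gamma>) / X n)) \<longlonglongrightarrow> 1"
    proof (rule tendstoI)
      fix e :: real assume "0 < e"
      from small[OF this] show "\<forall>\<^sub>F n in sequentially. dist (h n ((cs n + \<gamma>) / X n)) 1 < e"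
      proof eventually_elim
        case (elim n)
        then show ?case using h01(2)[of n "(cs n + \<gamma>) / X n"] unfolding dist_real_def by linarith
      qed
    qed
  qed
  have eq: "\<forall>\<^sub>F n in sequentially. h n (x n / X n) = measure_pmf.prob
       (random_hypergraph r n (x n * real n powi (3 - int r))) {F. turannical r n F}" for x
    using eventually_gt_at_top[of 0]
  proof eventually_elim
    case (elim n)
    show ?case unfolding powi[OF elim] unfolding prob_random_hypergraph_clip h_def r ..
  qed
  show ?thesis
  proof (rule exI[of _ "c0 / 2"], rule exI[of _ "C0 + 1"], rule exI[of _ cs], intro conjI allI impI)
    show "cs n \<in> {c0 / 2<..<C0 + 1}" for n using cs_range[of n] c0 by auto
    fix \<gamma> :: real assume \<gamma>: "\<gamma> > 0"
    show "(\<lambda>n. measure_pmf.prob (random_hypergraph r n ((cs n - \<gamma>) * real n powi (3 - int r)))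
        {F. turannical r n F}) \<longlonglongrightarrow> 0"
      using limits(1)[OF \<gamma>] eq by (rule Lim_transform_eventually)
    show "(\<lambda>n. measure_pmf.prob (random_hypergraph r n ((cs n + \<gamma>) * real n powi (3 - int r)))
        {F. turannical r n F}) \<longlonglongrightarrow> 1"
      using limits(2)[OF \<gamma>] eq by (rule Lim_transform_eventually)
  qed (use c0 C0 in auto)
qed

end
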